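(* A binary linear code $\mathcal{C}\subseteq GF(2)^n$ has a geometric representation embeddable into $\mathbb{R}^3$ if and only if there exists a graph $G$ (loops and parallel edges allowed) with edge set $\{e_1,\dots,e_n\}$ such that $\mathcal{C}$ equals the cut space of $G$.
   Context: A binary linear code of length $n$ is a linear subspace $\mathcal{C}\subseteq GF(2)^n$. A triangular configuration is a finite two-dimensional simplicial complex (finite set of geometric simplices closed under faces, any two intersecting in a common face or not at all) in which every maximal simplex is a triangle or a segment; $T(\Delta)$ is its set of triangles. Its incidence matrix over $GF(2)$ has rows indexed by edges and columns by triangles, entry $1$ iff the edge is a side of the triangle; $\ker\Delta\subseteq GF(2)^{T(\Delta)}$ is the kernel. Puncturing a code along a set $S$ of coordinates deletes the entries indexed by $S$; the result is $\mathcal{D}/S$. $\mathcal{C}$ has a geometric representation if there is a triangular configuration $\Delta$ and $S\subseteq T(\Delta)$ such that, after identifying $T(\Delta)\setminus S$ with $\{1,\dots,n\}$ by a suitable bijection, $\mathcal{C}=\ker\Delta/S$ and $\dim\mathcal{C}=\dim\ker\Delta$; it is embeddable into $\mathbb{R}^k$ if $\Delta$ is isomorphic to a triangular configuration lying in $\mathbb{R}^k$. The cut space of a graph $G$ with edges $e_1,\dots,e_n$ is the subspace of $GF(2)^n$ spanned by the incidence vectors of the edge cuts $\delta(X)$, $X\subseteq V(G)$, where $\delta(X)$ is the set of edges with exactly one end in $X$. *)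

theory Defs
  imports
    "HOL-Analysis.Analysis"
    "HOL-Library.Function_Algebras"
    "HOL-Analysis.Finite_Function_Topology"
    "HOL-Library.Uprod"
    "HOL-Library.Z2"
begin

section \<open>Binary codes\<close>

text \<open>
  For a finite index set \<open>I\<close> the space \<open>GF(2)\<^sup>I\<close> is rendered by the functions into \<^typ>\<open>bit\<close>
  that vanish outside \<open>I\<close>; in particular \<open>GF(2)\<^sup>n\<close> is \<open>GF2_space {1..n}\<close>. All these spaces are
  subspaces of the full function space over the field \<^typ>\<open>bit\<close>.
\<close>

definition GF2_scale :: "bit \<Rightarrow> ('i \<Rightarrow> bit) \<Rightarrow> 'i \<Rightarrow> bit" where
  "GF2_scale c x = (\<lambda>i. c * x i)"

interpretation GF2: vector_space "GF2_scale :: bit \<Rightarrow> ('i \<Rightarrow> bit) \<Rightarrow> 'i \<Rightarrow> bit"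
  by standard (auto simp: GF2_scale_def fun_eq_iff algebra_simps)

definition GF2_space :: "'i set \<Rightarrow> ('i \<Rightarrow> bit) set" where
  "GF2_space I = {x. \<forall>i. i \<notin> I \<longrightarrow> x i = 0}"

definition binary_linear_code :: "nat \<Rightarrow> (nat \<Rightarrow> bit) set \<Rightarrow> bool" where
  "binary_linear_code n C \<longleftrightarrow> C \<subseteq> GF2_space {1..n} \<and> GF2.subspace C"

text \<open>
  Since entries outside the index set are \<open>0\<close>, deleting the entries indexed by \<open>S\<close> from a code in
  \<open>GF2_space I\<close> means overwriting them by \<open>0\<close>; the result lies in \<open>GF2_space (I - S)\<close>.
\<close>

definition puncture :: "('i \<Rightarrow> bit) set \<Rightarrow> 'i set \<Rightarrow> ('i \<Rightarrow> bit) set" where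
  "puncture D S = (\<lambda>x i. if i \<in> S then 0 else x i) ` D"

definition relabel :: "nat \<Rightarrow> (nat \<Rightarrow> 'i) \<Rightarrow> ('i \<Rightarrow> bit) set \<Rightarrow> (nat \<Rightarrow> bit) set" where
  "relabel n \<phi> D = (\<lambda>y i. if i \<in> {1..n} then y (\<phi> i) else 0) ` D"


section \<open>Triangular configurations\<close>

text \<open>
  The next two definitions are those of \<^const>\<open>simplex\<close> and \<^const>\<open>simplicial_complex\<close>, stated
  for an arbitrary real vector space instead of a Euclidean space. The empty set is the
  \<open>(-1)\<close>-dimensional simplex and a face of every simplex.
\<close>

definition geom_simplex :: "int \<Rightarrow> 'a::real_vector set \<Rightarrow> bool" where
  "geom_simplex n s \<longleftrightarrow>
     (\<exists>V. finite V \<and> \<not> affine_dependent V \<and> int (card V) = n + 1 \<and> s = convex hull V)"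

definition geom_complex :: "'a::real_vector set set \<Rightarrow> bool" where
  "geom_complex \<Delta> \<longleftrightarrow>
     finite \<Delta> \<and>
     (\<forall>s\<in>\<Delta>. \<exists>n. geom_simplex n s) \<and>
     (\<forall>f s. s \<in> \<Delta> \<and> f face_of s \<longrightarrow> f \<in> \<Delta>) \<and>
     (\<forall>s t. s \<in> \<Delta> \<and> t \<in> \<Delta> \<longrightarrow> (s \<inter> t) face_of s)"

lemma geom_simplex_iff_simplex: "geom_simplex n s \<longleftrightarrow> n simplex s"
  for s :: "'a::euclidean_space set"
  unfolding geom_simplex_def simplex by auto

lemma geom_complex_iff_simplicial_complex: "geom_complex \<Delta> \<longleftrightarrow> simplicial_complex \<Delta>"
  for \<Delta> :: "'a::euclidean_space set set"
  unfolding geom_complex_def simplicial_complex_def geom_simplex_iff_simplex by simp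

definition triangles :: "'a::real_vector set set \<Rightarrow> 'a set set" where
  "triangles \<Delta> = {t \<in> \<Delta>. geom_simplex 2 t}"

definition edges :: "'a::real_vector set set \<Rightarrow> 'a set set" where
  "edges \<Delta> = {e \<in> \<Delta>. geom_simplex 1 e}"

text \<open>
  The last conjunct bounds the dimension of the complex by \<open>2\<close>; together with the existence of a
  triangle the dimension is exactly \<open>2\<close>.
\<close>

definition triangular_configuration :: "'a::real_vector set set \<Rightarrow> bool" where
  "triangular_configuration \<Delta> \<longleftrightarrow>
     geom_complex \<Delta> \<and>
     triangles \<Delta> \<noteq> {} \<and>
     (\<forall>s\<in>\<Delta>. (\<forall>t\<in>\<Delta>. s \<subseteq> t \<longrightarrow> t = s) \<longrightarrow> geom_simplex 2 s \<or> geom_simplex 1 s)"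

definition incidence :: "'a::real_vector set \<Rightarrow> 'a set \<Rightarrow> bit" where
  "incidence e t = (if e face_of t then 1 else 0)"

definition kernel :: "'a::real_vector set set \<Rightarrow> ('a set \<Rightarrow> bit) set" where
  "kernel \<Delta> =
     {x \<in> GF2_space (triangles \<Delta>). \<forall>e\<in>edges \<Delta>. (\<Sum>t\<in>triangles \<Delta>. incidence e t * x t) = 0}"

text \<open>
  Two complexes are isomorphic if a bijection between their vertices carries the vertex sets of the
  simplices of one onto the vertex sets of the simplices of the other.
\<close>

definition vertex_set :: "'a::real_vector set \<Rightarrow> 'a set" where
  "vertex_set s = {v. v extreme_point_of s}"

definition complex_iso :: "'a::real_vector set set \<Rightarrow> 'b::real_vector set set \<Rightarrow> bool" where
  "complex_iso \<Delta> \<Delta>' \<longleftrightarrow>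
     (\<exists>f. bij_betw f (\<Union>s\<in>\<Delta>. vertex_set s) (\<Union>s\<in>\<Delta>'. vertex_set s) \<and>
          (\<lambda>s. f ` vertex_set s) ` \<Delta> = vertex_set ` \<Delta>')"

definition embeddable_into :: "'b::real_vector itself \<Rightarrow> 'a::real_vector set set \<Rightarrow> bool" where
  "embeddable_into (_ :: 'b itself) \<Delta> \<longleftrightarrow>
     (\<exists>\<Delta>' :: 'b set set. triangular_configuration \<Delta>' \<and> complex_iso \<Delta> \<Delta>')"


section \<open>Geometric representations\<close>

definition geometric_representation ::
  "nat \<Rightarrow> (nat \<Rightarrow> bit) set \<Rightarrow> 'a::real_vector set set \<Rightarrow> 'a set set \<Rightarrow> bool" where
  "geometric_representation n C \<Delta> S \<longleftrightarrow>
     triangular_configuration \<Delta> \<and>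
     S \<subseteq> triangles \<Delta> \<and>
     (\<exists>\<phi>. bij_betw \<phi> {1..n} (triangles \<Delta> - S) \<and> C = relabel n \<phi> (puncture (kernel \<Delta>) S)) \<and>
     GF2.dim C = GF2.dim (kernel \<Delta>)"

text \<open>
  A triangular configuration may live in a Euclidean space of any dimension. As dimensions are
  types, the existential quantification over them is expressed by taking the configuration in the
  space of finitely supported real sequences: a finite complex there lies in the subspace \<open>\<real>\<^sup>m\<close> of
  sequences supported in \<open>{..<m}\<close>, for some \<open>m\<close>, and every \<open>\<real>\<^sup>m\<close> occurs in this way.
\<close>

definition has_geometric_representation_into ::
  "'b::real_vector itself \<Rightarrow> nat \<Rightarrow> (nat \<Rightarrow> bit) set \<Rightarrow> bool" where
  "has_geometric_representation_into R n C \<longleftrightarrow>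
     (\<exists>(\<Delta> :: (nat \<Rightarrow>\<^sub>0 real) set set) S.
        geometric_representation n C \<Delta> S \<and> embeddable_into R \<Delta>)"


section \<open>Cut spaces of graphs\<close>

text \<open>
  A finite graph with vertex set \<open>V\<close> and edge set \<open>E\<close> assigns to each edge the unordered pair of its
  ends; loops \<open>Upair v v\<close> and parallel edges are allowed.
\<close>

definition graph :: "'v set \<Rightarrow> 'e set \<Rightarrow> ('e \<Rightarrow> 'v uprod) \<Rightarrow> bool" where
  "graph V E ends \<longleftrightarrow> finite V \<and> finite E \<and> (\<forall>e\<in>E. set_uprod (ends e) \<subseteq> V)"

definition edge_cut :: "'e set \<Rightarrow> ('e \<Rightarrow> 'v uprod) \<Rightarrow> 'v set \<Rightarrow> 'e set" where
  "edge_cut E ends X = {e \<in> E. \<exists>u v. ends e = Upair u v \<and> u \<in> X \<and> v \<notin> X}"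

definition cut_space :: "'v set \<Rightarrow> 'e set \<Rightarrow> ('e \<Rightarrow> 'v uprod) \<Rightarrow> ('e \<Rightarrow> bit) set" where
  "cut_space V E ends = GF2.span {indicator (edge_cut E ends X) |X. X \<subseteq> V}"

end

(*
  Let Delta be a triangular configuration in R^3 and let U be the complement of its triangles. The
  kernel of Delta is the cut space of the dual graph, whose vertices are the components of U and in
  which a triangle joins the components on its two sides. The key is a parity identity: for two
  triangles s and t in general position, the sides of s that meet t and the sides of t that meet s
  are even in number altogether. Summed over the triangles t of a cycle it shows that the parity of
  the number of crossings of a segment [p, y] with the cycle depends, for a fixed generic p, only on
  the component of y, so a cycle is a cut. Applied to a small triangle s around the midpoint of an
  edge it shows that a cut is a cycle. Puncturing deletes edges of the graph.

  Conversely, take a triangulated rectangular grid in a plane, cone its strips in one direction off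
  from an apex below and its strips in the other direction off from an apex above. Every lower region
  (one for each edge of the graph) then touches every upper region (one for each vertex). Removing a
  triangle between the lower region of an edge uv and the upper region of u merges the two; a triangle
  between the lower region of uv and the upper region of v represents the edge. For the dimensions to
  agree, one upper region per component of the graph is opened to the outside.
*)

theory Submission
  imports Defs
begin

text \<open>All codes are compared through potentials: a cut space consists of the words
  \<open>c (a e) + c (b e)\<close>, so components of space and vertices of a graph enter only as
  arguments of a function \<open>c\<close>. The parity identity is one-dimensional at heart: the
  planes of the two triangles meet in a line, each triangle cuts a segment out of it, and for two
  segments on a line with distinct ends the ends covered by the other segment are even in number.
  General position supplies the distinct ends; its price is that arguments by connectedness have to
  run over a dense set of admissible points. In the converse the obstacle is to see that the coned
  grid is embedded without comparing triangles pair by pair. A convex function on the grid points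
  and the apexes settles it: the tetrahedra spanned by a floor triangle and an apex are its cells of
  linearity, and uniqueness of barycentric coordinates follows from convexity alone. The opened
  columns are forced by the constants: without them a potential constant on a component of the graph
  would be a nonzero cycle that punctures to zero.\<close>

declare add_bit_eq_xor [simp del] mult_bit_eq_and [simp del]

section \<open>Cut spaces as spaces of potential differences\<close>

lemma bit_add_self [simp]: "x + x = (0::bit)"
  by (cases x) auto

lemma bit_add_eq_0_iff: "x + y = (0::bit) \<longleftrightarrow> x = y"
  by (cases x; cases y) auto

lemma subspace_edge_potentials:
  "GF2.subspace {x \<in> GF2_space E. \<exists>c. \<forall>e\<in>E. x e = c (a e) + c (b e)}"
proof -
  have *: "\<exists>c'. \<forall>e\<in>E. x e + y e = c' (a e) + c' (b e)"
    if "\<forall>e\<in>E. x e = c (a e) + c (b e)" "\<forall>e\<in>E. y e = d (a e) + d (b e)" for x y :: "'a \<Rightarrow> bit" and c d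
    by (intro exI [of _ "\<lambda>v. c v + d v"] ballI) (simp only: that[rule_format] ac_simps)
  have **: "\<exists>c'. \<forall>e\<in>E. k * x e = c' (a e) + c' (b e)"
    if "\<forall>e\<in>E. x e = c (a e) + c (b e)" for x :: "'a \<Rightarrow> bit" and k c
    by (intro exI [of _ "\<lambda>v. k * c v"] ballI) (simp only: that[rule_format] distrib_left)
  show ?thesis
    unfolding GF2.subspace_def GF2_space_def GF2_scale_def
    using * ** by (auto intro: exI [of _ "\<lambda>_. 0"])
qed

text \<open>Over GF(2) a vertex function is the indicator of the set where it is 1, and its
  differences along the edges form the cut of that set. The cuts therefore already are a subspace
  and equal their span. The order of the ends \<open>a e\<close>, \<open>b e\<close> is arbitrary
  because signs vanish.\<close>

lemma cut_space_eq_potentials: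
  assumes "\<And>e. e \<in> E \<Longrightarrow> ends e = Upair (a e) (b e)"
    and "\<And>e. e \<in> E \<Longrightarrow> a e \<in> V \<and> b e \<in> V"
  shows "cut_space V E ends = {x \<in> GF2_space E. \<exists>c. \<forall>e\<in>E. x e = c (a e) + c (b e)}"
    (is "_ = ?P")
proof -
  have cut: "indicator (edge_cut E ends X) e = indicator X (a e) + (indicator X (b e) :: bit)"
    if "e \<in> E" for e X
    using assms(1)[OF that] that by (auto simp: edge_cut_def indicator_def)
  have "{indicator (edge_cut E ends X) |X. X \<subseteq> V} = ?P"
  proof (intro equalityI subsetI)
    fix x :: "'a \<Rightarrow> bit"
    assume "x \<in> {indicator (edge_cut E ends X) |X. X \<subseteq> V}"
    then obtain X where "x = indicator (edge_cut E ends X)" by blast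
    then show "x \<in> ?P"
      using cut by (auto simp: GF2_space_def edge_cut_def)
  next
    fix x assume x: "x \<in> ?P"
    then obtain c where c: "\<forall>e\<in>E. x e = c (a e) + c (b e)" by blast
    define X where "X = {v\<in>V. c v = 1}"
    have ind: "indicator X v = c v" if "v \<in> V" for v
      using that by (cases "c v") (auto simp: X_def)
    have "x e = indicator (edge_cut E ends X) e" for e
    proof (cases "e \<in> E")
      case True
      then show ?thesis using c cut [OF True] ind assms(2) by simp
    next
      case False
      then show ?thesis using x by (simp add: GF2_space_def edge_cut_def)
    qed
    then show "x \<in> {indicator (edge_cut E ends X) |X. X \<subseteq> V}"
      using X_def by blast
  qed
  then show ?thesis
    unfolding cut_space_def
    by (simp only: GF2.span_eq_iff subspace_edge_potentials)
qed

section \<open>Simplices in real vector spaces\<close>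

text \<open>Affine independence makes coordinates unique. Those of a point of
  \<open>convex hull W\<close> vanish off \<open>W\<close>; if the point lies strictly between
  \<open>a\<close> and \<open>b\<close>, they are a positive combination of the nonnegative
  coordinates of \<open>a\<close> and \<open>b\<close>, which must then vanish off \<open>W\<close>
  too.\<close>

lemma convex_hull_face_of_simplex:
  fixes V :: "'a::real_vector set"
  assumes V: "finite V" "\<not> affine_dependent V" and "W \<subseteq> V"
  shows "convex hull W face_of convex hull V"
  unfolding face_of_def
proof (intro conjI ballI impI)
  show "convex hull W \<subseteq> convex hull V" by (simp add: assms hull_mono)
  show "convex (convex hull W)" by simp
  fix a b x assume a: "a \<in> convex hull V" and b: "b \<in> convex hull V"
    and x: "x \<in> convex hull W" and xab: "x \<in> open_segment a b"
  obtain l m where l: "\<forall>v\<in>V. 0 \<le> l v" "sum l V = 1" "(\<Sum>v\<in>V. l v *\<^sub>R v) = a"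
    and m: "\<forall>v\<in>V. 0 \<le> m v" "sum m V = 1" "(\<Sum>v\<in>V. m v *\<^sub>R v) = b"
    using V a b by (auto simp: convex_hull_finite)
  obtain k where k: "\<forall>v\<in>W. 0 \<le> k v" "sum k W = 1" "(\<Sum>v\<in>W. k v *\<^sub>R v) = x"
    using x V assms(3) finite_subset [OF assms(3)] by (auto simp: convex_hull_finite)
  obtain u where u: "0 < u" "u < 1" "x = (1 - u) *\<^sub>R a + u *\<^sub>R b"
    using xab by (auto simp: in_segment)
  define k' where "k' v = (if v \<in> W then k v else 0)" for v
  have k': "sum k' V = 1" "(\<Sum>v\<in>V. k' v *\<^sub>R v) = x"
    using k assms by (auto simp: k'_def sum.If_cases Int_absorb1 if_distrib [of "\<lambda>x. x *\<^sub>R _"] cong: if_cong)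
  define w where "w v = (1 - u) * l v + u * m v - k' v" for v
  have "sum w V = 0"
    using l m k' by (simp add: w_def sum.distrib sum_subtractf flip: sum_distrib_left)
  moreover have "(\<Sum>v\<in>V. w v *\<^sub>R v) = 0"
  proof -
    have "(\<Sum>v\<in>V. w v *\<^sub>R v) = (1 - u) *\<^sub>R (\<Sum>v\<in>V. l v *\<^sub>R v) + u *\<^sub>R (\<Sum>v\<in>V. m v *\<^sub>R v) - (\<Sum>v\<in>V. k' v *\<^sub>R v)"
      by (simp add: w_def scaleR_sum_right sum.distrib sum_subtractf algebra_simps)
    then show ?thesis using l m k' u by simp
  qed
  ultimately have w0: "\<forall>v\<in>V. w v = 0"
    using V(2) unfolding affine_dependent_explicit_finite [OF V(1)] by blast
  have z: "l v = 0 \<and> m v = 0" if "v \<in> V - W" for v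
  proof -
    have "(1 - u) * l v + u * m v = 0" using w0 that by (auto simp: w_def k'_def)
    moreover have "0 \<le> (1 - u) * l v" "0 \<le> u * m v" using l m u that by auto
    ultimately have "(1 - u) * l v = 0" "u * m v = 0" by linarith+
    then show ?thesis using u by auto
  qed
  have finW: "finite W" using assms(3) V finite_subset by blast
  have "sum l W = sum l V" "sum m W = sum m V"
    "(\<Sum>v\<in>W. l v *\<^sub>R v) = (\<Sum>v\<in>V. l v *\<^sub>R v)" "(\<Sum>v\<in>W. m v *\<^sub>R v) = (\<Sum>v\<in>V. m v *\<^sub>R v)"
    by (rule sum.mono_neutral_left; use z V assms in auto)+
  then show "a \<in> convex hull W" "b \<in> convex hull W"
    using l m assms finW by (auto simp: convex_hull_finite intro: exI [of _ l] exI [of _ m])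
qed

text \<open>A vertex \<open>v\<close> carrying weight strictly between 0 and 1 in a point
  \<open>x\<close> of \<open>f\<close> lies in \<open>f\<close>: \<open>x\<close> is strictly
  between \<open>v\<close> and the point \<open>y\<close> obtained by renormalizing the other
  weights, and a face absorbs both ends. So only vertices in \<open>f\<close> carry weight.\<close>

lemma face_of_convex_hull_subset:
  fixes V :: "'a::real_vector set"
  assumes V: "finite V" and f: "f face_of convex hull V"
  shows "f = convex hull (f \<inter> V)"
proof
  have cf: "convex f" using f face_of_imp_convex by blast
  show "convex hull (f \<inter> V) \<subseteq> f" by (simp add: cf hull_minimal)
  show "f \<subseteq> convex hull (f \<inter> V)"
  proof
    fix x assume x: "x \<in> f"
    then have "x \<in> convex hull V" using f face_of_imp_subset by blast
    then obtain l where l: "\<forall>v\<in>V. 0 \<le> l v" "sum l V = 1" "(\<Sum>v\<in>V. l v *\<^sub>R v) = x"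
      using V by (auto simp: convex_hull_finite)
    have inf: "v \<in> f" if v: "v \<in> V" "l v > 0" for v
    proof (cases "l v = 1")
      case True
      have "sum l (V - {v}) = 0" using l V v True by (simp add: sum_diff1)
      then have "\<forall>w\<in>V - {v}. l w = 0" using l V by (subst (asm) sum_nonneg_eq_0_iff) auto
      then have "(\<Sum>w\<in>V. l w *\<^sub>R w) = (\<Sum>w\<in>{v}. l w *\<^sub>R w)"
        by (intro sum.mono_neutral_right) (use V v in auto)
      then show ?thesis using l True x by simp
    next
      case False
      have "l v \<le> 1" using l V v member_le_sum [of v V l] by auto
      then have lt: "l v < 1" using False by simp
      define y where "y = (\<Sum>w\<in>V - {v}. (l w / (1 - l v)) *\<^sub>R w)"
      have "sum l (V - {v}) = 1 - l v" using l V v by (simp add: sum_diff1)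
      then have "(\<Sum>w\<in>V - {v}. l w / (1 - l v)) = 1"
        using lt by (simp flip: sum_divide_distrib)
      moreover have "\<forall>w\<in>V - {v}. 0 \<le> l w / (1 - l v)" using l lt by auto
      ultimately have "y \<in> convex hull (V - {v})"
        using V unfolding y_def by (auto simp: convex_hull_finite intro!: exI [of _ "\<lambda>w. l w / (1 - l v)"])
      then have y: "y \<in> convex hull V" using hull_mono [of "V - {v}" V convex] by blast
      have xe: "x = (1 - l v) *\<^sub>R y + l v *\<^sub>R v"
      proof -
        have "(1 - l v) *\<^sub>R y = (\<Sum>w\<in>V - {v}. l w *\<^sub>R w)"
          using lt by (simp add: y_def scaleR_sum_right)
        then show ?thesis using l(3) V v by (simp add: sum_diff1)
      qed
      show ?thesis
      proof (cases "y = v")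
        case True
        then have "x = v" using xe by (simp add: algebra_simps)
        then show ?thesis using x by simp
      next
        case False
        then have "x \<in> open_segment y v" using xe v lt by (auto simp: in_segment)
        then show ?thesis using f x y hull_inc [OF v(1), of convex] by (auto simp: face_of_def)
      qed
    qed
    have z: "l v = 0" if "v \<in> V - f \<inter> V" for v using inf [of v] l that by force
    have "(\<Sum>v\<in>f \<inter> V. l v *\<^sub>R v) = x" "sum l (f \<inter> V) = 1"
      unfolding l(2,3)[symmetric]
      by (rule sum.mono_neutral_left; use z V in auto)+
    then show "x \<in> convex hull (f \<inter> V)"
      using l V by (auto simp: convex_hull_finite intro!: exI [of _ l])
  qed
qed

lemma vertex_set_convex_hull:
  fixes V :: "'a::real_vector set"
  assumes "finite V" "\<not> affine_dependent V"
  shows "vertex_set (convex hull V) = V"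
proof -
  have "v extreme_point_of convex hull V" if "v \<in> V" for v
    using convex_hull_face_of_simplex [OF assms, of "{v}"] that by (simp add: face_of_singleton)
  then show ?thesis
    using extreme_point_of_convex_hull by (fastforce simp: vertex_set_def)
qed

lemma geom_simplex_vertex_set:
  assumes "geom_simplex n s"
  shows "finite (vertex_set s)" "\<not> affine_dependent (vertex_set s)"
    "int (card (vertex_set s)) = n + 1" "s = convex hull (vertex_set s)"
  using assms vertex_set_convex_hull unfolding geom_simplex_def by force+

text \<open>Makes incidence purely combinatorial, so that kernels can be carried along
  isomorphisms.\<close>

lemma face_of_geom_simplex_iff:
  assumes "geom_simplex m s" "geom_simplex n t"
  shows "s face_of t \<longleftrightarrow> vertex_set s \<subseteq> vertex_set t"
proof
  note s = geom_simplex_vertex_set [OF assms(1)] and t = geom_simplex_vertex_set [OF assms(2)]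
  assume f: "s face_of t"
  show "vertex_set s \<subseteq> vertex_set t"
    using f extreme_point_of_face [OF f] by (auto simp: vertex_set_def)
next
  note s = geom_simplex_vertex_set [OF assms(1)] and t = geom_simplex_vertex_set [OF assms(2)]
  assume "vertex_set s \<subseteq> vertex_set t"
  then show "s face_of t"
    using convex_hull_face_of_simplex [OF t(1,2)] s(4) t(4) by metis
qed

lemma geom_complex_subset_face:
  assumes "geom_complex \<Delta>" "t \<in> \<Delta>" "W \<subseteq> vertex_set t"
  shows "convex hull W \<in> \<Delta>" "vertex_set (convex hull W) = W"
    "geom_simplex (int (card W) - 1) (convex hull W)"
proof -
  obtain n where n: "geom_simplex n t" using assms unfolding geom_complex_def by blast
  note t = geom_simplex_vertex_set [OF n]
  have "convex hull W face_of t"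
    using convex_hull_face_of_simplex [OF t(1,2) assms(3)] t(4) by simp
  then show "convex hull W \<in> \<Delta>" using assms unfolding geom_complex_def by blast
  have W: "finite W" "\<not> affine_dependent W"
    using t assms(3) finite_subset affine_dependent_subset by blast+
  then show "vertex_set (convex hull W) = W" by (rule vertex_set_convex_hull)
  show "geom_simplex (int (card W) - 1) (convex hull W)"
    using W unfolding geom_simplex_def by auto
qed

lemma finite_triangles: "geom_complex \<Delta> \<Longrightarrow> finite (triangles \<Delta>)"
  by (simp add: geom_complex_def triangles_def)

text \<open>Ranging over all pairs \<open>E\<close> of points instead of the edges of
  \<open>\<Delta>\<close> changes nothing: a pair inside some triangle spans an edge of the complex,
  and any other pair gives an empty sum. This form mentions vertex sets only.\<close>

lemma kernel_eq_cycles: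
  assumes "geom_complex \<Delta>"
  shows "kernel \<Delta> = {x \<in> GF2_space (triangles \<Delta>).
    \<forall>E. card E = 2 \<longrightarrow> (\<Sum>t | t \<in> triangles \<Delta> \<and> E \<subseteq> vertex_set t. x t) = 0}"
proof -
  note fin = finite_triangles [OF assms]
  have inc: "(\<Sum>t\<in>triangles \<Delta>. incidence e t * x t) =
      (\<Sum>t | t \<in> triangles \<Delta> \<and> vertex_set e \<subseteq> vertex_set t. x t)"
    if "e \<in> edges \<Delta>" for e and x :: "'a set \<Rightarrow> bit"
  proof -
    have "(\<Sum>t\<in>triangles \<Delta>. incidence e t * x t) =
        (\<Sum>t\<in>triangles \<Delta>. if vertex_set e \<subseteq> vertex_set t then x t else 0)"
      using that by (intro sum.cong)
        (auto simp: incidence_def edges_def triangles_def face_of_geom_simplex_iff)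
    also have "\<dots> = (\<Sum>t | t \<in> triangles \<Delta> \<and> vertex_set e \<subseteq> vertex_set t. x t)"
      using fin by (simp add: sum.inter_filter)
    finally show ?thesis .
  qed
  have edge: "\<exists>e\<in>edges \<Delta>. vertex_set e = E"
    if E: "card E = 2" and ne: "{t. t \<in> triangles \<Delta> \<and> E \<subseteq> vertex_set t} \<noteq> {}" for E
  proof -
    obtain t where "t \<in> \<Delta>" "E \<subseteq> vertex_set t" using ne by (auto simp: triangles_def)
    from geom_complex_subset_face [OF assms this] E show ?thesis
      by (auto simp: edges_def intro!: bexI [of _ "convex hull E"])
  qed
  have c2: "card (vertex_set e) = 2" if "e \<in> edges \<Delta>" for e
    using geom_simplex_vertex_set(3)[of 1 e] that by (simp add: edges_def)
  have "(\<forall>e\<in>edges \<Delta>. (\<Sum>t\<in>triangles \<Delta>. incidence e t * x t) = 0) \<longleftrightarrow>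
      (\<forall>E. card E = 2 \<longrightarrow> (\<Sum>t | t \<in> triangles \<Delta> \<and> E \<subseteq> vertex_set t. x t) = 0)"
    for x :: "'a set \<Rightarrow> bit"
  proof (intro iffI allI impI ballI)
    fix E :: "'a set"
    assume *: "\<forall>e\<in>edges \<Delta>. (\<Sum>t\<in>triangles \<Delta>. incidence e t * x t) = 0" and E: "card E = 2"
    show "(\<Sum>t | t \<in> triangles \<Delta> \<and> E \<subseteq> vertex_set t. x t) = 0"
    proof (cases "{t. t \<in> triangles \<Delta> \<and> E \<subseteq> vertex_set t} = {}")
      case True
      then show ?thesis by (metis sum.empty)
    next
      case False
      then obtain e where "e \<in> edges \<Delta>" "vertex_set e = E" using edge E by blast
      then show ?thesis using * inc by metis
    qed
  next
    fix e assume "\<forall>E. card E = 2 \<longrightarrow> (\<Sum>t | t \<in> triangles \<Delta> \<and> E \<subseteq> vertex_set t. x t) = 0"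
      and "e \<in> edges \<Delta>"
    then show "(\<Sum>t\<in>triangles \<Delta>. incidence e t * x t) = 0" using inc c2 by simp
  qed
  then show ?thesis unfolding kernel_def by blast
qed

section \<open>The parity identity for two triangles\<close>

lemma real_segment_parity:
  fixes b c y z :: real
  assumes "b \<noteq> y" "b \<noteq> z" "c \<noteq> y" "c \<noteq> z"
  shows "of_bool (y \<in> closed_segment b c) + of_bool (z \<in> closed_segment b c) +
    of_bool (b \<in> closed_segment y z) + of_bool (c \<in> closed_segment y z) = (0 :: bit)"
proof -
  \<comment> \<open>Two intervals are disjoint, nested or overlapping; the covered ends are none,
    two of one interval, or one of each.\<close>
  have "(y \<in> closed_segment b c \<longleftrightarrow> z \<in> closed_segment b c) \<longleftrightarrow>
      (b \<in> closed_segment y z \<longleftrightarrow> c \<in> closed_segment y z)"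
    unfolding closed_segment_eq_real_ivl using assms by (smt (verit) atLeastAtMost_iff)
  then show ?thesis
    by (cases "y \<in> closed_segment b c"; cases "z \<in> closed_segment b c";
        cases "b \<in> closed_segment y z"; cases "c \<in> closed_segment y z") auto
qed

lemma collinear_segment_parity:
  fixes d :: "'a::real_vector"
  assumes "y = b + s *\<^sub>R d" "z = b + t *\<^sub>R d" "c = b + r *\<^sub>R d"
    and "b \<noteq> y" "b \<noteq> z" "c \<noteq> y" "c \<noteq> z"
  shows "of_bool (y \<in> closed_segment b c) + of_bool (z \<in> closed_segment b c) +
    of_bool (b \<in> closed_segment y z) + of_bool (c \<in> closed_segment y z) = (0 :: bit)"
proof -
  have d: "d \<noteq> 0" using assms by auto
  define L where "L k = b + k *\<^sub>R d" for k
  have inj: "L k = L l \<longleftrightarrow> k = l" for k l using d by (simp add: L_def)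
  have mem: "L k \<in> closed_segment (L l) (L m) \<longleftrightarrow> k \<in> closed_segment l m" for k l m
  proof -
    have "(1 - u) *\<^sub>R L l + u *\<^sub>R L m = L ((1 - u) * l + u * m)" for u
      by (simp add: L_def algebra_simps)
    then show ?thesis by (simp add: in_segment inj)
  qed
  have e: "b = L 0" "y = L s" "z = L t" "c = L r" by (auto simp: L_def assms)
  show ?thesis
    using real_segment_parity [of 0 s t r] assms(4-) unfolding e mem inj by simp
qed

text \<open>The intersection of the line through \<open>a\<close> and \<open>b\<close> with the
  plane \<open>n \<bullet> w = k\<close>, meaningful if
  \<open>n \<bullet> a \<noteq> n \<bullet> b\<close>.\<close>

definition cut_point :: "'a::real_inner \<Rightarrow> real \<Rightarrow> 'a \<Rightarrow> 'a \<Rightarrow> 'a" where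
  "cut_point n k a b = a + ((k - n \<bullet> a) / (n \<bullet> b - n \<bullet> a)) *\<^sub>R (b - a)"

lemma cut_point_plane: "n \<bullet> a \<noteq> n \<bullet> b \<Longrightarrow> n \<bullet> cut_point n k a b = k"
  by (simp add: cut_point_def inner_add_right inner_diff_right)

lemma cut_point_segment:
  assumes "n \<bullet> a < k" "k < n \<bullet> b"
  shows "closed_segment a b \<inter> {w. n \<bullet> w = k} = {cut_point n k a b}"
proof -
  define u where "u = (k - n \<bullet> a) / (n \<bullet> b - n \<bullet> a)"
  have u: "0 < u" "u < 1" using assms by (auto simp: u_def)
  have e: "cut_point n k a b = (1 - u) *\<^sub>R a + u *\<^sub>R b"
    unfolding cut_point_def u_def[symmetric] by (simp add: algebra_simps)
  have *: "v = u" if "n \<bullet> ((1 - v) *\<^sub>R a + v *\<^sub>R b) = k" for v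
  proof -
    have "v * (n \<bullet> b - n \<bullet> a) = k - n \<bullet> a"
      using that by (simp add: inner_add_right left_diff_distrib right_diff_distrib)
    then show ?thesis using assms by (simp add: u_def eq_divide_eq)
  qed
  have 1: "w = cut_point n k a b" if w: "w \<in> closed_segment a b" "n \<bullet> w = k" for w
  proof -
    obtain v where v: "w = (1 - v) *\<^sub>R a + v *\<^sub>R b" using w(1) by (auto simp: in_segment)
    then have "v = u" using * w(2) by simp
    then show ?thesis using v e by simp
  qed
  have 2: "n \<bullet> cut_point n k a b = k" using assms by (intro cut_point_plane) auto
  have 3: "cut_point n k a b \<in> closed_segment a b"
    unfolding in_segment e using u by (intro exI [of _ u]) auto
  show ?thesis
  proof (intro equalityI subsetI)
    fix w assume "w \<in> closed_segment a b \<inter> {w. n \<bullet> w = k}"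
    then show "w \<in> {cut_point n k a b}" using 1 by blast
  qed (use 2 3 in auto)
qed

lemma plane_section_triangle:
  assumes a: "n \<bullet> a < k" and b: "k < n \<bullet> b" and c: "k < n \<bullet> c"
  shows "convex hull {a, b, c} \<inter> {w. n \<bullet> w = k} =
    closed_segment (cut_point n k a b) (cut_point n k a c)"
proof (intro equalityI subsetI)
  let ?B = "cut_point n k a b" and ?C = "cut_point n k a c"
  have "?B \<in> convex hull {a, b, c}" "?C \<in> convex hull {a, b, c}"
    using cut_point_segment [OF a b] cut_point_segment [OF a c]
      hull_mono [of "{a, b}" "{a, b, c}" convex] hull_mono [of "{a, c}" "{a, b, c}" convex]
    unfolding segment_convex_hull by auto
  then have 1: "closed_segment ?B ?C \<subseteq> convex hull {a, b, c}"
    by (simp add: closed_segment_subset)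
  have 2: "closed_segment ?B ?C \<subseteq> {w. n \<bullet> w = k}"
    using cut_point_plane [of n a b k] cut_point_plane [of n a c k] a b c convex_hyperplane
    by (intro closed_segment_subset) auto
  show "w \<in> convex hull {a, b, c} \<inter> {w. n \<bullet> w = k}" if "w \<in> closed_segment ?B ?C" for w
    using that 1 2 by blast
next
  let ?B = "cut_point n k a b" and ?C = "cut_point n k a c"
  fix w assume "w \<in> convex hull {a, b, c} \<inter> {w. n \<bullet> w = k}"
  then obtain l m r where lmr: "0 \<le> l" "0 \<le> m" "0 \<le> r" "l + m + r = 1"
    "w = l *\<^sub>R a + m *\<^sub>R b + r *\<^sub>R c" and nw: "n \<bullet> w = k"
    by (auto simp: convex_hull_3)
  define \<alpha> \<beta> \<gamma> where "\<alpha> = k - n \<bullet> a" and "\<beta> = n \<bullet> b - k" and "\<gamma> = n \<bullet> c - k"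
  have pos: "0 < \<alpha>" "0 < \<beta>" "0 < \<gamma>" using a b c by (auto simp: \<alpha>_def \<beta>_def \<gamma>_def)
  have bal: "l * \<alpha> = m * \<beta> + r * \<gamma>"
  proof -
    have "l * (n \<bullet> a) + m * (n \<bullet> b) + r * (n \<bullet> c) = (l + m + r) * k"
      using nw lmr by (simp add: inner_add_right)
    then show ?thesis by (simp add: \<alpha>_def \<beta>_def \<gamma>_def algebra_simps)
  qed
  \<comment> \<open>The weight \<open>l\<close> of \<open>a\<close> splits into
    \<open>m * \<beta> / \<alpha>\<close> and \<open>r * \<gamma> / \<alpha>\<close>, the parts that
    balance \<open>b\<close> and \<open>c\<close> about the plane. \<open>u\<close> and
    \<open>v\<close> are the total weights of the two balanced pairs, whose centres of mass are the
    two cut points.\<close>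
  define u v where "u = m * (\<alpha> + \<beta>) / \<alpha>" and "v = r * (\<alpha> + \<gamma>) / \<alpha>"
  have l_eq: "l = (m * \<beta> + r * \<gamma>) / \<alpha>" using bal pos by (simp add: field_simps)
  have uv: "0 \<le> u" "0 \<le> v" "u + v = 1"
  proof -
    show "0 \<le> u" "0 \<le> v" using lmr pos by (auto simp: u_def v_def)
    have "u + v = (m * \<beta> + r * \<gamma>) / \<alpha> + m + r" using pos by (simp add: u_def v_def field_simps)
    then show "u + v = 1" using l_eq lmr by simp
  qed
  have B: "?B = (\<beta> / (\<alpha> + \<beta>)) *\<^sub>R a + (\<alpha> / (\<alpha> + \<beta>)) *\<^sub>R b"
  proof -
    have "?B = (1 - \<alpha> / (\<alpha> + \<beta>)) *\<^sub>R a + (\<alpha> / (\<alpha> + \<beta>)) *\<^sub>R b"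
      by (simp add: cut_point_def \<alpha>_def \<beta>_def algebra_simps)
    also have "1 - \<alpha> / (\<alpha> + \<beta>) = \<beta> / (\<alpha> + \<beta>)" using pos by (simp add: field_simps)
    finally show ?thesis .
  qed
  have C: "?C = (\<gamma> / (\<alpha> + \<gamma>)) *\<^sub>R a + (\<alpha> / (\<alpha> + \<gamma>)) *\<^sub>R c"
  proof -
    have "?C = (1 - \<alpha> / (\<alpha> + \<gamma>)) *\<^sub>R a + (\<alpha> / (\<alpha> + \<gamma>)) *\<^sub>R c"
      by (simp add: cut_point_def \<alpha>_def \<gamma>_def algebra_simps)
    also have "1 - \<alpha> / (\<alpha> + \<gamma>) = \<gamma> / (\<alpha> + \<gamma>)" using pos by (simp add: field_simps)
    finally show ?thesis .
  qed
  have coef: "u * (\<beta> / (\<alpha> + \<beta>)) = m * \<beta> / \<alpha>" "u * (\<alpha> / (\<alpha> + \<beta>)) = m"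
    "v * (\<gamma> / (\<alpha> + \<gamma>)) = r * \<gamma> / \<alpha>" "v * (\<alpha> / (\<alpha> + \<gamma>)) = r"
    using pos by (auto simp: u_def v_def add_pos_pos [THEN less_imp_neq, symmetric])
  have "u *\<^sub>R ?B + v *\<^sub>R ?C = (u * (\<beta> / (\<alpha> + \<beta>)) + v * (\<gamma> / (\<alpha> + \<gamma>))) *\<^sub>R a +
      (u * (\<alpha> / (\<alpha> + \<beta>))) *\<^sub>R b + (v * (\<alpha> / (\<alpha> + \<gamma>))) *\<^sub>R c"
    by (simp add: B C scaleR_add_right scaleR_add_left)
  also have "\<dots> = w" unfolding coef lmr(5) l_eq by (simp add: add_divide_distrib)
  finally show "w \<in> closed_segment ?B ?C"
    unfolding segment_convex_hull convex_hull_2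
    using uv by (intro CollectI exI [of _ u] exI [of _ v]) auto
qed

lemma inner_cross3_parallel:
  fixes n m u :: "real^3"
  assumes "n \<bullet> u = 0" "m \<bullet> u = 0" "cross3 n m \<noteq> 0"
  obtains r where "u = r *\<^sub>R cross3 n m"
proof -
  have "cross3 u (cross3 n m) = 0"
    using assms(1,2) by (simp add: Lagrange inner_commute)
  then have "collinear {0, cross3 n m, u}" by (simp add: cross_eq_0 insert_commute)
  then show ?thesis using assms(3) that by (auto simp: collinear_lemma)
qed

definition meets :: "'a set \<Rightarrow> 'a set \<Rightarrow> bit" where
  "meets S T = of_bool (S \<inter> T \<noteq> {})"

definition crossing_parity :: "'a::real_vector \<Rightarrow> 'a \<Rightarrow> 'a \<Rightarrow> 'a \<Rightarrow> 'a \<Rightarrow> 'a \<Rightarrow> bit" where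
  "crossing_parity a b c x y z =
    meets (closed_segment x y) (convex hull {a, b, c}) +
    meets (closed_segment y z) (convex hull {a, b, c}) +
    meets (closed_segment z x) (convex hull {a, b, c}) +
    (meets (convex hull {x, y, z}) (closed_segment a b) +
     meets (convex hull {x, y, z}) (closed_segment b c) +
     meets (convex hull {x, y, z}) (closed_segment c a))"

definition sides :: "'a::real_vector \<Rightarrow> 'a \<Rightarrow> 'a \<Rightarrow> 'a set" where
  "sides a b c = closed_segment a b \<union> closed_segment b c \<union> closed_segment c a"

lemma sides_rotate: "sides b c a = sides a b c"
  by (auto simp: sides_def)

lemma crossing_parity_rotate:
  "crossing_parity b c a x y z = crossing_parity a b c x y z"
  "crossing_parity a b c y z x = crossing_parity a b c x y z"
  by (simp_all add: crossing_parity_def insert_commute ac_simps)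

lemma segment_subset_hyperplane:
  "n \<bullet> a = k \<Longrightarrow> n \<bullet> b = k \<Longrightarrow> closed_segment a b \<subseteq> {w. n \<bullet> w = k}"
  by (rule closed_segment_subset) (auto simp: convex_hyperplane)

lemma segment_subset_halfspace:
  "k < n \<bullet> a \<Longrightarrow> k < n \<bullet> b \<Longrightarrow> closed_segment a b \<subseteq> {w. k < n \<bullet> w}"
  by (rule closed_segment_subset) (auto simp: convex_halfspace_gt)

lemma triangle_subset_hyperplane:
  "n \<bullet> a = k \<Longrightarrow> n \<bullet> b = k \<Longrightarrow> n \<bullet> c = k \<Longrightarrow> convex hull {a, b, c} \<subseteq> {w. n \<bullet> w = k}"
  by (rule hull_minimal) (auto simp: convex_hyperplane)

text \<open>Here \<open>a\<close> and \<open>x\<close> are alone on their sides of the other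
  triangle's plane. The common line of the planes meets the triangles in the segments
  \<open>B C\<close> and \<open>Y Z\<close>. A side at \<open>a\<close> or \<open>x\<close> meets
  the other triangle exactly if its cut point lies in the other segment, while the sides
  \<open>b c\<close> and \<open>y z\<close> miss the line. What remains is the parity of ends on a
  line.\<close>

lemma crossing_parity_separated:
  fixes a b c x y z :: "real^3"
  assumes n: "n \<bullet> x = k" "n \<bullet> y = k" "n \<bullet> z = k"
    and abc: "n \<bullet> a < k" "k < n \<bullet> b" "k < n \<bullet> c"
    and m: "m \<bullet> a = l" "m \<bullet> b = l" "m \<bullet> c = l"
    and xyz: "m \<bullet> x < l" "l < m \<bullet> y" "l < m \<bullet> z"
    and disj: "sides a b c \<inter> sides x y z = {}"
  shows "crossing_parity a b c x y z = 0"
proof -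
  define B C Y Z where "B = cut_point n k a b" and "C = cut_point n k a c"
    and "Y = cut_point m l x y" and "Z = cut_point m l x z"
  let ?T = "convex hull {a, b, c}" and ?S = "convex hull {x, y, z}"
  have T: "?T \<subseteq> {w. m \<bullet> w = l}" and S: "?S \<subseteq> {w. n \<bullet> w = k}"
    using n m by (simp_all add: triangle_subset_hyperplane)
  have yz: "closed_segment y z \<subseteq> {w. l < m \<bullet> w}" and bc: "closed_segment b c \<subseteq> {w. k < n \<bullet> w}"
    using xyz abc by (simp_all add: segment_subset_halfspace)
  note B = cut_point_segment [OF abc(1,2), folded B_def]
    and C = cut_point_segment [OF abc(1,3), folded C_def]
    and Y = cut_point_segment [OF xyz(1,2), folded Y_def]
    and Z = cut_point_segment [OF xyz(1,3), folded Z_def]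
  have mem: "B \<in> closed_segment a b" "C \<in> closed_segment a c" "Y \<in> closed_segment x y"
    "Z \<in> closed_segment x z"
    using B C Y Z by blast+
  have on: "n \<bullet> B = k" "n \<bullet> C = k" "m \<bullet> Y = l" "m \<bullet> Z = l"
    using abc xyz by (simp_all add: B_def C_def Y_def Z_def cut_point_plane)
  have on': "m \<bullet> B = l" "m \<bullet> C = l" "n \<bullet> Y = k" "n \<bullet> Z = k"
  proof -
    have "closed_segment a b \<subseteq> {w. m \<bullet> w = l}" "closed_segment a c \<subseteq> {w. m \<bullet> w = l}"
      "closed_segment x y \<subseteq> {w. n \<bullet> w = k}" "closed_segment x z \<subseteq> {w. n \<bullet> w = k}"
      using n m by (simp_all add: segment_subset_hyperplane)
    then show "m \<bullet> B = l" "m \<bullet> C = l" "n \<bullet> Y = k" "n \<bullet> Z = k" using mem by blast+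
  qed
  have ST: "?T \<inter> {w. n \<bullet> w = k} = closed_segment B C" "?S \<inter> {w. m \<bullet> w = l} = closed_segment Y Z"
    using plane_section_triangle abc xyz by (simp_all add: B_def C_def Y_def Z_def)
  \<comment> \<open>\<open>R\<close> is a side crossing the plane \<open>H\<close> only at
    \<open>P\<close>, \<open>U\<close> is a triangle inside \<open>H\<close>, and \<open>Q\<close>
    is the section of \<open>U\<close> by the plane \<open>H'\<close> of the triangle to which
    \<open>R\<close> belongs.\<close>
  have *: "meets R U = of_bool (P \<in> Q)" "meets U R = of_bool (P \<in> Q)"
    if "R \<inter> H = {P}" "U \<subseteq> H" "U \<inter> H' = Q" "P \<in> H'" for P :: "real^3" and R U H H' Q
  proof -
    have "R \<inter> U = {P} \<inter> U" using that(1,2) by blast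
    moreover have "P \<in> U \<longleftrightarrow> P \<in> Q" using that(3,4) by blast
    ultimately have "R \<inter> U \<noteq> {} \<longleftrightarrow> P \<in> Q" by simp
    then show "meets R U = of_bool (P \<in> Q)" "meets U R = of_bool (P \<in> Q)"
      by (simp_all add: meets_def Int_commute)
  qed
  have 1: "meets (closed_segment x y) ?T = of_bool (Y \<in> closed_segment B C)"
    by (rule *(1) [OF Y T ST(1)]) (simp add: on')
  have 2: "meets (closed_segment z x) ?T = of_bool (Z \<in> closed_segment B C)"
    unfolding closed_segment_commute [of z x] by (rule *(1) [OF Z T ST(1)]) (simp add: on')
  have 3: "meets ?S (closed_segment a b) = of_bool (B \<in> closed_segment Y Z)"
    by (rule *(2) [OF B S ST(2)]) (simp add: on')
  have 4: "meets ?S (closed_segment c a) = of_bool (C \<in> closed_segment Y Z)"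
    unfolding closed_segment_commute [of c a] by (rule *(2) [OF C S ST(2)]) (simp add: on')
  have 5: "meets (closed_segment y z) ?T = 0" "meets ?S (closed_segment b c) = 0"
    using yz bc T S unfolding meets_def by fastforce+
  \<comment> \<open>With parallel planes \<open>n\<close> would be constant on \<open>a\<close>,
    \<open>b\<close>, contradicting that they are separated.\<close>
  have indep: "cross3 n m \<noteq> 0"
  proof
    assume "cross3 n m = 0"
    then have "collinear {0, m, n}" by (simp add: cross_eq_0 insert_commute)
    moreover have "m \<noteq> 0" "n \<noteq> 0" using xyz abc by auto
    ultimately obtain r where "n = r *\<^sub>R m" unfolding collinear_lemma by blast
    then have "n \<bullet> a = n \<bullet> b" using m by simp
    then show False using abc by simp
  qed
  have par: "\<exists>r. P = B + r *\<^sub>R cross3 n m" if "n \<bullet> P = k" "m \<bullet> P = l" for P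
  proof -
    have "n \<bullet> (P - B) = 0" "m \<bullet> (P - B) = 0"
      unfolding inner_diff_right that on on' by simp_all
    then obtain r where "P - B = r *\<^sub>R cross3 n m" using indep inner_cross3_parallel by blast
    then have "P = B + r *\<^sub>R cross3 n m" by (simp add: algebra_simps)
    then show ?thesis ..
  qed
  obtain s t r where par: "Y = B + s *\<^sub>R cross3 n m" "Z = B + t *\<^sub>R cross3 n m"
    "C = B + r *\<^sub>R cross3 n m"
    using par [of Y] par [of Z] par [of C] on on' by blast
  \<comment> \<open>Disjoint boundaries keep the four ends on the line distinct across the two
    segments.\<close>
  have "B \<in> sides a b c" "C \<in> sides a b c" "Y \<in> sides x y z" "Z \<in> sides x y z"
    using mem by (simp_all add: sides_def closed_segment_commute)
  then have ne: "B \<noteq> Y" "B \<noteq> Z" "C \<noteq> Y" "C \<noteq> Z" using disj by auto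
  show ?thesis
    using collinear_segment_parity [OF par ne]
    by (simp only: crossing_parity_def 1 2 3 4 5 add_0_left add_0_right add.assoc)
qed

lemma crossing_parity_isolated:
  fixes a b c x y z :: "real^3"
  assumes n: "n \<bullet> x = k" "n \<bullet> y = k" "n \<bullet> z = k"
    and abc: "n \<bullet> a < k \<and> k < n \<bullet> b \<and> k < n \<bullet> c \<or> k < n \<bullet> a \<and> n \<bullet> b < k \<and> n \<bullet> c < k"
    and m: "m \<bullet> a = l" "m \<bullet> b = l" "m \<bullet> c = l"
    and xyz: "m \<bullet> x < l \<and> l < m \<bullet> y \<and> l < m \<bullet> z \<or> l < m \<bullet> x \<and> m \<bullet> y < l \<and> m \<bullet> z < l"
    and disj: "sides a b c \<inter> sides x y z = {}"
  shows "crossing_parity a b c x y z = 0"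
proof -
  have "\<exists>n k. n \<bullet> x = k \<and> n \<bullet> y = k \<and> n \<bullet> z = k \<and> n \<bullet> a < k \<and> k < n \<bullet> b \<and> k < n \<bullet> c"
    using abc
  proof
    assume "k < n \<bullet> a \<and> n \<bullet> b < k \<and> n \<bullet> c < k"
    then show ?thesis using n by (intro exI [of _ "- n"] exI [of _ "- k"]) auto
  qed (use n in blast)
  moreover have "\<exists>m l. m \<bullet> a = l \<and> m \<bullet> b = l \<and> m \<bullet> c = l \<and> m \<bullet> x < l \<and> l < m \<bullet> y \<and> l < m \<bullet> z"
    using xyz
  proof
    assume "l < m \<bullet> x \<and> m \<bullet> y < l \<and> m \<bullet> z < l"
    then show ?thesis using m by (intro exI [of _ "- m"] exI [of _ "- l"]) auto
  qed (use m in blast)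
  ultimately show ?thesis using crossing_parity_separated disj by metis
qed

lemma triangles_disjoint_of_same_side:
  assumes n: "n \<bullet> x = k" "n \<bullet> y = k" "n \<bullet> z = k"
    and abc: "n \<bullet> a < k \<and> n \<bullet> b < k \<and> n \<bullet> c < k \<or> k < n \<bullet> a \<and> k < n \<bullet> b \<and> k < n \<bullet> c"
  shows "convex hull {a, b, c} \<inter> convex hull {x, y, z} = {}"
proof -
  have "convex hull {x, y, z} \<subseteq> {w. n \<bullet> w = k}"
    by (intro hull_minimal) (use n convex_hyperplane in auto)
  moreover have "convex hull {a, b, c} \<subseteq> {w. n \<bullet> w < k} \<or> convex hull {a, b, c} \<subseteq> {w. k < n \<bullet> w}"
    using abc
  proof
    assume "n \<bullet> a < k \<and> n \<bullet> b < k \<and> n \<bullet> c < k"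
    then show ?thesis by (intro disjI1 hull_minimal) (auto simp: convex_halfspace_lt)
  next
    assume "k < n \<bullet> a \<and> k < n \<bullet> b \<and> k < n \<bullet> c"
    then show ?thesis by (intro disjI2 hull_minimal) (auto simp: convex_halfspace_gt)
  qed
  ultimately show ?thesis by fastforce
qed

lemma crossing_parity_disjoint:
  assumes "convex hull {a, b, c} \<inter> convex hull {x, y, z} = {}"
  shows "crossing_parity a b c x y z = 0"
proof -
  have "closed_segment a b \<subseteq> convex hull {a, b, c}" "closed_segment b c \<subseteq> convex hull {a, b, c}"
    "closed_segment c a \<subseteq> convex hull {a, b, c}" "closed_segment x y \<subseteq> convex hull {x, y, z}"
    "closed_segment y z \<subseteq> convex hull {x, y, z}" "closed_segment z x \<subseteq> convex hull {x, y, z}"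
    unfolding segment_convex_hull by (auto intro!: hull_mono)
  then have "closed_segment x y \<inter> convex hull {a, b, c} = {}"
    "closed_segment y z \<inter> convex hull {a, b, c} = {}" "closed_segment z x \<inter> convex hull {a, b, c} = {}"
    "convex hull {x, y, z} \<inter> closed_segment a b = {}" "convex hull {x, y, z} \<inter> closed_segment b c = {}"
    "convex hull {x, y, z} \<inter> closed_segment c a = {}"
    using assms by blast+
  then show ?thesis by (simp add: crossing_parity_def meets_def)
qed

text \<open>For disjoint triangles all six terms vanish. Otherwise neither triangle lies strictly on
  one side of the other's plane, so exactly one of its vertices is alone on its side; rotating the
  names brings that vertex to the front.\<close>

lemma crossing_parity_eq_0:
  fixes a b c x y z :: "real^3"
  assumes n: "n \<bullet> x = k" "n \<bullet> y = k" "n \<bullet> z = k"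
    and abc: "n \<bullet> a \<noteq> k" "n \<bullet> b \<noteq> k" "n \<bullet> c \<noteq> k"
    and m: "m \<bullet> a = l" "m \<bullet> b = l" "m \<bullet> c = l"
    and xyz: "m \<bullet> x \<noteq> l" "m \<bullet> y \<noteq> l" "m \<bullet> z \<noteq> l"
    and disj: "sides a b c \<inter> sides x y z = {}"
  shows "crossing_parity a b c x y z = 0"
proof (cases "convex hull {a, b, c} \<inter> convex hull {x, y, z} = {}")
  case True
  then show ?thesis by (rule crossing_parity_disjoint)
next
  case False
  let ?iso = "\<lambda>n k p q r. n \<bullet> p < k \<and> k < n \<bullet> q \<and> k < n \<bullet> r \<or> k < n \<bullet> p \<and> n \<bullet> q < k \<and> n \<bullet> r < (k::real)"
  have "\<not> (n \<bullet> a < k \<and> n \<bullet> b < k \<and> n \<bullet> c < k \<or> k < n \<bullet> a \<and> k < n \<bullet> b \<and> k < n \<bullet> c)"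
    using triangles_disjoint_of_same_side [OF n] False by blast
  then have A: "?iso n k a b c \<or> ?iso n k b c a \<or> ?iso n k c a b" using abc by argo
  have "\<not> (m \<bullet> x < l \<and> m \<bullet> y < l \<and> m \<bullet> z < l \<or> l < m \<bullet> x \<and> l < m \<bullet> y \<and> l < m \<bullet> z)"
    using triangles_disjoint_of_same_side [OF m] False by blast
  then have X: "?iso m l x y z \<or> ?iso m l y z x \<or> ?iso m l z x y" using xyz by argo
  have *: "crossing_parity a' b' c' x y z = 0"
    if "?iso n k a' b' c'" "m \<bullet> a' = l" "m \<bullet> b' = l" "m \<bullet> c' = l" "sides a' b' c' \<inter> sides x y z = {}"
    for a' b' c'
  proof -
    from X consider "?iso m l x y z" | "?iso m l y z x" | "?iso m l z x y" by blast
    then show ?thesis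
    proof cases
    case 1
    then show ?thesis by (rule crossing_parity_isolated [OF n that(1-4) _ that(5)])
  next
    case 2
    then have "crossing_parity a' b' c' y z x = 0"
      by (rule crossing_parity_isolated [OF n(2,3,1) that(1-4)]) (use that(5) in \<open>simp add: sides_rotate\<close>)
    then show ?thesis by (simp add: crossing_parity_rotate)
  next
    case 3
    then have "crossing_parity a' b' c' z x y = 0"
      by (rule crossing_parity_isolated [OF n(3,1,2) that(1-4)])
        (use that(5) in \<open>simp add: sides_rotate [of x y z] sides_rotate [of z x y]\<close>)
    then show ?thesis by (metis crossing_parity_rotate(2))
  qed
  qed
  from A consider "?iso n k a b c" | "?iso n k b c a" | "?iso n k c a b" by blast
  then show ?thesis
  proof cases
    case 1
    then show ?thesis by (rule * [OF _ m disj])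
  next
    case 2
    then have "crossing_parity b c a x y z = 0"
      by (rule * [OF _ m(2,3,1)]) (use disj in \<open>simp add: sides_rotate\<close>)
    then show ?thesis by (simp add: crossing_parity_rotate)
  next
    case 3
    then have "crossing_parity c a b x y z = 0"
      by (rule * [OF _ m(3,1,2)]) (use disj in \<open>simp add: sides_rotate [of a b c] sides_rotate [of c a b]\<close>)
    then show ?thesis by (metis crossing_parity_rotate(1))
  qed
qed

section \<open>General position\<close>

text \<open>The affine hull of at most \<open>DIM('a)\<close> points is closed with empty interior,
  so removing one such hull after another leaves a nonempty open set.\<close>

lemma generic_point:
  fixes O' :: "'a::euclidean_space set"
  assumes "finite \<S>" "\<And>S. S \<in> \<S> \<Longrightarrow> finite S \<and> card S \<le> DIM('a)" "open O'" "O' \<noteq> {}"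
  obtains z where "z \<in> O'" "\<And>S. S \<in> \<S> \<Longrightarrow> z \<notin> affine hull S"
proof -
  have "\<exists>z\<in>O'. \<forall>S\<in>\<S>. z \<notin> affine hull S"
    using assms
  proof (induction \<S> arbitrary: O' rule: finite_induct)
    case empty
    then show ?case by blast
  next
    case (insert S \<S>)
    have "interior (affine hull S) = {}"
      using insert.prems(1)[of S] empty_interior_affine_hull [of S] by simp
    then have "\<not> O' \<subseteq> affine hull S"
      using insert.prems(2,3) interior_maximal [of O' "affine hull S"] by auto
    then have "open (O' - affine hull S)" "O' - affine hull S \<noteq> {}"
      using insert.prems(2) by (auto simp: open_Diff)
    then obtain z where "z \<in> O' - affine hull S" "\<forall>S\<in>\<S>. z \<notin> affine hull S"
      using insert.IH [of "O' - affine hull S"] insert.prems(1) by auto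
    then show ?case by auto
  qed
  then show ?thesis using that by blast
qed

text \<open>A common point \<open>r\<close> differs from \<open>p\<close>, so \<open>y\<close> lies
  on the line through \<open>p\<close> and \<open>r\<close>, which stays inside the affine hull of
  \<open>p\<close>, \<open>v\<close>, \<open>w\<close>.\<close>

lemma segment_avoids_segment:
  fixes p :: "'a::real_vector"
  assumes p: "p \<notin> closed_segment v w" and y: "y \<notin> affine hull {p, v, w}"
  shows "closed_segment p y \<inter> closed_segment v w = {}"
proof (rule ccontr)
  assume "\<not> ?thesis"
  then obtain r where r: "r \<in> closed_segment p y" "r \<in> closed_segment v w" by blast
  then obtain u where u: "r = (1 - u) *\<^sub>R p + u *\<^sub>R y" by (auto simp: in_segment)
  have "u \<noteq> 0" using u r(2) p by auto
  have "r \<in> affine hull {p, v, w}"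
    using r(2) convex_hull_subset_affine_hull [of "{v, w}"] hull_mono [of "{v, w}" "{p, v, w}" affine]
    by (auto simp: segment_convex_hull)
  moreover have "p \<in> affine hull {p, v, w}" by (simp add: hull_inc)
  ultimately have "(1 - 1 / u) *\<^sub>R p + (1 / u) *\<^sub>R r \<in> affine hull {p, v, w}"
    by (intro mem_affine) auto
  moreover have "(1 - 1 / u) *\<^sub>R p + (1 / u) *\<^sub>R r = y"
  proof -
    have "(1 / u) *\<^sub>R r = (1 / u - 1) *\<^sub>R p + y"
      using \<open>u \<noteq> 0\<close> by (simp add: u scaleR_add_right right_diff_distrib)
    then show ?thesis by (simp add: algebra_simps)
  qed
  ultimately show False using y by simp
qed

text \<open>The cross product is normal to the plane through \<open>p\<close>, \<open>y\<close>,
  \<open>z\<close>. If \<open>v\<close> were in that plane, then \<open>z\<close> would be in the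
  plane of \<open>p\<close>, \<open>y\<close>, \<open>v\<close>, these three points being affinely
  independent.\<close>

lemma cross3_generic:
  fixes p y z v :: "real^3"
  assumes vp: "v \<noteq> p" and y: "y \<notin> affine hull {p, v}" and z: "z \<notin> affine hull {p, y, v}"
  shows "cross3 (y - p) (z - p) \<bullet> v \<noteq> cross3 (y - p) (z - p) \<bullet> p"
proof
  define a b c where "a = y - p" and "b = z - p" and "c = v - p"
  assume "cross3 (y - p) (z - p) \<bullet> v = cross3 (y - p) (z - p) \<bullet> p"
  then have 0: "cross3 a b \<bullet> c = 0" by (simp add: a_def b_def c_def inner_diff_right)
  have c0: "c \<noteq> 0" using vp by (simp add: c_def)
  have ac: "a \<notin> span {c}"
  proof
    assume "a \<in> span {c}"
    then obtain r where "a = r *\<^sub>R c" by (auto simp: span_singleton)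
    then have "y = (1 - r) *\<^sub>R p + r *\<^sub>R v" by (simp add: a_def c_def algebra_simps)
    then have "y \<in> affine hull {p, v}" unfolding affine_hull_2
      by (intro CollectI exI [of _ "1 - r"] exI [of _ r]) simp
    then show False using y by blast
  qed
  have n: "cross3 c a \<noteq> 0"
  proof
    assume "cross3 c a = 0"
    then have "collinear {0, c, a}" by (simp add: cross_eq_0)
    then consider "a = 0" | r where "a = r *\<^sub>R c" using c0 unfolding collinear_lemma by blast
    then show False by cases (use ac in \<open>auto simp: span_zero span_singleton\<close>)
  qed
  \<comment> \<open>By the cyclic symmetry of the triple product \<open>b\<close> lies in this
    plane, and counting dimensions identifies the plane with the span of \<open>a\<close> and
    \<open>c\<close>.\<close>
  let ?H = "{x. cross3 c a \<bullet> x = 0}"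
  have sub: "span {a, c} \<subseteq> ?H"
    by (rule span_minimal) (use dot_cross_self subspace_hyperplane in auto)
  have "independent {a, c}" "a \<noteq> c" using c0 ac by (auto simp: independent_insert span_base)
  then have "dim (span {a, c}) = 2" by (simp add: dim_eq_card_independent)
  moreover have "dim ?H = 2" using n by (simp add: dim_hyperplane)
  ultimately have "span {a, c} = ?H"
    using sub by (intro subspace_dim_equal) (auto simp: subspace_hyperplane)
  moreover have "b \<in> ?H"
  proof -
    have "cross3 c a \<bullet> b = cross3 a b \<bullet> c" by (rule cross_triple)
    then show ?thesis using 0 by simp
  qed
  ultimately have "b \<in> span {a, c}" by blast
  then obtain s t where "b - s *\<^sub>R a = t *\<^sub>R c"
    by (auto simp: span_breakdown_eq span_singleton)
  then have "b = s *\<^sub>R a + t *\<^sub>R c" by (simp add: algebra_simps)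
  then have "z = (1 - s - t) *\<^sub>R p + s *\<^sub>R y + t *\<^sub>R v"
    by (simp add: a_def b_def c_def algebra_simps)
  then have "z \<in> affine hull {p, y, v}" unfolding affine_hull_3
    by (intro CollectI exI [of _ "1 - s - t"] exI [of _ s] exI [of _ t]) simp
  then show False using z by blast
qed

section \<open>Triangular configurations in three-space\<close>

locale space_complex =
  fixes \<Delta> :: "(real^3) set set"
  assumes complex: "geom_complex \<Delta>"
begin

abbreviation "T \<equiv> triangles \<Delta>"
abbreviation "U \<equiv> - \<Union>T"

definition vertices :: "(real^3) set" where
  "vertices = (\<Union>t\<in>T. vertex_set t)"

definition edge_ends :: "(real^3) set set" where
  "edge_ends = {E. card E = 2 \<and> (\<exists>t\<in>T. E \<subseteq> vertex_set t)}"

definition skeleton :: "(real^3) set" where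
  "skeleton = (\<Union>E\<in>edge_ends. convex hull E)"

lemma finite_T: "finite T"
  using complex by (rule finite_triangles)

lemma in_complex: "t \<in> T \<Longrightarrow> t \<in> \<Delta>"
  by (simp add: triangles_def)

lemma triangle_vertices:
  assumes "t \<in> T"
  shows "finite (vertex_set t)" "\<not> affine_dependent (vertex_set t)" "card (vertex_set t) = 3"
    "t = convex hull (vertex_set t)"
  using geom_simplex_vertex_set [of 2 t] assms by (auto simp: triangles_def)

lemma triangle_cases:
  assumes "t \<in> T"
  obtains a b c where "vertex_set t = {a, b, c}" "a \<noteq> b" "b \<noteq> c" "c \<noteq> a" "t = convex hull {a, b, c}"
proof -
  have "card (vertex_set t) = 3" by (rule triangle_vertices [OF assms])
  then obtain a b c where "vertex_set t = {a, b, c}" "a \<noteq> b" "b \<noteq> c" "c \<noteq> a"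
    by (auto simp: card_3_iff)
  then show ?thesis using that triangle_vertices(4) [OF assms] by metis
qed

lemma finite_vertices: "finite vertices"
  unfolding vertices_def using finite_T triangle_vertices(1) by blast

lemma finite_edge_ends: "finite edge_ends"
proof -
  have "edge_ends \<subseteq> Pow vertices" by (auto simp: edge_ends_def vertices_def)
  then show ?thesis using finite_vertices finite_subset by blast
qed

lemma edge_ends_cases:
  assumes "E \<in> edge_ends"
  obtains v w where "E = {v, w}" "v \<noteq> w" "v \<in> vertices" "w \<in> vertices"
  using assms that by (auto simp: edge_ends_def vertices_def card_2_iff)

lemma aff_dim_triangle:
  assumes "t \<in> T"
  shows "aff_dim t = 2"
proof -
  have "aff_dim t = aff_dim (vertex_set t)"
    by (metis aff_dim_convex_hull triangle_vertices(4) [OF assms])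
  then show ?thesis
    using aff_dim_affine_independent [OF triangle_vertices(2) [OF assms]]
    by (simp add: triangle_vertices(3) [OF assms])
qed


definition plane_of :: "(real^3) set \<Rightarrow> real^3 \<Rightarrow> real \<Rightarrow> bool" where
  "plane_of t n k \<longleftrightarrow> n \<noteq> 0 \<and> affine hull t = {w. n \<bullet> w = k}"

lemma plane_of_exists: "t \<in> T \<Longrightarrow> \<exists>n k. plane_of t n k"
  using aff_dim_triangle [of t] aff_dim_eq_hyperplane [of t] by (simp add: plane_of_def)

lemma plane_of_minus: "plane_of t n k \<Longrightarrow> plane_of t (- n) (- k)"
  by (simp add: plane_of_def)

lemma plane_of_mem: "plane_of t n k \<Longrightarrow> w \<in> t \<Longrightarrow> n \<bullet> w = k"
  using hull_inc [of w t affine] by (auto simp: plane_of_def)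

lemma closed_Union_T: "closed (\<Union>T)"
proof -
  have "closed t" if "t \<in> T" for t
  proof -
    have "compact (convex hull vertex_set t)"
      using that by (intro finite_imp_compact_convex_hull triangle_vertices)
    then show ?thesis using triangle_vertices(4) [OF that] compact_imp_closed by metis
  qed
  then show ?thesis using finite_T by blast
qed

lemma open_U: "open U"
  using closed_Union_T by (simp add: open_Compl)

lemma convex_triangle: "t \<in> T \<Longrightarrow> convex t"
  by (metis convex_convex_hull triangle_vertices(4))

text \<open>The intersection is a face of \<open>t\<close>. It is a proper one, since otherwise
  \<open>t\<close> would be a proper face of \<open>t'\<close> of the same dimension; and proper
  faces miss the relative interior.\<close>

lemma rel_interior_triangle_disjoint:
  assumes "t \<in> T" "t' \<in> T" "t \<noteq> t'"
  shows "rel_interior t \<inter> t' = {}"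
proof -
  have f: "(t \<inter> t') face_of t" "(t' \<inter> t) face_of t'"
    using complex assms in_complex unfolding geom_complex_def by blast+
  have "t \<inter> t' \<noteq> t"
  proof
    assume "t \<inter> t' = t"
    then have "t face_of t'" using f(2) by (simp add: Int_commute)
    then have "aff_dim t < aff_dim t'"
      using face_of_aff_dim_lt convex_triangle assms by blast
    then show False using aff_dim_triangle assms by simp
  qed
  then have "(t \<inter> t') \<inter> rel_interior t = {}"
    using face_of_disjoint_rel_interior [OF f(1)] by blast
  then show ?thesis using rel_interior_subset by blast
qed

text \<open>The relative boundary of a triangle is made of its three sides, all contained in the
  skeleton.\<close>

lemma rel_interior_triangleI:
  assumes t: "t \<in> T" and q: "q \<in> t" "q \<notin> skeleton"
  shows "q \<in> rel_interior t"
proof (rule ccontr)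
  assume "q \<notin> rel_interior t"
  then have "q \<in> convex hull (vertex_set t) - rel_interior (convex hull (vertex_set t))"
    using q triangle_vertices(4) [OF t] by simp
  then obtain a where a: "a \<in> vertex_set t" "q \<in> convex hull (vertex_set t - {a})"
    by (subst (asm) rel_boundary_of_convex_hull) (use triangle_vertices(2) [OF t] in auto)
  have "card (vertex_set t - {a}) = 2"
    using a(1) triangle_vertices [OF t] by simp
  then have "vertex_set t - {a} \<in> edge_ends" using t by (auto simp: edge_ends_def)
  then show False using a q by (auto simp: skeleton_def)
qed

lemma skeleton_subset: "skeleton \<subseteq> \<Union>T"
proof -
  have "convex hull E \<subseteq> t" if "t \<in> T" "E \<subseteq> vertex_set t" for E t
    using hull_mono [OF that(2), of convex] triangle_vertices(4) [OF that(1)] by simp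
  then show ?thesis by (auto simp: skeleton_def edge_ends_def)
qed

lemma rel_interior_nonempty: "t \<in> T \<Longrightarrow> rel_interior t \<noteq> {}"
  using aff_dim_triangle [of t] convex_triangle [of t] rel_interior_eq_empty [of t] by auto

text \<open>Near such a point the whole configuration looks like the single plane of
  \<open>t\<close>.\<close>

lemma small_ball:
  assumes t: "t \<in> T" and q: "q \<in> rel_interior t"
  obtains \<rho> where "\<rho> > 0" "ball q \<rho> \<inter> affine hull t \<subseteq> t" "\<And>t'. t' \<in> T \<Longrightarrow> t' \<noteq> t \<Longrightarrow> ball q \<rho> \<inter> t' = {}"
proof -
  obtain e where e: "e > 0" "ball q e \<inter> affine hull t \<subseteq> t"
    using q unfolding mem_rel_interior_ball by blast
  have "closed (\<Union>(T - {t}))"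
  proof -
    have "closed t'" if "t' \<in> T" for t'
      using that finite_imp_compact_convex_hull [OF triangle_vertices(1) [OF that]]
        triangle_vertices(4) [OF that] compact_imp_closed by metis
    then show ?thesis using finite_T by blast
  qed
  moreover have "q \<notin> \<Union>(T - {t})"
    using rel_interior_triangle_disjoint t q by blast
  ultimately obtain d where d: "d > 0" "ball q d \<subseteq> - \<Union>(T - {t})"
    by (metis Compl_iff open_Compl openE)
  show ?thesis
  proof (rule that [of "min e d"])
    show "ball q (min e d) \<inter> affine hull t \<subseteq> t" using e by auto
    show "ball q (min e d) \<inter> t' = {}" if "t' \<in> T" "t' \<noteq> t" for t'
      using d that by (auto simp: ball_min_Int)
  qed (use e d in auto)
qed

section \<open>The components on the two sides of a triangle\<close>

definition component :: "real^3 \<Rightarrow> (real^3) set" where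
  "component w = connected_component_set U w"

lemma component_eq:
  assumes "connected S" "S \<subseteq> U" "v \<in> S" "w \<in> S"
  shows "component v = component w"
proof -
  have "w \<in> connected_component_set U v" using connected_component_maximal assms by blast
  then show ?thesis unfolding component_def by (metis connected_component_eq)
qed

lemma halfspace_point:
  fixes q :: "'a::euclidean_space"
  assumes "n \<noteq> 0" "n \<bullet> q = k" "e > 0"
  obtains w where "w \<in> ball q e" "k < n \<bullet> w"
proof -
  define w where "w = q + (e / (2 * norm n)) *\<^sub>R n"
  have "w \<in> ball q e" using assms by (simp add: w_def dist_norm)
  moreover have "k < n \<bullet> w"
    using assms by (simp add: w_def inner_add_right)
  ultimately show ?thesis by (rule that)
qed

definition one_sided :: "real^3 \<Rightarrow> real \<Rightarrow> (real^3) set \<Rightarrow> real^3 \<Rightarrow> bool" where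
  "one_sided n k K q \<longleftrightarrow> (\<exists>\<rho>>0. \<forall>w\<in>ball q \<rho>. k < n \<bullet> w \<longrightarrow> w \<in> U \<and> component w = K)"

text \<open>The component touching \<open>t\<close> from a given side is locally constant along the relative interior
  of \<open>t\<close>, which is connected.\<close>

lemma one_sided_exists:
  assumes t: "t \<in> T" and p: "plane_of t n k"
  shows "\<exists>K. \<forall>q\<in>rel_interior t. one_sided n k K q"
proof -
  have loc: "\<exists>\<rho>>0. \<exists>K. \<forall>w\<in>ball q \<rho>. k < n \<bullet> w \<longrightarrow> w \<in> U \<and> component w = K"
    if q: "q \<in> rel_interior t" for q
  proof -
    obtain \<rho> where \<rho>: "\<rho> > 0" "ball q \<rho> \<inter> affine hull t \<subseteq> t"
      "\<And>t'. t' \<in> T \<Longrightarrow> t' \<noteq> t \<Longrightarrow> ball q \<rho> \<inter> t' = {}"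
      using small_ball t q by blast
    define H where "H = ball q \<rho> \<inter> {w. k < n \<bullet> w}"
    have "connected H"
      unfolding H_def by (intro convex_connected convex_Int convex_halfspace_gt convex_ball)
    moreover have "H \<subseteq> U"
      using \<rho>(3) plane_of_mem [OF p] by (fastforce simp: H_def)
    ultimately have "\<forall>w\<in>H. w \<in> U \<and> component w = component (SOME w. w \<in> H)"
      using component_eq [of H] someI [of "\<lambda>w. w \<in> H"] by blast
    then show ?thesis using \<rho>(1) by (auto simp: H_def)
  qed
  obtain q0 where q0: "q0 \<in> rel_interior t" using rel_interior_nonempty t by blast
  obtain K where K: "one_sided n k K q0" using loc [OF q0] unfolding one_sided_def by blast
  have "one_sided n k K q" if q: "q \<in> rel_interior t" for q
  proof (rule connected_induction_simple [of "rel_interior t" q0 q "one_sided n k K"])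
    show "connected (rel_interior t)"
      using convex_triangle [OF t] by (intro convex_connected convex_rel_interior)
    fix a assume a: "a \<in> rel_interior t"
    obtain \<rho> L where \<rho>: "\<rho> > 0" "\<forall>w\<in>ball a \<rho>. k < n \<bullet> w \<longrightarrow> w \<in> U \<and> component w = L"
      using loc [OF a] by blast
    have step: "one_sided n k K y" if x: "x \<in> rel_interior t" "x \<in> ball a \<rho>" "one_sided n k K x"
      and y: "y \<in> ball a \<rho>" for x y
    proof -
      obtain r where r: "r > 0" "\<forall>w\<in>ball x r. k < n \<bullet> w \<longrightarrow> w \<in> U \<and> component w = K"
        using x unfolding one_sided_def by blast
      obtain r' where r': "r' > 0" "ball x r' \<subseteq> ball a \<rho>"
        using x(2) by (meson openE open_ball)
      obtain w where w: "w \<in> ball x (min r r')" "k < n \<bullet> w"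
        using halfspace_point [of n x k "min r r'"] p x(1) rel_interior_subset [of t] r r'
          plane_of_mem [OF p] by (metis min_less_iff_conj plane_of_def subsetD)
      then have "w \<in> ball x r" "w \<in> ball a \<rho>" using r' by auto
      \<comment> \<open>The point \<open>w\<close> is above the plane and in both balls, so it
        forces the two local values to agree.\<close>
      then have KL: "K = L" using w(2) r(2) \<rho>(2) by metis
      obtain s where s: "s > 0" "ball y s \<subseteq> ball a \<rho>"
        using y by (meson openE open_ball)
      show ?thesis
        unfolding one_sided_def
      proof (intro exI conjI ballI impI)
        fix w assume "w \<in> ball y s" "k < n \<bullet> w"
        then show "w \<in> U" "component w = K" using s(2) \<rho>(2) KL by blast+
      qed (fact s(1))
    qed
    show "\<exists>S. openin (top_of_set (rel_interior t)) S \<and> a \<in> S \<and>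
        (\<forall>x\<in>S. \<forall>y\<in>S. one_sided n k K x \<longrightarrow> one_sided n k K y)"
    proof (intro exI conjI ballI impI)
      show "openin (top_of_set (rel_interior t)) (rel_interior t \<inter> ball a \<rho>)"
        by (simp add: openin_open_Int)
      show "a \<in> rel_interior t \<inter> ball a \<rho>" using a \<rho>(1) by simp
    qed (use step in blast)
  qed (use q q0 K in auto)
  then show ?thesis by blast
qed

text \<open>All four data are chosen at once so that \<open>upper\<close> and \<open>lower\<close>
  refer to the same orientation of the normal. The two components may coincide; the triangle is then
  a loop of the dual graph.\<close>

definition side_data :: "(real^3) set \<Rightarrow> (real^3) \<times> real \<times> (real^3) set \<times> (real^3) set" where
  "side_data t = (SOME (n, k, K, L). plane_of t n k \<and>
    (\<forall>q\<in>rel_interior t. one_sided n k K q \<and> one_sided (- n) (- k) L q))"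

definition normal where "normal t = fst (side_data t)"
definition offset where "offset t = fst (snd (side_data t))"
definition upper where "upper t = fst (snd (snd (side_data t)))"
definition lower where "lower t = snd (snd (snd (side_data t)))"

lemma side_data:
  assumes "t \<in> T"
  shows "plane_of t (normal t) (offset t)"
    "q \<in> rel_interior t \<Longrightarrow> one_sided (normal t) (offset t) (upper t) q"
    "q \<in> rel_interior t \<Longrightarrow> one_sided (- normal t) (- offset t) (lower t) q"
proof -
  let ?P = "\<lambda>(n, k, K, L). plane_of t n k \<and>
    (\<forall>q\<in>rel_interior t. one_sided n k K q \<and> one_sided (- n) (- k) L q)"
  obtain n k where p: "plane_of t n k" using plane_of_exists assms by blast
  obtain K L where "\<forall>q\<in>rel_interior t. one_sided n k K q" "\<forall>q\<in>rel_interior t. one_sided (- n) (- k) L q"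
    using one_sided_exists [OF assms p] one_sided_exists [OF assms plane_of_minus [OF p]] by blast
  then have "?P (n, k, K, L)" using p by auto
  then have "?P (side_data t)" unfolding side_data_def by (rule someI [of ?P])
  then have *: "plane_of t (normal t) (offset t) \<and> (\<forall>q\<in>rel_interior t.
      one_sided (normal t) (offset t) (upper t) q \<and> one_sided (- normal t) (- offset t) (lower t) q)"
    by (simp add: normal_def offset_def upper_def lower_def case_prod_unfold)
  then show "plane_of t (normal t) (offset t)"
    "q \<in> rel_interior t \<Longrightarrow> one_sided (normal t) (offset t) (upper t) q"
    "q \<in> rel_interior t \<Longrightarrow> one_sided (- normal t) (- offset t) (lower t) q" by blast+
qed

lemma side_ball:
  assumes t: "t \<in> T" and q: "q \<in> rel_interior t"
  obtains \<rho> where "\<rho> > 0" "ball q \<rho> \<inter> affine hull t \<subseteq> t"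
    "\<And>t'. t' \<in> T \<Longrightarrow> t' \<noteq> t \<Longrightarrow> ball q \<rho> \<inter> t' = {}"
    "\<And>w. w \<in> ball q \<rho> \<Longrightarrow> offset t < normal t \<bullet> w \<Longrightarrow> component w = upper t"
    "\<And>w. w \<in> ball q \<rho> \<Longrightarrow> normal t \<bullet> w < offset t \<Longrightarrow> component w = lower t"
proof -
  obtain \<rho>1 where 1: "\<rho>1 > 0" "ball q \<rho>1 \<inter> affine hull t \<subseteq> t"
    "\<And>t'. t' \<in> T \<Longrightarrow> t' \<noteq> t \<Longrightarrow> ball q \<rho>1 \<inter> t' = {}"
    using small_ball t q by blast
  obtain \<rho>2 where 2: "\<rho>2 > 0" "\<forall>w\<in>ball q \<rho>2. offset t < normal t \<bullet> w \<longrightarrow> component w = upper t"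
    using side_data(2) [OF t q] unfolding one_sided_def by blast
  obtain \<rho>3 where 3: "\<rho>3 > 0" "\<forall>w\<in>ball q \<rho>3. - offset t < - normal t \<bullet> w \<longrightarrow> component w = lower t"
    using side_data(3) [OF t q] unfolding one_sided_def by blast
  show ?thesis
  proof (rule that [of "min \<rho>1 (min \<rho>2 \<rho>3)"])
    show "ball q (min \<rho>1 (min \<rho>2 \<rho>3)) \<inter> t' = {}" if "t' \<in> T" "t' \<noteq> t" for t'
      using 1(3) [OF that] by (auto simp: ball_min_Int)
  qed (use 1 2 3 in \<open>auto simp: ball_min_Int\<close>)
qed

end

section \<open>Intersection numbers modulo 2\<close>

context space_complex begin

text \<open>The mod 2 intersection number of a segment with the 2-chain \<open>x\<close>. Recording
  only whether a triangle is met suffices: a segment with an end off the plane of the triangle meets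
  it at most once.\<close>

definition crossing_sum :: "((real^3) set \<Rightarrow> bit) \<Rightarrow> real^3 \<Rightarrow> real^3 \<Rightarrow> bit" where
  "crossing_sum x y z = (\<Sum>t\<in>T. x t * meets (closed_segment y z) t)"

definition off_planes :: "real^3 \<Rightarrow> bool" where
  "off_planes y \<longleftrightarrow> (\<forall>t\<in>T. y \<notin> affine hull t)"

text \<open>Exactly what the parity identity asks of \<open>p\<close>, \<open>y\<close>,
  \<open>z\<close> against every triangle of the configuration at once.\<close>

definition generic_triangle :: "real^3 \<Rightarrow> real^3 \<Rightarrow> real^3 \<Rightarrow> bool" where
  "generic_triangle p y z \<longleftrightarrow> off_planes p \<and> off_planes y \<and> off_planes z \<and>
     (\<exists>n k. n \<bullet> p = k \<and> n \<bullet> y = k \<and> n \<bullet> z = k \<and> (\<forall>v\<in>vertices. n \<bullet> v \<noteq> k)) \<and>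
     sides p y z \<inter> skeleton = {}"

lemma off_planes_U: "off_planes y \<Longrightarrow> y \<in> U"
  using hull_inc [of y _ affine] by (auto simp: off_planes_def)

lemma off_planes_hull: "off_planes w \<longleftrightarrow> (\<forall>S \<in> vertex_set ` T. w \<notin> affine hull S)"
proof -
  have "affine hull t = affine hull (vertex_set t)" if "t \<in> T" for t
    using triangle_vertices(4) [OF that] affine_hull_convex_hull by metis
  then show ?thesis by (auto simp: off_planes_def)
qed

lemma crossing_sum_commute: "crossing_sum x z y = crossing_sum x y z"
  by (simp add: crossing_sum_def closed_segment_commute)

lemma meets_triangle_sides:
  assumes gen: "generic_triangle p y z" and t: "t \<in> T"
  shows "meets (closed_segment p y) t + meets (closed_segment y z) t + meets (closed_segment z p) t =
    (\<Sum>E | E \<in> edge_ends \<and> E \<subseteq> vertex_set t. meets (convex hull {p, y, z}) (convex hull E))"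
proof -
  obtain a b c where t_eq: "vertex_set t = {a, b, c}" "a \<noteq> b" "b \<noteq> c" "c \<noteq> a" "t = convex hull {a, b, c}"
    using triangle_cases t by blast
  obtain m l where pl: "plane_of t m l" using plane_of_exists t by blast
  have abc: "{a, b, c} \<subseteq> t" "{a, b, c} \<subseteq> vertices"
    using t_eq t hull_subset [of "{a, b, c}" convex] by (auto simp: vertices_def)
  have m: "m \<bullet> a = l" "m \<bullet> b = l" "m \<bullet> c = l" using plane_of_mem [OF pl] abc by auto
  have off: "m \<bullet> p \<noteq> l" "m \<bullet> y \<noteq> l" "m \<bullet> z \<noteq> l"
    using gen t pl by (auto simp: generic_triangle_def off_planes_def plane_of_def)
  obtain n k where n: "n \<bullet> p = k" "n \<bullet> y = k" "n \<bullet> z = k" "\<forall>v\<in>vertices. n \<bullet> v \<noteq> k"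
    using gen unfolding generic_triangle_def by blast
  have E: "{E. E \<in> edge_ends \<and> E \<subseteq> vertex_set t} = {{a, b}, {b, c}, {c, a}}"
  proof (intro equalityI subsetI)
    fix E assume "E \<in> {E. E \<in> edge_ends \<and> E \<subseteq> vertex_set t}"
    then show "E \<in> {{a, b}, {b, c}, {c, a}}"
      using t_eq by (auto simp: edge_ends_def card_2_iff doubleton_eq_iff)
  next
    fix E assume "E \<in> {{a, b}, {b, c}, {c, a}}"
    then show "E \<in> {E. E \<in> edge_ends \<and> E \<subseteq> vertex_set t}"
      using t_eq(1-4) t by (auto simp: edge_ends_def intro!: bexI [of _ t])
  qed
  have "sides a b c \<subseteq> skeleton"
    using E by (auto simp: sides_def skeleton_def segment_convex_hull)
  then have disj: "sides a b c \<inter> sides p y z = {}" using gen unfolding generic_triangle_def by blast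
  have "crossing_parity a b c p y z = 0"
    by (rule crossing_parity_eq_0 [OF n(1-3) _ _ _ m off disj]) (use n(4) abc in auto)
  moreover have "(\<Sum>E | E \<in> edge_ends \<and> E \<subseteq> vertex_set t. meets (convex hull {p, y, z}) (convex hull E)) =
      meets (convex hull {p, y, z}) (closed_segment a b) + meets (convex hull {p, y, z}) (closed_segment b c) +
      meets (convex hull {p, y, z}) (closed_segment c a)"
    unfolding E segment_convex_hull using t_eq(2-4) by (simp add: doubleton_eq_iff add.assoc)
  ultimately show ?thesis
    unfolding crossing_parity_def t_eq(5) by (simp only: bit_add_eq_0_iff)
qed

text \<open>The mod 2 rule that the boundary of a triangle meets a chain as often as the triangle
  meets the boundary of the chain: the parity identity is summed over all \<open>t\<close> and the
  sums over triangles and their sides are exchanged.\<close>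

lemma crossing_sum_triangle:
  assumes gen: "generic_triangle p y z"
  shows "crossing_sum x p y + crossing_sum x y z + crossing_sum x z p =
    (\<Sum>E\<in>edge_ends. meets (convex hull {p, y, z}) (convex hull E) * (\<Sum>t | t \<in> T \<and> E \<subseteq> vertex_set t. x t))"
proof -
  let ?m = "\<lambda>E. meets (convex hull {p, y, z}) (convex hull E)"
  have "crossing_sum x p y + crossing_sum x y z + crossing_sum x z p =
      (\<Sum>t\<in>T. x t * (meets (closed_segment p y) t + meets (closed_segment y z) t + meets (closed_segment z p) t))"
    by (simp add: crossing_sum_def sum.distrib distrib_left)
  also have "\<dots> = (\<Sum>t\<in>T. \<Sum>E | E \<in> edge_ends \<and> E \<subseteq> vertex_set t. ?m E * x t)"
    by (intro sum.cong refl) (simp add: meets_triangle_sides [OF gen] sum_distrib_left mult.commute)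
  also have "\<dots> = (\<Sum>E\<in>edge_ends. \<Sum>t | t \<in> T \<and> E \<subseteq> vertex_set t. ?m E * x t)"
    by (rule sum.swap_restrict [OF finite_T finite_edge_ends])
  finally show ?thesis by (simp add: sum_distrib_left)
qed

text \<open>The height over the plane of \<open>t\<close> is affine along the line and,
  \<open>y\<close> being off the plane, cannot vanish twice.\<close>

lemma segment_triangle_unique:
  assumes t: "t \<in> T" and y: "off_planes y"
    and r: "y + r *\<^sub>R (z - y) \<in> t" "y + s *\<^sub>R (z - y) \<in> t"
  shows "r = s"
proof -
  let ?n = "normal t" and ?k = "offset t"
  note pl = side_data(1) [OF t]
  have yk: "?n \<bullet> y \<noteq> ?k" using y t pl by (auto simp: off_planes_def plane_of_def)
  have "?n \<bullet> y + r * (?n \<bullet> (z - y)) = ?k" "?n \<bullet> y + s * (?n \<bullet> (z - y)) = ?k"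
    using plane_of_mem [OF pl r(1)] plane_of_mem [OF pl r(2)] by (simp_all add: inner_add_right)
  then have "(r - s) * (?n \<bullet> (z - y)) = 0" "?n \<bullet> (z - y) \<noteq> 0" using yk by (auto simp: algebra_simps)
  then show ?thesis by simp
qed

text \<open>Walking from \<open>y\<close> to \<open>z\<close>, each crossing of a triangle
  \<open>t\<close> moves between \<open>upper t\<close> and \<open>lower t\<close> and adds exactly
  \<open>c (upper t) + c (lower t)\<close>, so the contributions telescope. \<open>N a b\<close> is
  the partial sum over the parameters from \<open>a\<close> to \<open>b\<close>.\<close>

lemma crossing_sum_components:
  fixes c :: "(real^3) set \<Rightarrow> bit"
  assumes y: "off_planes y" and z: "off_planes z" and sk: "closed_segment y z \<inter> skeleton = {}"
  shows "crossing_sum (\<lambda>t. c (upper t) + c (lower t)) y z = c (component y) + c (component z)"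
proof -
  define \<gamma> where "\<gamma> s = y + s *\<^sub>R (z - y)" for s
  define N where "N a b = (\<Sum>t\<in>T. (c (upper t) + c (lower t)) * of_bool (\<exists>r\<in>{a..b}. \<gamma> r \<in> t))" for a b
  have seg: "\<gamma> ` {0..1} = closed_segment y z"
  proof -
    have "\<gamma> s = (1 - s) *\<^sub>R y + s *\<^sub>R z" for s by (simp add: \<gamma>_def algebra_simps)
    then show ?thesis unfolding closed_segment_image_interval by auto
  qed
  have cont: "continuous_on UNIV \<gamma>" unfolding \<gamma>_def by (intro continuous_intros)
  have uniq: "r = s" if "t \<in> T" "\<gamma> r \<in> t" "\<gamma> s \<in> t" for t r s
    using segment_triangle_unique [OF that(1) y] that(2,3) unfolding \<gamma>_def .
  \<comment> \<open>As \<open>\<gamma> b\<close> is in \<open>U\<close>, no crossing occurs at the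
    common end, hence none is counted twice.\<close>
  have N_add: "N a b' = N a b + N b b'" if le: "a \<le> b" "b \<le> b'" and bU: "\<gamma> b \<in> U" for a b b'
  proof -
    have "of_bool (\<exists>r\<in>{a..b'}. \<gamma> r \<in> t) = (of_bool (\<exists>r\<in>{a..b}. \<gamma> r \<in> t) + of_bool (\<exists>r\<in>{b..b'}. \<gamma> r \<in> t) :: bit)"
      if t: "t \<in> T" for t
    proof (cases "\<exists>r. \<gamma> r \<in> t")
      case True
      then obtain r where r: "\<gamma> r \<in> t" by blast
      then have iff: "\<gamma> s \<in> t \<longleftrightarrow> s = r" for s
        using uniq [OF t] by blast
      have "r \<noteq> b" using r bU t by auto
      then show ?thesis using le by (cases "r \<le> b") (auto simp: iff)
    qed auto
    then show ?thesis by (simp add: N_def sum.distrib distrib_left)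
  qed
  have nhd: "\<exists>\<epsilon>>0. \<forall>s. \<bar>s - s0\<bar> < \<epsilon> \<longrightarrow> \<gamma> s \<in> S" if S: "open S" "\<gamma> s0 \<in> S" for S s0
  proof -
    have "open (\<gamma> -` S)" using cont S(1) by (simp add: open_vimage)
    then obtain \<epsilon> where "\<epsilon> > 0" "ball s0 \<epsilon> \<subseteq> \<gamma> -` S" using S(2) by (meson openE vimageI2)
    then show ?thesis by (intro exI [of _ \<epsilon>]) (auto simp: dist_real_def subset_iff abs_minus_commute)
  qed
  have local: "\<exists>\<epsilon>>0. \<forall>a b. \<bar>a - s0\<bar> < \<epsilon> \<and> \<bar>b - s0\<bar> < \<epsilon> \<and> a \<le> b \<and> \<gamma> a \<in> U \<and> \<gamma> b \<in> U \<longrightarrow>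
      N a b = c (component (\<gamma> a)) + c (component (\<gamma> b))" if s0: "s0 \<in> {0..1}" for s0
  proof (cases "\<gamma> s0 \<in> U")
    case True
    then obtain e where e: "e > 0" "ball (\<gamma> s0) e \<subseteq> U" using open_U by (meson openE)
    obtain \<epsilon> where \<epsilon>: "\<epsilon> > 0" "\<And>s. \<bar>s - s0\<bar> < \<epsilon> \<Longrightarrow> \<gamma> s \<in> ball (\<gamma> s0) e"
      using nhd [of "ball (\<gamma> s0) e" s0] e(1) by auto
    have "N a b = c (component (\<gamma> a)) + c (component (\<gamma> b))"
      if ab: "\<bar>a - s0\<bar> < \<epsilon>" "\<bar>b - s0\<bar> < \<epsilon>" for a b
    proof -
      have "\<gamma> r \<notin> t" if "r \<in> {a..b}" "t \<in> T" for r t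
      proof -
        have "\<bar>r - s0\<bar> < \<epsilon>" using that(1) ab by auto
        then show ?thesis using \<epsilon>(2) e(2) that(2) by blast
      qed
      then have "N a b = 0" unfolding N_def by (intro sum.neutral) auto
      moreover have "component (\<gamma> a) = component (\<gamma> b)"
        using component_eq [OF connected_ball e(2)] \<epsilon>(2) ab by blast
      ultimately show ?thesis by simp
    qed
    then show ?thesis using \<epsilon>(1) by blast
  next
    case False
    then obtain t where t: "t \<in> T" "\<gamma> s0 \<in> t" by blast
    \<comment> \<open>The segment avoids the skeleton, so a crossing happens in the relative
      interior, where the two sides are defined.\<close>
    have q: "\<gamma> s0 \<in> rel_interior t"
      using rel_interior_triangleI t sk seg s0 by blast
    obtain \<rho> where \<rho>: "\<rho> > 0" "\<And>t'. t' \<in> T \<Longrightarrow> t' \<noteq> t \<Longrightarrow> ball (\<gamma> s0) \<rho> \<inter> t' = {}"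
      "\<And>w. w \<in> ball (\<gamma> s0) \<rho> \<Longrightarrow> offset t < normal t \<bullet> w \<Longrightarrow> component w = upper t"
      "\<And>w. w \<in> ball (\<gamma> s0) \<rho> \<Longrightarrow> normal t \<bullet> w < offset t \<Longrightarrow> component w = lower t"
      using side_ball [OF t(1) q] by metis
    obtain \<epsilon> where \<epsilon>: "\<epsilon> > 0" "\<And>s. \<bar>s - s0\<bar> < \<epsilon> \<Longrightarrow> \<gamma> s \<in> ball (\<gamma> s0) \<rho>"
      using nhd [of "ball (\<gamma> s0) \<rho>" s0] \<rho>(1) by auto
    define \<beta> where "\<beta> = normal t \<bullet> (z - y)"
    note pl = side_data(1) [OF t(1)]
    have height: "normal t \<bullet> \<gamma> s = offset t + (s - s0) * \<beta>" for s
      using plane_of_mem [OF pl t(2)] by (simp add: \<gamma>_def \<beta>_def inner_add_right algebra_simps)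
    have "\<beta> \<noteq> 0"
    proof
      assume "\<beta> = 0"
      then have "normal t \<bullet> y = offset t" using height [of 0] by (simp add: \<gamma>_def)
      then show False using y t(1) pl by (auto simp: off_planes_def plane_of_def)
    qed
    have comp: "component (\<gamma> s) = (if 0 < (s - s0) * \<beta> then upper t else lower t)"
      if "\<bar>s - s0\<bar> < \<epsilon>" "s \<noteq> s0" for s
    proof (cases "0 < (s - s0) * \<beta>")
      case True
      then show ?thesis using \<rho>(3) [OF \<epsilon>(2) [OF that(1)]] height by simp
    next
      case False
      moreover have "(s - s0) * \<beta> \<noteq> 0" using that(2) \<open>\<beta> \<noteq> 0\<close> by simp
      ultimately have "(s - s0) * \<beta> < 0" by linarith
      then show ?thesis using \<rho>(4) [OF \<epsilon>(2) [OF that(1)]] height by simp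
    qed
    have "N a b = c (component (\<gamma> a)) + c (component (\<gamma> b))"
      if ab: "\<bar>a - s0\<bar> < \<epsilon>" "\<bar>b - s0\<bar> < \<epsilon>" "a \<le> b" "\<gamma> a \<in> U" "\<gamma> b \<in> U" for a b
    proof -
      have ne: "a \<noteq> s0" "b \<noteq> s0" using ab t by auto
      have other: "\<gamma> r \<notin> t'" if "r \<in> {a..b}" "t' \<in> T" "t' \<noteq> t" for r t'
      proof -
        have "\<bar>r - s0\<bar> < \<epsilon>" using that(1) ab by auto
        then show ?thesis using \<epsilon>(2) \<rho>(2) that by blast
      qed
      have N1: "N a b = (\<Sum>t'\<in>{t}. (c (upper t') + c (lower t')) * of_bool (\<exists>r\<in>{a..b}. \<gamma> r \<in> t'))"
        unfolding N_def using other t(1) finite_T by (intro sum.mono_neutral_right) auto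
      have hit: "(\<exists>r\<in>{a..b}. \<gamma> r \<in> t) \<longleftrightarrow> a < s0 \<and> s0 < b"
      proof -
        have "\<gamma> r \<in> t \<longleftrightarrow> r = s0" for r
          using uniq [OF t(1) _ t(2)] t(2) by blast
        then have "(\<exists>r\<in>{a..b}. \<gamma> r \<in> t) \<longleftrightarrow> s0 \<in> {a..b}" by simp
        then show ?thesis using ne by (simp add: less_le)
      qed
      have Nab: "N a b = (c (upper t) + c (lower t)) * of_bool (a < s0 \<and> s0 < b)"
        unfolding N1 by (simp only: sum.insert finite.emptyI empty_iff not_False_eq_True sum.empty hit) simp
      consider "a < s0" "s0 < b" | "b < s0" | "s0 < a" using ne ab(3) by linarith
      then show ?thesis
      proof cases
        case 1
        have "0 < (a - s0) * \<beta> \<longleftrightarrow> \<not> 0 < (b - s0) * \<beta>"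
          using 1 \<open>\<beta> \<noteq> 0\<close> by (auto simp: zero_less_mult_iff)
        then have "c (component (\<gamma> a)) + c (component (\<gamma> b)) = c (upper t) + c (lower t)"
          unfolding comp [OF ab(1) ne(1)] comp [OF ab(2) ne(2)] by (simp add: add.commute)
        then show ?thesis using Nab 1 by simp
      next
        case 2
        have "0 < (a - s0) * \<beta> \<longleftrightarrow> 0 < (b - s0) * \<beta>"
          using 2 ab(3) by (simp add: zero_less_mult_iff)
        then have "component (\<gamma> a) = component (\<gamma> b)"
          unfolding comp [OF ab(1) ne(1)] comp [OF ab(2) ne(2)] by simp
        then show ?thesis using Nab 2 by simp
      next
        case 3
        have "0 < (a - s0) * \<beta> \<longleftrightarrow> 0 < (b - s0) * \<beta>"
          using 3 ab(3) by (simp add: zero_less_mult_iff)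
        then have "component (\<gamma> a) = component (\<gamma> b)"
          unfolding comp [OF ab(1) ne(1)] comp [OF ab(2) ne(2)] by simp
        then show ?thesis using Nab 3 by simp
      qed
    qed
    then show ?thesis using \<epsilon>(1) by blast
  qed
  have U01: "\<gamma> 0 \<in> U" "\<gamma> 1 \<in> U" using off_planes_U y z by (auto simp: \<gamma>_def)
  have "N 0 1 = c (component (\<gamma> 0)) + c (component (\<gamma> 1))"
  \<comment> \<open>The claim makes sense only at parameters with \<open>\<gamma> s\<close> in
    \<open>U\<close>. These are dense, since every triangle is hit at most once and so only finitely
    many parameters are excluded.\<close>
  proof (rule connected_induction [where S = "{0..1}" and a = 0 and b = 1 and P = "\<lambda>s. \<gamma> s \<in> U"
        and Q = "\<lambda>s. N 0 s = c (component (\<gamma> 0)) + c (component (\<gamma> s))"])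
    fix S and a :: real assume S: "openin (top_of_set {0..1}) S" "a \<in> S"
    show "\<exists>s. s \<in> S \<and> \<gamma> s \<in> U"
    proof (rule ccontr)
      assume "\<not> ?thesis"
      then have "S \<subseteq> (\<Union>t\<in>T. {s. \<gamma> s \<in> t})" by auto
      moreover have "finite {s. \<gamma> s \<in> t}" if "t \<in> T" for t
      proof (cases "\<exists>r. \<gamma> r \<in> t")
        case True
        then obtain r where "\<gamma> r \<in> t" by blast
        then have "{s. \<gamma> s \<in> t} \<subseteq> {r}"
          using uniq [OF that] by blast
        then show ?thesis using finite_subset by blast
      qed simp
      ultimately have "finite S" using finite_T by (meson finite_UN finite_subset)
      moreover have "infinite S"
      proof -
        obtain e where e: "e > 0" "ball a e \<inter> {0..1} \<subseteq> S" and a: "a \<in> {0..1}"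
          using S unfolding openin_contains_ball by blast
        define l u where "l = max 0 (a - e)" and "u = min 1 (a + e)"
        have "{l<..<u} \<subseteq> ball a e \<inter> {0..1}" by (auto simp: l_def u_def dist_real_def)
        then have "{l<..<u} \<subseteq> S" using e(2) by blast
        moreover have "l < u" using e(1) a by (auto simp: l_def u_def)
        ultimately show ?thesis using infinite_Ioo infinite_super by blast
      qed
      ultimately show False by blast
    qed
  next
    fix s0 :: real assume s0: "s0 \<in> {0..1}"
    obtain \<epsilon> where \<epsilon>: "\<epsilon> > 0" "\<And>a b. \<bar>a - s0\<bar> < \<epsilon> \<Longrightarrow> \<bar>b - s0\<bar> < \<epsilon> \<Longrightarrow> a \<le> b \<Longrightarrow> \<gamma> a \<in> U \<Longrightarrow>
        \<gamma> b \<in> U \<Longrightarrow> N a b = c (component (\<gamma> a)) + c (component (\<gamma> b))"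
      using local [OF s0] by blast
    have step: "N 0 b = c (component (\<gamma> 0)) + c (component (\<gamma> b))"
      if a: "a \<in> {0..1}" "\<bar>a - s0\<bar> < \<epsilon>" "\<gamma> a \<in> U" and b: "b \<in> {0..1}" "\<bar>b - s0\<bar> < \<epsilon>" "\<gamma> b \<in> U"
        and Na: "N 0 a = c (component (\<gamma> 0)) + c (component (\<gamma> a))" for a b
    proof (cases "a \<le> b")
      case True
      have "N 0 b = N 0 a + N a b" using a True by (intro N_add) auto
      then show ?thesis using \<epsilon>(2) [OF a(2) b(2) True a(3) b(3)] Na
        by (cases "c (component (\<gamma> a))") auto
    next
      case False
      then have "N 0 a = N 0 b + N b a" using b by (intro N_add) auto
      then have "N 0 b = N 0 a + N b a" by (simp add: add.assoc)
      moreover have "N b a = c (component (\<gamma> b)) + c (component (\<gamma> a))"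
        using \<epsilon>(2) [OF b(2) a(2) _ b(3) a(3)] False by simp
      ultimately show ?thesis using Na
        by (cases "c (component (\<gamma> a))") auto
    qed
    show "\<exists>S. openin (top_of_set {0..1}) S \<and> s0 \<in> S \<and> (\<forall>a\<in>S. \<forall>b\<in>S.
        \<gamma> a \<in> U \<and> \<gamma> b \<in> U \<and> N 0 a = c (component (\<gamma> 0)) + c (component (\<gamma> a)) \<longrightarrow>
        N 0 b = c (component (\<gamma> 0)) + c (component (\<gamma> b)))"
    proof (intro exI conjI ballI impI)
      show "openin (top_of_set {0..1}) ({0..1} \<inter> ball s0 \<epsilon>)" by (simp add: openin_open_Int)
      show "s0 \<in> {0..1} \<inter> ball s0 \<epsilon>" using s0 \<epsilon>(1) by simp
      fix a b assume ab: "a \<in> {0..1} \<inter> ball s0 \<epsilon>" "b \<in> {0..1} \<inter> ball s0 \<epsilon>"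
        "\<gamma> a \<in> U \<and> \<gamma> b \<in> U \<and> N 0 a = c (component (\<gamma> 0)) + c (component (\<gamma> a))"
      then have "\<bar>a - s0\<bar> < \<epsilon>" "\<bar>b - s0\<bar> < \<epsilon>" by (simp_all add: dist_real_def abs_minus_commute)
      then show "N 0 b = c (component (\<gamma> 0)) + c (component (\<gamma> b))"
        using step [of a b] ab by blast
    qed
  next
    show "N 0 0 = c (component (\<gamma> 0)) + c (component (\<gamma> 0))"
      using U01 by (auto simp: N_def intro!: sum.neutral)
  qed (use U01 in auto)
  moreover have "crossing_sum (\<lambda>t. c (upper t) + c (lower t)) y z = N 0 1"
  proof -
    have "meets (closed_segment y z) t = of_bool (\<exists>r\<in>{0..1}. \<gamma> r \<in> t)" for t
      unfolding meets_def seg [symmetric] by (rule arg_cong [of _ _ of_bool]) blast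
    then show ?thesis by (simp add: crossing_sum_def N_def)
  qed
  ultimately show ?thesis by (simp add: \<gamma>_def)
qed

end

context space_complex begin

subsection \<open>Cuts are cycles\<close>

text \<open>Two edges of the complex intersect in a common face, and a face of an edge that contains
  its midpoint contains both ends.\<close>

lemma edge_ends_midpoint:
  assumes E: "E \<in> edge_ends" "E = {u, v}" "u \<noteq> v" and E': "E' \<in> edge_ends" "E' \<noteq> E"
  shows "midpoint u v \<notin> convex hull E'"
proof
  let ?m = "midpoint u v"
  assume m: "?m \<in> convex hull E'"
  obtain t t' where t: "t \<in> T" "E \<subseteq> vertex_set t" and t': "t' \<in> T" "E' \<subseteq> vertex_set t'"
    and card: "card E = 2" "card E' = 2"
    using E(1) E'(1) by (auto simp: edge_ends_def)
  note e = geom_complex_subset_face [OF complex in_complex [OF t(1)] t(2)]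
  note e' = geom_complex_subset_face [OF complex in_complex [OF t'(1)] t'(2)]
  let ?f = "convex hull E \<inter> convex hull E'"
  have f: "?f face_of convex hull E" "?f face_of convex hull E'"
    using complex e(1) e'(1) unfolding geom_complex_def by (metis inf_commute)+
  have "?m \<in> open_segment u v" using E(3) by simp
  moreover have "?m \<in> convex hull E"
    using E(2) by (simp add: segment_convex_hull [symmetric])
  moreover have "u \<in> convex hull E" "v \<in> convex hull E" using E(2) by (simp_all add: hull_inc)
  ultimately have "u \<in> ?f" "v \<in> ?f" using f(1) m unfolding face_of_def by blast+
  then have "convex hull E \<subseteq> convex hull E'"
    using E(2) by (intro hull_minimal) auto
  then have "convex hull E face_of convex hull E'" using f(2) by (simp add: Int_absorb2)
  then have "vertex_set (convex hull E) \<subseteq> vertex_set (convex hull E')"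
    using face_of_geom_simplex_iff e(3) e'(3) by blast
  then have "E \<subseteq> E'" using e(2) e'(2) by simp
  then have "E = E'" using card by (metis card_subset_eq card.infinite zero_neq_numeral)
  then show False using E'(2) by simp
qed

lemma edge_midpoint_ball:
  assumes E: "E \<in> edge_ends" "E = {u, v}" "u \<noteq> v"
  obtains r where "r > 0" "\<And>E'. E' \<in> edge_ends \<Longrightarrow> E' \<noteq> E \<Longrightarrow> ball (midpoint u v) r \<inter> convex hull E' = {}"
proof -
  let ?S = "\<Union>E'\<in>edge_ends - {E}. convex hull E'"
  have "compact (convex hull E')" if "E' \<in> edge_ends" for E'
    using that by (metis edge_ends_cases finite.emptyI finite_insert finite_imp_compact_convex_hull)
  then have "closed ?S"
    using finite_edge_ends by (intro closed_UN) (auto simp: compact_imp_closed)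
  moreover have "midpoint u v \<notin> ?S" using edge_ends_midpoint [OF E] by blast
  ultimately obtain r where "r > 0" "ball (midpoint u v) r \<subseteq> - ?S"
    by (metis Compl_iff open_Compl openE)
  then show ?thesis by (intro that [of r]) blast+
qed

text \<open>Needed for a point \<open>m - y\<close> determined by a free point \<open>y\<close>:
  keeping it off a plane amounts to keeping \<open>y\<close> off the reflected plane.\<close>

lemma in_affine_hull_reflect:
  fixes m :: "'a::real_normed_vector"
  assumes "w \<in> affine hull S"
  shows "m - w \<in> affine hull ((\<lambda>w. m - w) ` S)"
proof -
  have "(\<lambda>w. m - w) ` X = (+) m ` ((*\<^sub>R) (-1) ` X)" for X
    by (auto simp: image_image)
  moreover have "affine hull ((*\<^sub>R) (-1) ` S) = (*\<^sub>R) (-1) ` (affine hull S)"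
    by (rule affine_hull_linear_image [symmetric]) (rule bounded_linear_scaleR_right)
  ultimately have "affine hull ((\<lambda>w. m - w) ` S) = (\<lambda>w. m - w) ` (affine hull S)"
    by (simp only: affine_hull_translation)
  then show ?thesis using assms by simp
qed

text \<open>Three vectors with sum 0 have equal consecutive cross products; they will be the corners
  of a triangle seen from its centroid.\<close>

lemma cross3_centered:
  fixes a b :: "real^3"
  shows "cross3 b (- a - b) = cross3 a b" "cross3 (- a - b) a = cross3 a b"
  by (simp_all add: cross3_simps)

text \<open>A small triangle with its centroid at the midpoint \<open>m\<close> of \<open>E\<close>,
  in a plane through \<open>m\<close> containing no vertex. It meets \<open>E\<close> at
  \<open>m\<close> alone, away from its own sides, and is too small to reach another edge.\<close>

lemma linking_triangle:
  assumes E: "E \<in> edge_ends"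
  obtains p y z where "generic_triangle p y z"
    "\<And>E'. E' \<in> edge_ends \<Longrightarrow> meets (convex hull {p, y, z}) (convex hull E') = of_bool (E' = E)"
proof -
  obtain u v where uv: "E = {u, v}" "u \<noteq> v" "u \<in> vertices" "v \<in> vertices"
    using E edge_ends_cases by metis
  define m where "m = midpoint u v"
  obtain r where r: "r > 0" "\<And>E'. E' \<in> edge_ends \<Longrightarrow> E' \<noteq> E \<Longrightarrow> ball m r \<inter> convex hull E' = {}"
    using edge_midpoint_ball [OF E uv(1,2)] unfolding m_def by blast
  \<comment> \<open>If \<open>m\<close> were a vertex of a triangle, another edge would end in
    \<open>m\<close>, inside the ball that excludes all other edges.\<close>
  have mv: "m \<notin> vertices"
  proof
    assume "m \<in> vertices"
    then obtain t where t: "t \<in> T" "m \<in> vertex_set t" by (auto simp: vertices_def)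
    obtain a b c where abc: "vertex_set t = {a, b, c}" "a \<noteq> b" "b \<noteq> c" "c \<noteq> a"
      using triangle_cases t(1) by metis
    have "\<exists>w\<in>vertex_set t. w \<noteq> m" using abc by auto
    then obtain w where w: "w \<in> vertex_set t" "w \<noteq> m" by blast
    then have "{m, w} \<in> edge_ends" using t by (auto simp: edge_ends_def)
    moreover have "{m, w} \<noteq> E" using uv by (auto simp: m_def doubleton_eq_iff midpoint_eq_endpoint)
    moreover have "m \<in> ball m r \<inter> convex hull {m, w}" using r(1) by (simp add: hull_inc)
    ultimately show False using r(2) by blast
  qed
  let ?\<T> = "vertex_set ` T"
  have fT: "finite ?\<T>" "\<And>S. S \<in> ?\<T> \<Longrightarrow> finite S \<and> card S = 3"
    using finite_T triangle_vertices by auto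
  have off: "off_planes w" if "\<And>S. S \<in> ?\<T> \<Longrightarrow> w \<notin> affine hull S" for w
    using that unfolding off_planes_hull by blast
  obtain p where p: "p \<in> ball m (r / 2)"
    "\<And>S. S \<in> (\<lambda>w. {m, w}) ` vertices \<union> ?\<T> \<Longrightarrow> p \<notin> affine hull S"
  proof (rule generic_point [of "(\<lambda>w. {m, w}) ` vertices \<union> ?\<T>" "ball m (r / 2)"])
    show "finite S \<and> card S \<le> DIM(real^3)" if "S \<in> (\<lambda>w. {m, w}) ` vertices \<union> ?\<T>" for S
      using that fT(2) card_insert_le_m1 by (fastforce simp: card_insert_if)
  qed (use finite_vertices fT r(1) in auto)
  \<comment> \<open>The third corner will be \<open>m + m + m - p - y\<close>, to make
    \<open>m\<close> the centroid. It is not free, so its genericity is imposed on \<open>y\<close>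
    through the reflected vertex sets. The radius \<open>r / 2\<close> for \<open>p\<close> and
    \<open>y\<close> keeps it within \<open>r\<close> of \<open>m\<close>.\<close>
  let ?\<R> = "(\<lambda>S. (\<lambda>w. (m + m + m - p) - w) ` S) ` ?\<T>"
  obtain y where y: "y \<in> ball m (r / 2)"
    "\<And>S. S \<in> (\<lambda>w. {m, p, w}) ` vertices \<union> ?\<T> \<union> ?\<R> \<Longrightarrow> y \<notin> affine hull S"
  proof (rule generic_point [of "(\<lambda>w. {m, p, w}) ` vertices \<union> ?\<T> \<union> ?\<R>" "ball m (r / 2)"])
    show "finite S \<and> card S \<le> DIM(real^3)" if "S \<in> (\<lambda>w. {m, p, w}) ` vertices \<union> ?\<T> \<union> ?\<R>" for S
    proof -
      consider w where "S = {m, p, w}" | "S \<in> ?\<T>" | S' where "S' \<in> ?\<T>" "S = (\<lambda>w. (m + m + m - p) - w) ` S'"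
        using \<open>S \<in> _\<close> by blast
      then show ?thesis
      proof cases
        case 1 then show ?thesis by (simp add: card_insert_if)
      next
        case 2 then show ?thesis using fT(2) by simp
      next
        case 3 then show ?thesis using fT(2) [OF 3(1)] card_image_le [of S'] by auto
      qed
    qed
  qed (use finite_vertices fT r(1) in auto)
  define z where "z = m + m + m - p - y"
  define n where "n = cross3 (p - m) (y - m)"
  have zball: "z \<in> ball m r"
  proof -
    have "z - m = (m - p) + (m - y)" by (simp add: z_def algebra_simps)
    then have "norm (z - m) \<le> norm (m - p) + norm (m - y)" by (metis norm_triangle_ineq)
    then show ?thesis using p(1) y(1) by (simp add: dist_norm norm_minus_commute)
  qed
  have hull_ball: "convex hull {p, y, z} \<subseteq> ball m r"
    using p(1) y(1) zball r(1) by (intro hull_minimal) auto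
  have nn: "n \<bullet> w \<noteq> n \<bullet> m" if "w \<in> vertices" for w
    unfolding n_def
  proof (rule cross3_generic)
    show "w \<noteq> m" using mv that by blast
    show "p \<notin> affine hull {m, w}" "y \<notin> affine hull {m, p, w}" using p(2) y(2) that by blast+
  qed
  have n_on: "n \<bullet> p = n \<bullet> m" "n \<bullet> y = n \<bullet> m" "n \<bullet> z = n \<bullet> m"
  proof -
    show 1: "n \<bullet> p = n \<bullet> m" "n \<bullet> y = n \<bullet> m"
    proof -
      have "n \<bullet> (p - m) = 0" "n \<bullet> (y - m) = 0" unfolding n_def by (simp_all add: dot_cross_self)
      then show "n \<bullet> p = n \<bullet> m" "n \<bullet> y = n \<bullet> m" by (simp_all add: inner_diff_right)
    qed
    show "n \<bullet> z = n \<bullet> m" unfolding z_def inner_diff_right inner_add_right 1 by simp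
  qed
  have off_p: "off_planes p"
  proof (rule off)
    fix S assume "S \<in> ?\<T>"
    then show "p \<notin> affine hull S" by (intro p(2) UnI2)
  qed
  have off_y: "off_planes y"
  proof (rule off)
    fix S assume "S \<in> ?\<T>"
    then show "y \<notin> affine hull S" by (intro y(2)) (rule UnI1, rule UnI2)
  qed
  have off_z: "off_planes z"
  proof (rule off)
    fix S assume S: "S \<in> ?\<T>"
    show "z \<notin> affine hull S"
    proof
      assume "z \<in> affine hull S"
      moreover have "y \<notin> affine hull ((\<lambda>w. (m + m + m - p) - w) ` S)"
        using S by (intro y(2) UnI2 imageI)
      moreover have "m + m + m - p - z = y" by (simp add: z_def)
      ultimately show False using in_affine_hull_reflect by metis
    qed
  qed
  \<comment> \<open>The plane contains \<open>m\<close> but neither end of \<open>E\<close>, so it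
    crosses the edge transversally.\<close>
  have mem_E: "w = m" if w: "w \<in> convex hull E" "n \<bullet> w = n \<bullet> m" for w
  proof -
    have "w \<in> closed_segment u v" using w(1) uv(1) by (simp add: segment_convex_hull)
    then obtain s where s: "w = (1 - s) *\<^sub>R u + s *\<^sub>R v" by (auto simp: in_segment)
    have mm: "m = (1 / 2) *\<^sub>R u + (1 / 2) *\<^sub>R v" by (simp add: m_def midpoint_def scaleR_add_right)
    have "(s - 1 / 2) * (n \<bullet> v - n \<bullet> u) = n \<bullet> w - n \<bullet> m"
      by (simp add: s mm inner_add_right algebra_simps)
    then have "(s - 1 / 2) * (n \<bullet> v - n \<bullet> u) = 0" using that(2) by simp
    moreover have "n \<bullet> v \<noteq> n \<bullet> u"
    proof
      assume "n \<bullet> v = n \<bullet> u"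
      then have "n \<bullet> u = n \<bullet> m" by (simp add: mm inner_add_right)
      then show False using nn uv by blast
    qed
    ultimately have s2: "s = 1 / 2" by simp
    show ?thesis unfolding s mm s2 by simp
  qed
  have hull_plane: "convex hull {p, y, z} \<subseteq> {w. n \<bullet> w = n \<bullet> m}"
    using n_on by (rule triangle_subset_hyperplane)
  have sides_sub: "sides p y z \<subseteq> convex hull {p, y, z}"
    unfolding sides_def segment_convex_hull by (intro Un_least hull_mono) auto
  have n0: "n \<noteq> 0" using nn [OF uv(3)] by auto
  \<comment> \<open>If the centroid were on a side, the cross product for that side would vanish;
    but for each side it equals \<open>n\<close>.\<close>
  have m_segment: "cross3 (a - m) (b - m) = 0" if "m \<in> closed_segment a b" for a b
  proof -
    obtain s where s: "m = (1 - s) *\<^sub>R a + s *\<^sub>R b" using \<open>m \<in> _\<close> by (auto simp: in_segment)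
    have "a - m = s *\<^sub>R (a - b)" "b - m = (s - 1) *\<^sub>R (a - b)" by (simp_all add: s algebra_simps)
    then show ?thesis by (simp add: cross_mult_left cross_mult_right)
  qed
  have m_sides: "m \<notin> sides p y z"
  proof
    have zm: "z - m = - (p - m) - (y - m)" by (simp add: z_def)
    have "cross3 (y - m) (z - m) = n" "cross3 (z - m) (p - m) = n"
      unfolding n_def zm by (rule cross3_centered)+
    moreover assume "m \<in> sides p y z"
    ultimately show False unfolding sides_def using n0 m_segment n_def by auto
  qed
  have disj: "sides p y z \<inter> skeleton = {}"
  proof -
    have "sides p y z \<inter> convex hull E' = {}" if "E' \<in> edge_ends" for E'
    proof (cases "E' = E")
      case True
      show ?thesis
      proof (rule ccontr)
        assume "sides p y z \<inter> convex hull E' \<noteq> {}"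
        then obtain w where "w \<in> sides p y z" "w \<in> convex hull E" using True by blast
        moreover from this have "w = m" using mem_E hull_plane sides_sub by blast
        ultimately show False using m_sides by blast
      qed
    next
      case False
      then show ?thesis using r(2) [OF that] sides_sub hull_ball by blast
    qed
    then show ?thesis by (auto simp: skeleton_def)
  qed
  have gen: "generic_triangle p y z"
    unfolding generic_triangle_def using off_p off_y off_z disj
    by (intro conjI exI [of _ n] exI [of _ "n \<bullet> m"]) (use n_on nn in simp_all)
  moreover have "meets (convex hull {p, y, z}) (convex hull E') = of_bool (E' = E)"
    if "E' \<in> edge_ends" for E'
  proof (cases "E' = E")
    case True
    have "m = (1 / 3) *\<^sub>R p + (1 / 3) *\<^sub>R y + (1 / 3) *\<^sub>R z"
    proof -
      have "m + m + m = (1 + 1 + 1) *\<^sub>R m" by (simp only: scaleR_add_left scaleR_one)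
      moreover have "p + y + z = m + m + m" by (simp add: z_def)
      ultimately have "(1 / 3) *\<^sub>R (p + y + z) = m" by simp
      then show ?thesis by (simp only: scaleR_add_right)
    qed
    then have "m \<in> convex hull {p, y, z}" unfolding convex_hull_3
      by (intro CollectI exI [of _ "1 / 3"]) simp
    moreover have "m \<in> convex hull E"
      unfolding uv(1) segment_convex_hull [symmetric] m_def by simp
    ultimately show ?thesis using True by (auto simp: meets_def)
  next
    case False
    then have "convex hull {p, y, z} \<inter> convex hull E' = {}"
      using r(2) [OF that] hull_ball by blast
    then show ?thesis using False by (simp add: meets_def)
  qed
  ultimately show ?thesis by (rule that)
qed

text \<open>For the triangle linking \<open>E\<close>, the intersection number of its boundary with
  \<open>x\<close> is the sum of \<open>x\<close> around \<open>E\<close>. The same number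
  telescopes to 0, because the three sides close up and each component value occurs twice.\<close>

lemma cut_in_kernel:
  fixes c :: "(real^3) set \<Rightarrow> bit"
  assumes x: "x \<in> GF2_space T" "\<And>t. t \<in> T \<Longrightarrow> x t = c (upper t) + c (lower t)"
  shows "x \<in> kernel \<Delta>"
proof -
  have "(\<Sum>t | t \<in> T \<and> E \<subseteq> vertex_set t. x t) = 0" if E: "card E = 2" for E
  proof (cases "E \<in> edge_ends")
    case False
    then have "{t. t \<in> T \<and> E \<subseteq> vertex_set t} = {}" using E by (auto simp: edge_ends_def)
    then show ?thesis by (metis sum.empty)
  next
    case True
    obtain p y z where gen: "generic_triangle p y z"
      and E: "\<And>E'. E' \<in> edge_ends \<Longrightarrow> meets (convex hull {p, y, z}) (convex hull E') = of_bool (E' = E)"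
      using linking_triangle [OF True] by metis
    let ?x = "\<lambda>t. c (upper t) + c (lower t)"
    have off: "off_planes p" "off_planes y" "off_planes z"
      and sk: "closed_segment p y \<inter> skeleton = {}" "closed_segment y z \<inter> skeleton = {}"
        "closed_segment z p \<inter> skeleton = {}"
      using gen unfolding generic_triangle_def sides_def by blast+
    have "(\<Sum>t | t \<in> T \<and> E \<subseteq> vertex_set t. x t) = (\<Sum>t | t \<in> T \<and> E \<subseteq> vertex_set t. ?x t)"
      using x(2) by (intro sum.cong) auto
    also have "\<dots> = (\<Sum>E'\<in>edge_ends. if E' = E then (\<Sum>t | t \<in> T \<and> E' \<subseteq> vertex_set t. ?x t) else 0)"
      using True finite_edge_ends by (simp add: sum.delta)
    also have "\<dots> = (\<Sum>E'\<in>edge_ends. meets (convex hull {p, y, z}) (convex hull E') *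
        (\<Sum>t | t \<in> T \<and> E' \<subseteq> vertex_set t. ?x t))"
      using E by (intro sum.cong) auto
    also have "\<dots> = crossing_sum ?x p y + crossing_sum ?x y z + crossing_sum ?x z p"
      by (rule crossing_sum_triangle [OF gen, symmetric])
    also have "\<dots> = (c (component p) + c (component y)) + (c (component y) + c (component z)) +
        (c (component z) + c (component p))"
      by (simp only: crossing_sum_components [OF off(1,2) sk(1)] crossing_sum_components [OF off(2,3) sk(2)]
          crossing_sum_components [OF off(3,1) sk(3)])
    also have "\<dots> = 0"
      by (cases "c (component p)"; cases "c (component y)"; cases "c (component z)") simp_all
    finally show ?thesis .
  qed
  then show ?thesis unfolding kernel_eq_cycles [OF complex] using x(1) by blast
qed

end

context space_complex begin

subsection \<open>Cycles are cuts\<close>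

text \<open>The condition on \<open>{p, v, w}\<close> makes the segment from \<open>p\<close> to
  \<open>y\<close> miss every edge, provided \<open>p\<close> is off all planes.\<close>

definition general_position :: "real^3 \<Rightarrow> real^3 \<Rightarrow> bool" where
  "general_position p y \<longleftrightarrow> off_planes y \<and> (\<forall>v\<in>vertices. \<forall>w\<in>vertices. y \<notin> affine hull {p, v, w})"

lemma off_planes_exists: "\<exists>p. off_planes p"
proof -
  have "finite (vertex_set ` T)" using finite_T by blast
  moreover have "finite S \<and> card S \<le> DIM(real^3)" if "S \<in> vertex_set ` T" for S
    using that triangle_vertices by auto
  ultimately obtain p :: "real^3" where "\<And>S. S \<in> vertex_set ` T \<Longrightarrow> p \<notin> affine hull S"
    using generic_point [of "vertex_set ` T" "UNIV :: (real^3) set"] by (metis open_UNIV UNIV_not_empty)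
  then show ?thesis unfolding off_planes_hull by blast
qed

lemma off_planes_segment:
  assumes p: "off_planes p" and y: "\<forall>v\<in>vertices. \<forall>w\<in>vertices. y \<notin> affine hull {p, v, w}"
  shows "closed_segment p y \<inter> skeleton = {}"
proof -
  have "closed_segment p y \<inter> convex hull E = {}" if E: "E \<in> edge_ends" for E
  proof -
    obtain v w where vw: "E = {v, w}" "v \<in> vertices" "w \<in> vertices"
      using E edge_ends_cases by metis
    have "p \<notin> \<Union>T" using off_planes_U [OF p] by simp
    then have "p \<notin> convex hull E" using skeleton_subset E by (auto simp: skeleton_def)
    then show ?thesis
      using segment_avoids_segment [of p v w y] y vw by (simp add: segment_convex_hull)
  qed
  then show ?thesis by (auto simp: skeleton_def)
qed

text \<open>One \<open>z\<close> serves all \<open>y\<close> in \<open>Y\<close>, so that two points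
  can be compared through a common third corner. With \<open>Y\<close> empty it says that points in
  general position are dense.\<close>

lemma generic_apex:
  assumes p: "off_planes p" and Y: "finite Y" "\<And>y. y \<in> Y \<Longrightarrow> general_position p y"
    and S: "open S" "S \<noteq> {}"
  obtains z where "z \<in> S" "general_position p z" "\<And>y. y \<in> Y \<Longrightarrow> generic_triangle p y z"
proof -
  \<comment> \<open>Avoiding the hulls in \<open>?P\<close> keeps the segments from \<open>p\<close>
    and from \<open>y\<close> to \<open>z\<close> off the skeleton; avoiding those in
    \<open>?Q\<close> keeps the plane of \<open>p\<close>, \<open>y\<close>, \<open>z\<close> off
    the vertices.\<close>
  let ?P = "\<lambda>y. (\<lambda>(v, w). {y, v, w}) ` (vertices \<times> vertices)"
  let ?Q = "\<lambda>y. (\<lambda>v. {p, y, v}) ` vertices"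
  let ?\<S> = "vertex_set ` T \<union> ?P p \<union> (\<Union>y\<in>Y. ?P y \<union> ?Q y)"
  obtain z where z: "z \<in> S" "\<And>A. A \<in> ?\<S> \<Longrightarrow> z \<notin> affine hull A"
  proof (rule generic_point [of ?\<S> S])
    show "finite ?\<S>" using finite_T finite_vertices Y(1) by simp
    show "finite A \<and> card A \<le> DIM(real^3)" if A: "A \<in> ?\<S>" for A
    proof -
      consider "A \<in> vertex_set ` T" | a b c where "A = {a, b, c}" using A by fast
      then show ?thesis
      proof cases
        case 1 then show ?thesis using triangle_vertices by auto
      next
        case 2 then show ?thesis by (simp add: card_insert_if)
      qed
    qed
  qed (use S in auto)
  have zP: "z \<notin> affine hull {y, v, w}" if "y = p \<or> y \<in> Y" "v \<in> vertices" "w \<in> vertices" for y v w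
  proof -
    have mem: "{y, v, w} \<in> ?P y" using that by force
    from that(1) have "{y, v, w} \<in> ?\<S>"
    proof
      assume "y = p"
      then show ?thesis using mem by (intro UnI1 UnI2) simp
    next
      assume "y \<in> Y"
      then show ?thesis using mem by (intro UnI2 UN_I UnI1)
    qed
    then show ?thesis by (rule z(2))
  qed
  have zQ: "z \<notin> affine hull {p, y, v}" if "y \<in> Y" "v \<in> vertices" for y v
    using that by (intro z(2) UnI2 UN_I [of y] imageI)
  have off_z: "off_planes z" unfolding off_planes_hull by (intro ballI z(2)) blast
  have gz: "general_position p z" unfolding general_position_def using off_z zP by blast
  have "generic_triangle p y z" if y: "y \<in> Y" for y
    unfolding generic_triangle_def
  proof (intro conjI exI)
    have gy: "general_position p y" using Y(2) y by blast
    then show off_y: "off_planes y" unfolding general_position_def by blast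
    let ?n = "cross3 (y - p) (z - p)"
    show "?n \<bullet> p = ?n \<bullet> p" ..
    have "?n \<bullet> (y - p) = 0" "?n \<bullet> (z - p) = 0" by (simp_all add: dot_cross_self)
    then show "?n \<bullet> y = ?n \<bullet> p" "?n \<bullet> z = ?n \<bullet> p" by (simp_all add: inner_diff_right)
    show "\<forall>v\<in>vertices. ?n \<bullet> v \<noteq> ?n \<bullet> p"
    proof
      fix v assume v: "v \<in> vertices"
      then obtain t where t: "t \<in> T" "v \<in> vertex_set t" by (auto simp: vertices_def)
      then have "v \<in> t" using triangle_vertices(4) [OF t(1)] hull_inc by metis
      then have "v \<noteq> p" using off_planes_U [OF p] t by auto
      moreover have "y \<notin> affine hull {p, v}"
        using gy v unfolding general_position_def by (metis insert_absorb2)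
      ultimately show "?n \<bullet> v \<noteq> ?n \<bullet> p" using cross3_generic zQ y v by blast
    qed
    have "closed_segment p y \<inter> skeleton = {}"
      using gy off_planes_segment [OF p] unfolding general_position_def by blast
    moreover have "closed_segment y z \<inter> skeleton = {}"
      using off_planes_segment [OF off_y] zP y by blast
    moreover have "closed_segment p z \<inter> skeleton = {}"
      using off_planes_segment [OF p] zP by blast
    ultimately show "sides p y z \<inter> skeleton = {}"
      unfolding sides_def closed_segment_commute [of z p] by blast
  qed (use p off_z in auto)
  then show ?thesis using that z(1) gz by blast
qed

text \<open>A cycle has no boundary for the triangle to meet, so its intersection numbers are
  additive around a generic triangle.\<close>

lemma kernel_crossing_sum:
  assumes x: "x \<in> kernel \<Delta>" and gen: "generic_triangle p y z"
  shows "crossing_sum x p y + crossing_sum x y z = crossing_sum x p z"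
proof -
  have "(\<Sum>t | t \<in> T \<and> E \<subseteq> vertex_set t. x t) = 0" if "E \<in> edge_ends" for E
    using x that unfolding kernel_eq_cycles [OF complex] edge_ends_def by blast
  then have "crossing_sum x p y + crossing_sum x y z + crossing_sum x z p = 0"
    unfolding crossing_sum_triangle [OF gen] by (simp add: sum.neutral)
  then show ?thesis unfolding bit_add_eq_0_iff by (simp add: crossing_sum_commute)
qed

lemma component_open_connected: "open (component w)" "connected (component w)" "component w \<subseteq> U"
  unfolding component_def
  by (simp_all add: open_connected_component open_U connected_component_subset)

lemma component_self: "w \<in> U \<Longrightarrow> w \<in> component w"
  by (simp add: component_def connected_component_refl)

text \<open>Inside a ball of the component no segment meets a triangle, so two points of the ball
  have the parity of a common third corner \<open>z\<close>. Connectedness, restricted to the dense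
  set of points in general position, spreads this over the component.\<close>

lemma crossing_sum_const:
  assumes p: "off_planes p" and x: "x \<in> kernel \<Delta>"
    and yz: "y \<in> component w" "z \<in> component w" "general_position p y" "general_position p z"
  shows "crossing_sum x p y = crossing_sum x p z"
proof (rule connected_induction [where S = "component w" and a = y and b = z and
      P = "general_position p" and Q = "\<lambda>z. crossing_sum x p y = crossing_sum x p z"])
  fix S a assume S: "openin (top_of_set (component w)) S" "a \<in> S"
  then have "open S" using component_open_connected(1) openin_open_eq by blast
  then show "\<exists>z. z \<in> S \<and> general_position p z"
    using generic_apex [OF p, of "{}" S] S(2) by blast
next
  fix a assume a: "a \<in> component w"
  obtain r where r: "r > 0" "ball a r \<subseteq> component w"
    using component_open_connected(1) a by (meson openE)
  have zero: "crossing_sum x u v = 0" if "u \<in> ball a r" "v \<in> ball a r" for u v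
  proof -
    have "closed_segment u v \<subseteq> ball a r" using that by (intro closed_segment_subset) auto
    then have "closed_segment u v \<subseteq> U" using r(2) component_open_connected(3) by blast
    then have "meets (closed_segment u v) t = 0" if "t \<in> T" for t
      using that by (auto simp: meets_def)
    then show ?thesis unfolding crossing_sum_def by (intro sum.neutral) simp
  qed
  have step: "crossing_sum x p u = crossing_sum x p v"
    if uv: "u \<in> ball a r" "v \<in> ball a r" "general_position p u" "general_position p v" for u v
  proof -
    obtain z where z: "z \<in> ball a r" "generic_triangle p u z" "generic_triangle p v z"
      using generic_apex [OF p, of "{u, v}" "ball a r"] uv r(1)
      by (metis centre_in_ball empty_iff finite.emptyI finite_insert insertE insertI1 insertI2 open_ball)
    show ?thesis
      using kernel_crossing_sum [OF x z(2)] kernel_crossing_sum [OF x z(3)]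
        zero [OF uv(1) z(1)] zero [OF uv(2) z(1)] by simp
  qed
  show "\<exists>S. openin (top_of_set (component w)) S \<and> a \<in> S \<and> (\<forall>u\<in>S. \<forall>v\<in>S.
      general_position p u \<and> general_position p v \<and> crossing_sum x p y = crossing_sum x p u \<longrightarrow>
      crossing_sum x p y = crossing_sum x p v)"
  proof (intro exI conjI ballI impI)
    show "openin (top_of_set (component w)) (ball a r)"
      using r(2) by (simp add: open_subset)
    show "a \<in> ball a r" using r(1) by simp
    fix u v assume "u \<in> ball a r" "v \<in> ball a r"
      "general_position p u \<and> general_position p v \<and> crossing_sum x p y = crossing_sum x p u"
    then show "crossing_sum x p y = crossing_sum x p v" using step by metis
  qed
qed (use yz component_open_connected in auto)

text \<open>The potential of a component is the crossing parity from a fixed \<open>p\<close> to any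
  of its points in general position. Just above and just below \<open>t\<close> it differs by the
  crossing number of a short segment that meets \<open>t\<close> and no other triangle, which is
  \<open>x t\<close>.\<close>

lemma kernel_in_cut:
  assumes x: "x \<in> kernel \<Delta>"
  shows "\<exists>c. \<forall>t\<in>T. x t = c (upper t) + c (lower t)"
proof -
  obtain p where p: "off_planes p" using off_planes_exists by blast
  define c where "c K = crossing_sum x p (SOME y. y \<in> K \<and> general_position p y)" for K
  have c: "c (component y) = crossing_sum x p y" if y: "general_position p y" for y
  proof -
    have "y \<in> component y" using component_self off_planes_U y unfolding general_position_def by blast
    then have "\<exists>z. z \<in> component y \<and> general_position p z" using y by blast
    from someI_ex [OF this] show ?thesis
      unfolding c_def using crossing_sum_const [OF p x _ _ _ y] \<open>y \<in> component y\<close> by blast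
  qed
  have "x t = c (upper t) + c (lower t)" if t: "t \<in> T" for t
  proof -
    obtain q where q: "q \<in> rel_interior t" using rel_interior_nonempty [OF t] by blast
    obtain r where r: "r > 0" "ball q r \<inter> affine hull t \<subseteq> t"
      "\<And>t'. t' \<in> T \<Longrightarrow> t' \<noteq> t \<Longrightarrow> ball q r \<inter> t' = {}"
      "\<And>w. w \<in> ball q r \<Longrightarrow> offset t < normal t \<bullet> w \<Longrightarrow> component w = upper t"
      "\<And>w. w \<in> ball q r \<Longrightarrow> normal t \<bullet> w < offset t \<Longrightarrow> component w = lower t"
      using side_ball [OF t q] by blast
    note pl = side_data(1) [OF t]
    have n0: "normal t \<noteq> 0" and nq: "normal t \<bullet> q = offset t"
      using pl plane_of_mem [OF pl] q rel_interior_subset by (auto simp: plane_of_def)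
    let ?A = "ball q r \<inter> {w. offset t < normal t \<bullet> w}"
    let ?B = "ball q r \<inter> {w. normal t \<bullet> w < offset t}"
    have "open ?A" "open ?B" by (simp_all add: open_Int open_halfspace_gt open_halfspace_lt)
    moreover have "?A \<noteq> {}"
      using halfspace_point [OF n0 nq r(1)] by blast
    moreover have "?B \<noteq> {}"
    proof -
      obtain w where "w \<in> ball q r" "- offset t < - normal t \<bullet> w"
        using halfspace_point [of "- normal t" q "- offset t" r] n0 nq r(1) by auto
      then show ?thesis by auto
    qed
    ultimately obtain y where y: "y \<in> ?A" "general_position p y"
      using generic_apex [OF p, of "{}" ?A] by (metis empty_iff finite.emptyI)
    obtain z where z: "z \<in> ?B" "general_position p z" "generic_triangle p y z"
      using generic_apex [OF p, of "{y}" ?B] y(2) \<open>open ?B\<close> \<open>?B \<noteq> {}\<close>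
      by (metis finite.emptyI finite_insert singletonD singletonI)
    have seg: "closed_segment y z \<subseteq> ball q r" using y(1) z(1) by (intro closed_segment_subset) auto
    have "c (upper t) + c (lower t) = crossing_sum x p y + crossing_sum x p z"
    proof -
      have "component y = upper t" "component z = lower t" using r(4,5) y(1) z(1) by blast+
      then show ?thesis using c [OF y(2)] c [OF z(2)] by metis
    qed
    also have "\<dots> = crossing_sum x y z"
      using kernel_crossing_sum [OF x z(3)] by (metis add.assoc add.left_neutral bit_add_self)
    also have "\<dots> = (\<Sum>t'\<in>{t}. x t' * meets (closed_segment y z) t')"
      unfolding crossing_sum_def
    proof (rule sum.mono_neutral_right)
      show "\<forall>t'\<in>T - {t}. x t' * meets (closed_segment y z) t' = 0"
      proof
        fix t' assume "t' \<in> T - {t}"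
        then have "closed_segment y z \<inter> t' = {}" using r(3) seg by blast
        then show "x t' * meets (closed_segment y z) t' = 0" by (simp add: meets_def)
      qed
    qed (use finite_T t in auto)
    also have "meets (closed_segment y z) t = 1"
    proof -
      have "\<exists>w\<in>closed_segment z y. normal t \<bullet> w = offset t"
      proof -
        have "closed_segment z y \<inter> {w. normal t \<bullet> w = offset t} = {cut_point (normal t) (offset t) z y}"
          using y(1) z(1) by (intro cut_point_segment) auto
        then show ?thesis by blast
      qed
      then obtain w where "w \<in> closed_segment y z" "normal t \<bullet> w = offset t"
        by (auto simp: closed_segment_commute)
      then have "w \<in> closed_segment y z \<inter> t" using r(2) seg pl unfolding plane_of_def by blast
      then show ?thesis by (auto simp: meets_def)
    qed
    then have "(\<Sum>t'\<in>{t}. x t' * meets (closed_segment y z) t') = x t" by simp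
    finally show ?thesis by simp
  qed
  then show ?thesis by blast
qed

theorem kernel_eq_potentials:
  "kernel \<Delta> = {x \<in> GF2_space T. \<exists>c. \<forall>t\<in>T. x t = c (upper t) + c (lower t)}"
  using cut_in_kernel kernel_in_cut by (auto simp: kernel_def)

end

section \<open>Cycles and isomorphisms\<close>

text \<open>Carries the cycle condition to triangles labelled by \<open>I\<close> with abstract
  vertex sets. It serves both isomorphisms and realizations; pairs outside \<open>W\<close> or its
  image lie in no triangle and give empty sums.\<close>

lemma kernel_indexed:
  fixes \<Delta> :: "'a::real_vector set set" and tri :: "'k \<Rightarrow> 'v set"
  assumes cx: "geom_complex \<Delta>" and bij: "bij_betw \<psi> I (triangles \<Delta>)" and inj: "inj_on f W"
    and tri: "\<And>k. k \<in> I \<Longrightarrow> tri k \<subseteq> W \<and> vertex_set (\<psi> k) = f ` tri k"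
    and x: "x \<in> GF2_space (triangles \<Delta>)"
  shows "x \<in> kernel \<Delta> \<longleftrightarrow> (\<forall>E. card E = 2 \<longrightarrow> (\<Sum>k | k \<in> I \<and> E \<subseteq> tri k. x (\<psi> k)) = 0)"
proof -
  have eq: "(\<Sum>k | k \<in> I \<and> E \<subseteq> tri k. x (\<psi> k)) =
      (\<Sum>t | t \<in> triangles \<Delta> \<and> f ` E \<subseteq> vertex_set t. x t)" if E: "E \<subseteq> W" for E
  proof (rule sum.reindex_bij_betw)
    have sub: "E \<subseteq> tri k \<longleftrightarrow> f ` E \<subseteq> vertex_set (\<psi> k)" if "k \<in> I" for k
      using tri [OF that] inj_on_image_subset_iff [OF inj E] by simp
    have img: "\<psi> ` {k. k \<in> I \<and> E \<subseteq> tri k} = {t. t \<in> triangles \<Delta> \<and> f ` E \<subseteq> vertex_set t}"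
      unfolding bij_betw_imp_surj_on [OF bij, symmetric] using sub by blast
    have "inj_on \<psi> {k. k \<in> I \<and> E \<subseteq> tri k}"
      by (rule inj_on_subset [OF bij_betw_imp_inj_on [OF bij]]) auto
    then show "bij_betw \<psi> {k. k \<in> I \<and> E \<subseteq> tri k} {t. t \<in> triangles \<Delta> \<and> f ` E \<subseteq> vertex_set t}"
      using img by (rule bij_betw_imageI)
  qed
  have "(\<forall>E. card E = 2 \<longrightarrow> (\<Sum>k | k \<in> I \<and> E \<subseteq> tri k. x (\<psi> k)) = 0) \<longleftrightarrow>
      (\<forall>E'. card E' = 2 \<longrightarrow> (\<Sum>t | t \<in> triangles \<Delta> \<and> E' \<subseteq> vertex_set t. x t) = 0)"
  proof (intro iffI allI impI)
    fix E' :: "'a set"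
    assume *: "\<forall>E. card E = 2 \<longrightarrow> (\<Sum>k | k \<in> I \<and> E \<subseteq> tri k. x (\<psi> k)) = 0" and E': "card E' = 2"
    show "(\<Sum>t | t \<in> triangles \<Delta> \<and> E' \<subseteq> vertex_set t. x t) = 0"
    proof (cases "E' \<subseteq> f ` W")
      case True
      then obtain E where E: "E \<subseteq> W" "E' = f ` E" by (auto simp: subset_image_iff)
      then have "card E = 2" using E' card_image [OF inj_on_subset [OF inj E(1)]] by simp
      then show ?thesis using * eq [OF E(1)] E(2) by simp
    next
      case False
      have "\<not> E' \<subseteq> vertex_set t" if t: "t \<in> triangles \<Delta>" for t
      proof -
        obtain k where "k \<in> I" "t = \<psi> k"
          using t unfolding bij_betw_imp_surj_on [OF bij, symmetric] by blast
        then show ?thesis using tri [of k] False by blast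
      qed
      then have "{t. t \<in> triangles \<Delta> \<and> E' \<subseteq> vertex_set t} = {}" by blast
      then show ?thesis by (metis sum.empty)
    qed
  next
    fix E :: "'v set"
    assume *: "\<forall>E'. card E' = 2 \<longrightarrow> (\<Sum>t | t \<in> triangles \<Delta> \<and> E' \<subseteq> vertex_set t. x t) = 0"
      and E: "card E = 2"
    show "(\<Sum>k | k \<in> I \<and> E \<subseteq> tri k. x (\<psi> k)) = 0"
    proof (cases "E \<subseteq> W")
      case True
      then have "card (f ` E) = 2" using E card_image [OF inj_on_subset [OF inj True]] by simp
      then show ?thesis using * eq [OF True] by simp
    next
      case False
      then have "{k. k \<in> I \<and> E \<subseteq> tri k} = {}" using tri by blast
      then show ?thesis by (metis sum.empty)
    qed
  qed
  then show ?thesis using x unfolding kernel_eq_cycles [OF cx] by blast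
qed

text \<open>The number of vertices is what an isomorphism of complexes preserves.\<close>

lemma triangles_iff_card:
  assumes "geom_complex \<Delta>"
  shows "s \<in> triangles \<Delta> \<longleftrightarrow> s \<in> \<Delta> \<and> card (vertex_set s) = 3"
proof (cases "s \<in> \<Delta>")
  case True
  then obtain n where n: "geom_simplex n s" using assms unfolding geom_complex_def by blast
  have "geom_simplex 2 s \<longleftrightarrow> card (vertex_set s) = 3"
    using geom_simplex_vertex_set(3) [OF n] n geom_simplex_vertex_set(3) [of 2 s] by auto
  then show ?thesis using True by (simp add: triangles_def)
qed (simp add: triangles_def)

lemma geom_complex_hull:
  assumes "geom_complex \<Delta>" "s \<in> \<Delta>"
  shows "s = convex hull (vertex_set s)"
proof -
  obtain n where "geom_simplex n s" using assms unfolding geom_complex_def by blast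
  then show ?thesis by (rule geom_simplex_vertex_set)
qed

lemma complex_iso_triangles:
  assumes cx: "geom_complex \<Delta>" "geom_complex \<Delta>'" and iso: "complex_iso \<Delta> \<Delta>'"
  obtains \<psi> f W where "bij_betw \<psi> (triangles \<Delta>) (triangles \<Delta>')" "inj_on f W"
    "\<And>t. t \<in> triangles \<Delta> \<Longrightarrow> vertex_set t \<subseteq> W \<and> vertex_set (\<psi> t) = f ` vertex_set t"
proof -
  define W where "W = (\<Union>s\<in>\<Delta>. vertex_set s)"
  obtain f where bij: "bij_betw f W (\<Union>s\<in>\<Delta>'. vertex_set s)"
    and img: "(\<lambda>s. f ` vertex_set s) ` \<Delta> = vertex_set ` \<Delta>'"
    using iso unfolding complex_iso_def W_def by blast
  have inj: "inj_on f W" using bij by (rule bij_betw_imp_inj_on)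
  note hull = geom_complex_hull [OF cx(1)] and hull' = geom_complex_hull [OF cx(2)]
  define \<psi> where "\<psi> s = convex hull (f ` vertex_set s)" for s
  have \<psi>: "\<psi> s \<in> \<Delta>' \<and> vertex_set (\<psi> s) = f ` vertex_set s" if s: "s \<in> \<Delta>" for s
  proof -
    have "f ` vertex_set s \<in> vertex_set ` \<Delta>'" unfolding img [symmetric] using s by (rule imageI)
    then obtain s' where "s' \<in> \<Delta>'" "vertex_set s' = f ` vertex_set s" by force
    then show ?thesis using hull' unfolding \<psi>_def by metis
  qed
  have sub: "vertex_set s \<subseteq> W" if "s \<in> \<Delta>" for s using that by (auto simp: W_def)
  have card: "card (f ` vertex_set s) = card (vertex_set s)" if "s \<in> \<Delta>" for s
    using card_image inj_on_subset [OF inj sub [OF that]] by blast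
  have "bij_betw \<psi> (triangles \<Delta>) (triangles \<Delta>')"
  proof (rule bij_betw_imageI)
    show "inj_on \<psi> (triangles \<Delta>)"
    proof (rule inj_onI)
      fix s t assume st: "s \<in> triangles \<Delta>" "t \<in> triangles \<Delta>" "\<psi> s = \<psi> t"
      then have d: "s \<in> \<Delta>" "t \<in> \<Delta>" by (simp_all add: triangles_def)
      then have "f ` vertex_set s = f ` vertex_set t" using \<psi> st(3) by metis
      then have "vertex_set s = vertex_set t" using inj_on_image_eq_iff [OF inj] sub d by metis
      then show "s = t" using hull d by metis
    qed
    show "\<psi> ` triangles \<Delta> = triangles \<Delta>'"
    proof (intro equalityI subsetI)
      fix s' assume "s' \<in> \<psi> ` triangles \<Delta>"
      then obtain s where "s \<in> \<Delta>" "card (vertex_set s) = 3" "s' = \<psi> s"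
        unfolding image_iff Bex_def triangles_iff_card [OF cx(1)] by blast
      then show "s' \<in> triangles \<Delta>'"
        unfolding triangles_iff_card [OF cx(2)] using \<psi> [of s] card [of s] by simp
    next
      fix s' assume s': "s' \<in> triangles \<Delta>'"
      then have "s' \<in> \<Delta>'" by (simp add: triangles_def)
      then have "vertex_set s' \<in> (\<lambda>s. f ` vertex_set s) ` \<Delta>" unfolding img by (rule imageI)
      then obtain s where s: "s \<in> \<Delta>" "vertex_set s' = f ` vertex_set s" by blast
      then have "s' = \<psi> s" using hull' [OF \<open>s' \<in> \<Delta>'\<close>] by (simp add: \<psi>_def)
      moreover have "s \<in> triangles \<Delta>"
        using s s' card [of s] unfolding triangles_iff_card [OF cx(1)] triangles_iff_card [OF cx(2)] by simp
      ultimately show "s' \<in> \<psi> ` triangles \<Delta>" by blast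
    qed
  qed
  then show ?thesis using that inj \<psi> sub by (auto simp: triangles_def)
qed

text \<open>The components are those of the copy of \<open>\<Delta>\<close> in three-space. Only
  finitely many touch a triangle, and \<open>h\<close> numbers these, so that the dual graph gets
  natural numbers as vertices.\<close>

lemma embeddable_kernel_eq_potentials:
  assumes cx: "geom_complex \<Delta>" and emb: "embeddable_into TYPE(real^3) \<Delta>"
  obtains a b :: "'a::real_vector set \<Rightarrow> nat" where
    "kernel \<Delta> = {x \<in> GF2_space (triangles \<Delta>). \<exists>c. \<forall>t\<in>triangles \<Delta>. x t = c (a t) + c (b t)}"
proof -
  obtain \<Delta>' :: "(real^3) set set" where \<Delta>': "triangular_configuration \<Delta>'" "complex_iso \<Delta> \<Delta>'"
    using emb unfolding embeddable_into_def by blast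
  have cx': "geom_complex \<Delta>'" using \<Delta>'(1) by (simp add: triangular_configuration_def)
  interpret space_complex \<Delta>' using cx' by unfold_locales
  obtain \<psi> f W where bij: "bij_betw \<psi> (triangles \<Delta>) (triangles \<Delta>')" and inj: "inj_on f W"
    and tri: "\<And>t. t \<in> triangles \<Delta> \<Longrightarrow> vertex_set t \<subseteq> W \<and> vertex_set (\<psi> t) = f ` vertex_set t"
    using complex_iso_triangles [OF cx cx' \<Delta>'(2)] by metis
  have "finite (upper ` triangles \<Delta>' \<union> lower ` triangles \<Delta>')" (is "finite ?R")
    using finite_triangles [OF cx'] by simp
  then obtain h :: "(real^3) set \<Rightarrow> nat" where h: "inj_on h ?R"
    using finite_imp_inj_to_nat_seg [of ?R] by metis
  define a b where "a t = h (upper (\<psi> t))" and "b t = h (lower (\<psi> t))" for t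
  have R: "upper (\<psi> t) \<in> ?R" "lower (\<psi> t) \<in> ?R" if "t \<in> triangles \<Delta>" for t
  proof -
    have "\<psi> t \<in> triangles \<Delta>'" using bij_betwE [OF bij] that by blast
    then show "upper (\<psi> t) \<in> ?R" "lower (\<psi> t) \<in> ?R" by blast+
  qed
  have "x \<in> kernel \<Delta> \<longleftrightarrow> (\<exists>c. \<forall>t\<in>triangles \<Delta>. x t = c (a t) + c (b t))"
    if x: "x \<in> GF2_space (triangles \<Delta>)" for x
  proof -
    define x' where "x' s = (if s \<in> triangles \<Delta>' then x (inv_into (triangles \<Delta>) \<psi> s) else 0)" for s
    have x': "x' \<in> GF2_space (triangles \<Delta>')" by (simp add: x'_def GF2_space_def)
    have x'\<psi>: "x' (\<psi> t) = x t" if "t \<in> triangles \<Delta>" for t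
      using that bij_betwE [OF bij] bij_betw_inv_into_left [OF bij that] by (simp add: x'_def)
    have "x \<in> kernel \<Delta> \<longleftrightarrow> (\<forall>E. card E = 2 \<longrightarrow> (\<Sum>t | t \<in> triangles \<Delta> \<and> E \<subseteq> vertex_set t. x t) = 0)"
      using x unfolding kernel_eq_cycles [OF cx] by blast
    also have "\<dots> \<longleftrightarrow> (\<forall>E. card E = 2 \<longrightarrow> (\<Sum>t | t \<in> triangles \<Delta> \<and> E \<subseteq> vertex_set t. x' (\<psi> t)) = 0)"
      using x'\<psi> by simp
    also have "\<dots> \<longleftrightarrow> x' \<in> kernel \<Delta>'"
      by (rule kernel_indexed [OF cx' bij inj tri x', symmetric])
    also have "\<dots> \<longleftrightarrow> (\<exists>c. \<forall>s\<in>triangles \<Delta>'. x' s = c (upper s) + c (lower s))"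
      using x' unfolding kernel_eq_potentials by blast
    also have "\<dots> \<longleftrightarrow> (\<exists>c. \<forall>t\<in>triangles \<Delta>. x t = c (upper (\<psi> t)) + c (lower (\<psi> t)))"
      using x'\<psi> bij_betw_imp_surj_on [OF bij, symmetric] by simp
    also have "\<dots> \<longleftrightarrow> (\<exists>c. \<forall>t\<in>triangles \<Delta>. x t = c (a t) + c (b t))"
    proof
      assume "\<exists>c. \<forall>t\<in>triangles \<Delta>. x t = c (upper (\<psi> t)) + c (lower (\<psi> t))"
      then obtain c where c: "\<forall>t\<in>triangles \<Delta>. x t = c (upper (\<psi> t)) + c (lower (\<psi> t))" ..
      show "\<exists>c. \<forall>t\<in>triangles \<Delta>. x t = c (a t) + c (b t)"
      proof (intro exI ballI)
        fix t assume t: "t \<in> triangles \<Delta>"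
        show "x t = (\<lambda>i. c (inv_into ?R h i)) (a t) + (\<lambda>i. c (inv_into ?R h i)) (b t)"
          unfolding a_def b_def inv_into_f_f [OF h R(1) [OF t]] inv_into_f_f [OF h R(2) [OF t]]
          using c t by blast
      qed
    next
      assume "\<exists>c. \<forall>t\<in>triangles \<Delta>. x t = c (a t) + c (b t)"
      then obtain c where "\<forall>t\<in>triangles \<Delta>. x t = c (a t) + c (b t)" ..
      then show "\<exists>c. \<forall>t\<in>triangles \<Delta>. x t = c (upper (\<psi> t)) + c (lower (\<psi> t))"
        unfolding a_def b_def by (intro exI [of _ "\<lambda>K. c (h K)"])
    qed
    finally show ?thesis .
  qed
  moreover have "kernel \<Delta> \<subseteq> GF2_space (triangles \<Delta>)" by (auto simp: kernel_def)
  ultimately show ?thesis by (intro that [of a b]) blast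
qed

text \<open>A potential describing a word on the remaining triangles also defines a cycle on all
  triangles; hence puncturing amounts to deleting edges of the dual graph.\<close>

lemma representation_imp_cut_space:
  assumes "has_geometric_representation_into TYPE(real^3) n C"
  shows "\<exists>(V :: nat set) (ends :: nat \<Rightarrow> nat uprod). graph V {1..n} ends \<and> C = cut_space V {1..n} ends"
proof -
  obtain \<Delta> :: "(nat \<Rightarrow>\<^sub>0 real) set set" and S where rep: "geometric_representation n C \<Delta> S"
    and emb: "embeddable_into TYPE(real^3) \<Delta>"
    using assms unfolding has_geometric_representation_into_def by blast
  obtain \<phi> where \<phi>: "bij_betw \<phi> {1..n} (triangles \<Delta> - S)" and C: "C = relabel n \<phi> (puncture (kernel \<Delta>) S)"
    using rep unfolding geometric_representation_def by blast
  have cx: "geom_complex \<Delta>"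
    using rep unfolding geometric_representation_def triangular_configuration_def by blast
  obtain a b :: "(nat \<Rightarrow>\<^sub>0 real) set \<Rightarrow> nat" where
    ker: "kernel \<Delta> = {x \<in> GF2_space (triangles \<Delta>). \<exists>c. \<forall>t\<in>triangles \<Delta>. x t = c (a t) + c (b t)}"
    using embeddable_kernel_eq_potentials [OF cx emb] .
  define V where "V = a ` \<phi> ` {1..n} \<union> b ` \<phi> ` {1..n}"
  define ends where "ends i = Upair (a (\<phi> i)) (b (\<phi> i))" for i
  have cut: "cut_space V {1..n} ends =
      {x \<in> GF2_space {1..n}. \<exists>c. \<forall>i\<in>{1..n}. x i = c (a (\<phi> i)) + c (b (\<phi> i))}"
    by (rule cut_space_eq_potentials) (auto simp: ends_def V_def)
  have \<phi>T: "\<phi> i \<in> triangles \<Delta>" "\<phi> i \<notin> S" if "i \<in> {1..n}" for i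
    using bij_betwE [OF \<phi>] that by auto
  have "C = cut_space V {1..n} ends"
    unfolding cut
  proof (intro equalityI subsetI)
    fix y assume "y \<in> C"
    then obtain x where x: "x \<in> kernel \<Delta>"
      and y: "y = (\<lambda>i. if i \<in> {1..n} then (if \<phi> i \<in> S then 0 else x (\<phi> i)) else 0)"
      unfolding C relabel_def puncture_def by blast
    obtain c where c: "\<forall>t\<in>triangles \<Delta>. x t = c (a t) + c (b t)" using x unfolding ker by blast
    show "y \<in> {x \<in> GF2_space {1..n}. \<exists>c. \<forall>i\<in>{1..n}. x i = c (a (\<phi> i)) + c (b (\<phi> i))}"
    proof (intro CollectI conjI exI ballI)
      show "y \<in> GF2_space {1..n}" by (simp add: y GF2_space_def)
      show "y i = c (a (\<phi> i)) + c (b (\<phi> i))" if "i \<in> {1..n}" for i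
        using \<phi>T [OF that] c that by (simp add: y)
    qed
  next
    fix y assume "y \<in> {x \<in> GF2_space {1..n}. \<exists>c. \<forall>i\<in>{1..n}. x i = c (a (\<phi> i)) + c (b (\<phi> i))}"
    then obtain c where y: "y \<in> GF2_space {1..n}" and c: "\<forall>i\<in>{1..n}. y i = c (a (\<phi> i)) + c (b (\<phi> i))"
      by blast
    define x where "x t = (if t \<in> triangles \<Delta> then c (a t) + c (b t) else 0)" for t
    have "x \<in> kernel \<Delta>" unfolding ker by (auto simp: x_def GF2_space_def)
    moreover have "y = (\<lambda>i. if i \<in> {1..n} then (if \<phi> i \<in> S then 0 else x (\<phi> i)) else 0)"
    proof
      fix i
      show "y i = (if i \<in> {1..n} then (if \<phi> i \<in> S then 0 else x (\<phi> i)) else 0)"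
      proof (cases "i \<in> {1..n}")
        case True
        then show ?thesis using \<phi>T [OF True] c by (simp add: x_def)
      next
        case False
        then show ?thesis using y by (auto simp: GF2_space_def)
      qed
    qed
    ultimately show "y \<in> C" unfolding C relabel_def puncture_def by (auto simp: image_image)
  qed
  moreover have "graph V {1..n} ends" by (auto simp: graph_def ends_def V_def)
  ultimately show ?thesis by blast
qed

section \<open>Realizing abstract complexes\<close>

text \<open>Geometric independence is expressed by uniqueness of barycentric coordinates across all
  triangles of the family.\<close>

locale realization =
  fixes I :: "'k set" and tri :: "'k \<Rightarrow> 'v set" and pos :: "'v \<Rightarrow> 'a::real_vector"
  assumes finite_I: "finite I" and I_nonempty: "I \<noteq> {}"
    and card_tri: "k \<in> I \<Longrightarrow> card (tri k) = 3"
    and inj_tri: "inj_on tri I"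
    and unique: "\<lbrakk>k \<in> I; k' \<in> I; \<And>v. 0 \<le> l v; \<And>v. 0 \<le> m v;
      \<And>v. v \<notin> tri k \<Longrightarrow> l v = 0; \<And>v. v \<notin> tri k' \<Longrightarrow> m v = (0::real); sum l (tri k) = 1; sum m (tri k') = 1;
      (\<Sum>v\<in>tri k. l v *\<^sub>R pos v) = (\<Sum>v\<in>tri k'. m v *\<^sub>R pos v)\<rbrakk> \<Longrightarrow> l = m"
begin

definition vertices :: "'v set" where
  "vertices = (\<Union>k\<in>I. tri k)"

definition faces :: "'v set set" where
  "faces = {F. \<exists>k\<in>I. F \<subseteq> tri k}"

definition hull_of :: "'v set \<Rightarrow> 'a set" where
  "hull_of F = convex hull (pos ` F)"

lemma finite_tri: "k \<in> I \<Longrightarrow> finite (tri k)"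
  using card_tri by (metis card.infinite zero_neq_numeral)

lemma inj_pos: "inj_on pos vertices"
proof (rule inj_onI)
  fix v w assume v: "v \<in> vertices" and w: "w \<in> vertices" and eq: "pos v = pos w"
  obtain k k' where k: "k \<in> I" "v \<in> tri k" "k' \<in> I" "w \<in> tri k'"
    using v w by (auto simp: vertices_def)
  let ?l = "\<lambda>u x. if x = u then 1 else (0::real)"
  have "?l v = ?l w"
  proof (rule unique [OF k(1,3)])
    show "sum (?l v) (tri k) = 1" "sum (?l w) (tri k') = 1"
      using k finite_tri by (simp_all add: sum.delta')
    have "(\<Sum>x\<in>tri k. ?l v x *\<^sub>R pos x) = (\<Sum>x\<in>tri k. if x = v then pos x else 0)"
      "(\<Sum>x\<in>tri k'. ?l w x *\<^sub>R pos x) = (\<Sum>x\<in>tri k'. if x = w then pos x else 0)"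
      by (auto intro!: sum.cong)
    then show "(\<Sum>x\<in>tri k. ?l v x *\<^sub>R pos x) = (\<Sum>x\<in>tri k'. ?l w x *\<^sub>R pos x)"
      using k finite_tri eq by simp
  qed (use k in auto)
  then show "v = w" by (metis zero_neq_one)
qed

lemma inj_pos_tri: "k \<in> I \<Longrightarrow> inj_on pos (tri k)"
  by (rule inj_on_subset [OF inj_pos]) (auto simp: vertices_def)

text \<open>The positive and the negative part of an affine dependency have the same total
  \<open>P\<close>; divided by \<open>P\<close> they are two different barycentric coordinates of
  one point.\<close>

lemma affine_independent_tri:
  assumes k: "k \<in> I"
  shows "\<not> affine_dependent (pos ` tri k)"
proof
  assume "affine_dependent (pos ` tri k)"
  then obtain u where u: "sum u (pos ` tri k) = 0" "\<exists>p\<in>pos ` tri k. u p \<noteq> 0"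
    "(\<Sum>p\<in>pos ` tri k. u p *\<^sub>R p) = 0"
    unfolding affine_dependent_explicit_finite [OF finite_imageI [OF finite_tri [OF k]]] by blast
  define w where "w v = u (pos v)" for v
  have w: "sum w (tri k) = 0" "(\<Sum>v\<in>tri k. w v *\<^sub>R pos v) = 0"
    using u(1,3) by (simp_all add: sum.reindex [OF inj_pos_tri [OF k]] w_def)
  define P where "P = (\<Sum>v\<in>tri k. max (w v) 0)"
  have PN: "(\<Sum>v\<in>tri k. max (- w v) 0) = P"
  proof -
    have "P - (\<Sum>v\<in>tri k. max (- w v) 0) = (\<Sum>v\<in>tri k. max (w v) 0 - max (- w v) 0)"
      by (simp add: P_def sum_subtractf)
    also have "\<dots> = sum w (tri k)" by (intro sum.cong) auto
    finally show ?thesis using w(1) by simp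
  qed
  obtain v0 where v0: "v0 \<in> tri k" "w v0 \<noteq> 0" using u(2) by (auto simp: w_def)
  have P0: "P > 0"
  proof -
    have "P \<ge> 0" unfolding P_def by (intro sum_nonneg) simp
    moreover have "P \<noteq> 0"
    proof
      assume "P = 0"
      then have "\<forall>v\<in>tri k. max (w v) 0 = 0" "\<forall>v\<in>tri k. max (- w v) 0 = 0"
        using PN finite_tri [OF k] unfolding P_def by (simp_all add: sum_nonneg_eq_0_iff)
      then show False using v0 by (metis max.absorb1 max.absorb2 neg_0_le_iff_le neg_equal_0_iff_equal linear)
    qed
    ultimately show ?thesis by simp
  qed
  define l m where "l v = (if v \<in> tri k then max (w v) 0 / P else 0)"
    and "m v = (if v \<in> tri k then max (- w v) 0 / P else 0)" for v
  have "l = m"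
  proof (rule unique [OF k k])
    show "sum l (tri k) = 1" "sum m (tri k) = 1"
      using P0 PN by (simp_all add: l_def m_def P_def flip: sum_divide_distrib)
    have "(\<Sum>v\<in>tri k. l v *\<^sub>R pos v) - (\<Sum>v\<in>tri k. m v *\<^sub>R pos v) = (\<Sum>v\<in>tri k. (1 / P) *\<^sub>R (w v *\<^sub>R pos v))"
      unfolding sum_subtractf [symmetric]
    proof (rule sum.cong)
      fix v assume "v \<in> tri k"
      then have "l v - m v = (1 / P) * w v" by (auto simp: l_def m_def max_def diff_divide_distrib [symmetric])
      then show "l v *\<^sub>R pos v - m v *\<^sub>R pos v = (1 / P) *\<^sub>R (w v *\<^sub>R pos v)"
        by (simp flip: scaleR_diff_left)
    qed simp
    also have "\<dots> = 0" unfolding scaleR_sum_right [symmetric] w(2) by simp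
    finally show "(\<Sum>v\<in>tri k. l v *\<^sub>R pos v) = (\<Sum>v\<in>tri k. m v *\<^sub>R pos v)" by simp
  qed (use P0 in \<open>auto simp: l_def m_def\<close>)
  then have "l v0 = m v0" by simp
  then show False using v0 P0 by (auto simp: l_def m_def max_def split: if_splits)
qed

lemma face_coordinates:
  assumes k: "k \<in> I" "F \<subseteq> tri k"
  shows "x \<in> hull_of F \<longleftrightarrow> (\<exists>l. (\<forall>v. 0 \<le> l v) \<and> (\<forall>v. v \<notin> F \<longrightarrow> l v = 0) \<and> sum l (tri k) = 1 \<and>
    (\<Sum>v\<in>tri k. l v *\<^sub>R pos v) = x)"
proof -
  have fin: "finite F" using k finite_tri finite_subset by blast
  have inj: "inj_on pos F" using inj_pos_tri [OF k(1)] k(2) by (rule inj_on_subset)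
  have supp: "sum l (tri k) = sum l F" "(\<Sum>v\<in>tri k. l v *\<^sub>R pos v) = (\<Sum>v\<in>F. l v *\<^sub>R pos v)"
    if "\<forall>v. v \<notin> F \<longrightarrow> l v = (0::real)" for l
    using that k finite_tri by (auto intro!: sum.mono_neutral_right)
  have hull: "x \<in> hull_of F \<longleftrightarrow> (\<exists>u. (\<forall>p\<in>pos ` F. 0 \<le> u p) \<and> sum u (pos ` F) = 1 \<and> (\<Sum>p\<in>pos ` F. u p *\<^sub>R p) = x)"
    unfolding hull_of_def using fin by (auto simp: convex_hull_finite)
  show ?thesis
    unfolding hull
  proof
    assume "\<exists>u. (\<forall>p\<in>pos ` F. 0 \<le> u p) \<and> sum u (pos ` F) = 1 \<and> (\<Sum>p\<in>pos ` F. u p *\<^sub>R p) = x"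
    then obtain u where u: "\<forall>p\<in>pos ` F. 0 \<le> u p" "sum u (pos ` F) = 1" "(\<Sum>p\<in>pos ` F. u p *\<^sub>R p) = x" by blast
    define l where "l v = (if v \<in> F then u (pos v) else 0)" for v
    have "sum l F = 1" "(\<Sum>v\<in>F. l v *\<^sub>R pos v) = x"
      using u(2,3) by (simp_all add: sum.reindex [OF inj] l_def)
    then show "\<exists>l. (\<forall>v. 0 \<le> l v) \<and> (\<forall>v. v \<notin> F \<longrightarrow> l v = 0) \<and> sum l (tri k) = 1 \<and> (\<Sum>v\<in>tri k. l v *\<^sub>R pos v) = x"
      using u(1) supp [of l] by (intro exI [of _ l]) (simp add: l_def)
  next
    assume "\<exists>l. (\<forall>v. 0 \<le> l v) \<and> (\<forall>v. v \<notin> F \<longrightarrow> l v = 0) \<and> sum l (tri k) = 1 \<and> (\<Sum>v\<in>tri k. l v *\<^sub>R pos v) = x"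
    then obtain l where l: "\<forall>v. 0 \<le> l v" "\<forall>v. v \<notin> F \<longrightarrow> l v = 0" "sum l (tri k) = 1" "(\<Sum>v\<in>tri k. l v *\<^sub>R pos v) = x"
      by blast
    then have "sum l F = 1" "(\<Sum>v\<in>F. l v *\<^sub>R pos v) = x" using supp by simp_all
    then show "\<exists>u. (\<forall>p\<in>pos ` F. 0 \<le> u p) \<and> sum u (pos ` F) = 1 \<and> (\<Sum>p\<in>pos ` F. u p *\<^sub>R p) = x"
      using l(1) by (intro exI [of _ "\<lambda>p. l (inv_into F pos p)"]) (simp add: sum.reindex [OF inj] inj)
  qed
qed

text \<open>A common point has the same coordinates in both faces, so they are supported in
  \<open>F \<inter> G\<close>.\<close>

lemma hull_of_Int:
  assumes F: "F \<in> faces" and G: "G \<in> faces"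
  shows "hull_of F \<inter> hull_of G = hull_of (F \<inter> G)"
proof
  show "hull_of (F \<inter> G) \<subseteq> hull_of F \<inter> hull_of G"
    unfolding hull_of_def by (intro Int_greatest hull_mono) auto
  obtain k k' where k: "k \<in> I" "F \<subseteq> tri k" "k' \<in> I" "G \<subseteq> tri k'" using F G by (auto simp: faces_def)
  show "hull_of F \<inter> hull_of G \<subseteq> hull_of (F \<inter> G)"
  proof
    fix x assume "x \<in> hull_of F \<inter> hull_of G"
    then have x: "x \<in> hull_of F" "x \<in> hull_of G" by auto
    obtain l where l: "\<forall>v. 0 \<le> l v" "\<forall>v. v \<notin> F \<longrightarrow> l v = 0" "sum l (tri k) = 1" "(\<Sum>v\<in>tri k. l v *\<^sub>R pos v) = x"
      using x(1) unfolding face_coordinates [OF k(1,2)] by blast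
    obtain m where m: "\<forall>v. 0 \<le> m v" "\<forall>v. v \<notin> G \<longrightarrow> m v = 0" "sum m (tri k') = 1" "(\<Sum>v\<in>tri k'. m v *\<^sub>R pos v) = x"
      using x(2) unfolding face_coordinates [OF k(3,4)] by blast
    have "l = m"
    proof (rule unique [OF k(1,3)])
      show "l v = 0" if "v \<notin> tri k" for v using that l(2) k(2) by blast
      show "m v = 0" if "v \<notin> tri k'" for v using that m(2) k(4) by blast
    qed (use l m in auto)
    then have "\<forall>v. v \<notin> F \<inter> G \<longrightarrow> l v = 0" using l(2) m(2) by blast
    moreover have "F \<inter> G \<subseteq> tri k" using k by blast
    ultimately show "x \<in> hull_of (F \<inter> G)" using face_coordinates [OF k(1)] l by blast
  qed
qed

lemma face_vertices:
  assumes "F \<in> faces"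
  shows "finite (pos ` F)" "\<not> affine_dependent (pos ` F)" "card (pos ` F) = card F"
    "vertex_set (hull_of F) = pos ` F" "F \<subseteq> vertices"
proof -
  obtain k where k: "k \<in> I" "F \<subseteq> tri k" using assms by (auto simp: faces_def)
  show fin: "finite (pos ` F)"
    using finite_subset [OF k(2) finite_tri [OF k(1)]] by (rule finite_imageI)
  show ind: "\<not> affine_dependent (pos ` F)"
    using affine_independent_tri [OF k(1)] affine_dependent_subset [OF _ image_mono [OF k(2), of pos]]
    by metis
  show "card (pos ` F) = card F" using inj_on_subset [OF inj_pos_tri [OF k(1)] k(2)] by (rule card_image)
  show "vertex_set (hull_of F) = pos ` F" unfolding hull_of_def by (rule vertex_set_convex_hull [OF fin ind])
  show "F \<subseteq> vertices" using k by (auto simp: vertices_def)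
qed

lemma geom_simplex_face: "F \<in> faces \<Longrightarrow> geom_simplex (int (card F) - 1) (hull_of F)"
  unfolding geom_simplex_def hull_of_def using face_vertices [of F] by (intro exI [of _ "pos ` F"]) simp

lemma faces_subset: "F \<in> faces \<Longrightarrow> G \<subseteq> F \<Longrightarrow> G \<in> faces"
  by (auto simp: faces_def)

lemma tri_face: "k \<in> I \<Longrightarrow> tri k \<in> faces"
  by (auto simp: faces_def)

definition realized :: "'a set set" where
  "realized = hull_of ` faces"

lemma geom_complex_realized: "geom_complex realized"
  unfolding geom_complex_def
proof (intro conjI ballI allI impI)
  have "faces \<subseteq> (\<Union>k\<in>I. Pow (tri k))" by (auto simp: faces_def)
  moreover have "finite (\<Union>k\<in>I. Pow (tri k))" using finite_I finite_tri by simp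
  ultimately have "finite faces" by (rule finite_subset)
  then show "finite realized" by (simp add: realized_def)
  show "\<exists>n. geom_simplex n s" if "s \<in> realized" for s
    using that geom_simplex_face by (auto simp: realized_def)
next
  fix f s assume "s \<in> realized \<and> f face_of s"
  then obtain F where F: "F \<in> faces" "f face_of hull_of F" by (auto simp: realized_def)
  have "f = convex hull (f \<inter> pos ` F)"
    using face_of_convex_hull_subset [OF face_vertices(1) [OF F(1)]] F(2) unfolding hull_of_def by blast
  also have "f \<inter> pos ` F = pos ` (F \<inter> pos -` f)" by blast
  finally have "f = hull_of (F \<inter> pos -` f)" by (simp add: hull_of_def)
  moreover have "F \<inter> pos -` f \<in> faces" using F(1) by (rule faces_subset) blast
  ultimately show "f \<in> realized" unfolding realized_def by (metis imageI)
next
  fix s t assume "s \<in> realized \<and> t \<in> realized"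
  then obtain F G where FG: "F \<in> faces" "G \<in> faces" "s = hull_of F" "t = hull_of G"
    by (auto simp: realized_def)
  have "hull_of (F \<inter> G) face_of hull_of F"
    unfolding hull_of_def using face_vertices(1,2) [OF FG(1)] by (rule convex_hull_face_of_simplex) blast
  then show "(s \<inter> t) face_of s" using hull_of_Int FG by simp
qed

lemma bij_triangles: "bij_betw (\<lambda>k. hull_of (tri k)) I (triangles realized)"
proof (rule bij_betw_imageI)
  show "inj_on (\<lambda>k. hull_of (tri k)) I"
  proof (rule inj_onI)
    fix k k' assume k: "k \<in> I" "k' \<in> I" "hull_of (tri k) = hull_of (tri k')"
    then have "pos ` tri k = pos ` tri k'" using face_vertices(4) tri_face by metis
    then have "tri k = tri k'"
      using inj_on_image_eq_iff [OF inj_pos] face_vertices(5) tri_face k by blast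
    then show "k = k'" using inj_onD [OF inj_tri] k by blast
  qed
  show "(\<lambda>k. hull_of (tri k)) ` I = triangles realized"
  proof (intro equalityI subsetI)
    fix s assume "s \<in> (\<lambda>k. hull_of (tri k)) ` I"
    then obtain k where "k \<in> I" "s = hull_of (tri k)" by blast
    then show "s \<in> triangles realized"
      using face_vertices [OF tri_face] card_tri tri_face
      unfolding triangles_iff_card [OF geom_complex_realized] unfolding realized_def by simp
  next
    fix s assume "s \<in> triangles realized"
    then obtain F where F: "F \<in> faces" "s = hull_of F" "card (vertex_set s) = 3"
      unfolding triangles_iff_card [OF geom_complex_realized] unfolding realized_def by blast
    then obtain k where k: "k \<in> I" "F \<subseteq> tri k" by (auto simp: faces_def)
    have "card F = card (tri k)" using F face_vertices [OF F(1)] card_tri [OF k(1)] by simp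
    then have "F = tri k" using k finite_tri by (metis card_subset_eq)
    then show "s \<in> (\<lambda>k. hull_of (tri k)) ` I" using F k by blast
  qed
qed

lemma triangular_realized: "triangular_configuration realized"
  unfolding triangular_configuration_def
proof (intro conjI ballI impI)
  show "triangles realized \<noteq> {}"
    using bij_betw_imp_surj_on [OF bij_triangles] I_nonempty by auto
  fix s assume s: "s \<in> realized" and max: "\<forall>t\<in>realized. s \<subseteq> t \<longrightarrow> t = s"
  obtain F k where F: "F \<in> faces" "s = hull_of F" "k \<in> I" "F \<subseteq> tri k"
    using s by (auto simp: realized_def faces_def)
  have "s \<subseteq> hull_of (tri k)" unfolding F(2) hull_of_def using F(4) by (intro hull_mono image_mono)
  then have "s = hull_of (tri k)" using max tri_face [OF F(3)] by (auto simp: realized_def)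
  then show "geom_simplex 2 s \<or> geom_simplex 1 s"
    using geom_simplex_face [OF tri_face [OF F(3)]] card_tri [OF F(3)] by simp
qed (rule geom_complex_realized)

lemma kernel_realized:
  assumes "x \<in> GF2_space (triangles realized)"
  shows "x \<in> kernel realized \<longleftrightarrow>
    (\<forall>E. card E = 2 \<longrightarrow> (\<Sum>k | k \<in> I \<and> E \<subseteq> tri k. x (hull_of (tri k))) = 0)"
proof (rule kernel_indexed [OF geom_complex_realized bij_triangles inj_pos _ assms])
  show "tri k \<subseteq> vertices \<and> vertex_set (hull_of (tri k)) = pos ` tri k" if "k \<in> I" for k
    using face_vertices [OF tri_face [OF that]] by blast
qed

lemma Union_vertex_set: "(\<Union>s\<in>realized. vertex_set s) = pos ` vertices"
proof -
  have "(\<Union>s\<in>realized. vertex_set s) = (\<Union>F\<in>faces. pos ` F)"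
    unfolding realized_def using face_vertices(4) by simp
  also have "\<dots> = pos ` (\<Union>faces)" by blast
  also have "\<Union>faces = vertices" by (auto simp: faces_def vertices_def)
  finally show ?thesis .
qed

end

lemma complex_iso_realized:
  assumes "realization I tri p" "realization I tri q"
  shows "complex_iso (realization.realized I tri p) (realization.realized I tri q)"
proof -
  interpret P: realization I tri p by fact
  interpret Q: realization I tri q by fact
  define f where "f = q \<circ> inv_into P.vertices p"
  have inv: "inv_into P.vertices p ` p ` F = F" if "F \<subseteq> P.vertices" for F
    using that by (rule inv_into_image_cancel [OF P.inj_pos])
  have "bij_betw f (p ` P.vertices) (q ` P.vertices)"
    unfolding f_def using bij_betw_trans [OF bij_betw_inv_into [OF inj_on_imp_bij_betw [OF P.inj_pos]]
        inj_on_imp_bij_betw [OF Q.inj_pos]] .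
  moreover have "f ` vertex_set (P.hull_of F) = vertex_set (Q.hull_of F)" if F: "F \<in> P.faces" for F
    unfolding P.face_vertices(4) [OF F] Q.face_vertices(4) [OF F] f_def image_comp [symmetric]
    by (simp add: inv P.face_vertices(5) [OF F])
  then have "(\<lambda>s. f ` vertex_set s) ` P.realized = vertex_set ` Q.realized"
    unfolding P.realized_def Q.realized_def image_image by simp
  ultimately show ?thesis
    unfolding complex_iso_def P.Union_vertex_set Q.Union_vertex_set by blast
qed

section \<open>The grid complex\<close>

text \<open>A triangulated grid in the plane \<open>z = 0\<close>, with its strips \<open>i \<le> x \<le> i + 1\<close> coned off from the
  apex below and its strips \<open>j \<le> y \<le> j + 1\<close> coned off from the apex above.\<close>

type_synonym point = "int \<times> int \<times> int"

text \<open>\<open>LowerTri\<close> and \<open>UpperTri\<close> are the halves of a unit square of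
  the floor. The \<open>WallX True\<close> cells over a line \<open>y = j\<close> separate columns
  \<open>j - 1\<close> and \<open>j\<close> above the floor; the \<open>WallY False\<close> cells
  under a line \<open>x = i\<close> separate rows \<open>i - 1\<close> and \<open>i\<close> below
  it.\<close>

datatype cell = LowerTri int int | UpperTri int int | WallX bool int int | WallY bool int int

definition apex :: "bool \<Rightarrow> point" where
  "apex s = (0, 0, if s then 1 else - 1)"

fun corners :: "cell \<Rightarrow> point set" where
  "corners (LowerTri i j) = {(i, j, 0), (i + 1, j, 0), (i + 1, j + 1, 0)}"
| "corners (UpperTri i j) = {(i, j, 0), (i, j + 1, 0), (i + 1, j + 1, 0)}"
| "corners (WallX s i j) = {apex s, (i, j, 0), (i + 1, j, 0)}"
| "corners (WallY s i j) = {apex s, (i, j, 0), (i, j + 1, 0)}"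

lemma apex_neq [simp]: "apex s \<noteq> (i, j, 0)" "(i, j, 0) \<noteq> apex s" "apex s = apex s' \<longleftrightarrow> s = s'"
  by (auto simp: apex_def)

lemma card_corners: "card (corners k) = 3"
  by (cases k) auto

lemma finite_corners: "finite (corners k)"
  by (cases k) auto

lemma inj_corners: "inj corners"
proof (rule injI)
  fix k k' assume "corners k = corners k'"
  then have "corners k \<subseteq> corners k'" by simp
  then show "k = k'" by (cases k; cases k') auto
qed

lemma cells_at_edge:
  "{k. {(i, j, 0), (i + 1, j, 0)} \<subseteq> corners k} =
    {LowerTri i j, UpperTri i (j - 1), WallX False i j, WallX True i j}"
  "{k. {(i, j, 0), (i, j + 1, 0)} \<subseteq> corners k} =
    {LowerTri (i - 1) j, UpperTri i j, WallY False i j, WallY True i j}"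
  "{k. {(i, j, 0), (i + 1, j + 1, 0)} \<subseteq> corners k} = {LowerTri i j, UpperTri i j}"
  "{k. {apex s, (i, j, 0)} \<subseteq> corners k} = {WallX s i j, WallX s (i - 1) j, WallY s i j, WallY s i (j - 1)}"
proof -
  have "{(i, j, 0), (i + 1, j, 0)} \<subseteq> corners k \<longleftrightarrow>
    k \<in> {LowerTri i j, UpperTri i (j - 1), WallX False i j, WallX True i j}" for k
    by (cases k) auto
  then show "{k. {(i, j, 0), (i + 1, j, 0)} \<subseteq> corners k} =
    {LowerTri i j, UpperTri i (j - 1), WallX False i j, WallX True i j}" by blast
  have "{(i, j, 0), (i, j + 1, 0)} \<subseteq> corners k \<longleftrightarrow>
    k \<in> {LowerTri (i - 1) j, UpperTri i j, WallY False i j, WallY True i j}" for k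
    by (cases k) auto
  then show "{k. {(i, j, 0), (i, j + 1, 0)} \<subseteq> corners k} =
    {LowerTri (i - 1) j, UpperTri i j, WallY False i j, WallY True i j}" by blast
  have "{(i, j, 0), (i + 1, j + 1, 0)} \<subseteq> corners k \<longleftrightarrow> k \<in> {LowerTri i j, UpperTri i j}" for k
    by (cases k) auto
  then show "{k. {(i, j, 0), (i + 1, j + 1, 0)} \<subseteq> corners k} = {LowerTri i j, UpperTri i j}" by blast
  have "{apex s, (i, j, 0)} \<subseteq> corners k \<longleftrightarrow>
    k \<in> {WallX s i j, WallX s (i - 1) j, WallY s i j, WallY s i (j - 1)}" for k
    by (cases k) auto
  then show "{k. {apex s, (i, j, 0)} \<subseteq> corners k} =
    {WallX s i j, WallX s (i - 1) j, WallY s i j, WallY s i (j - 1)}" by blast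
qed

definition grid_edge :: "point set \<Rightarrow> bool" where
  "grid_edge E \<longleftrightarrow> (\<exists>i j. E = {(i, j, 0), (i + 1, j, 0)}) \<or> (\<exists>i j. E = {(i, j, 0), (i, j + 1, 0)}) \<or>
    (\<exists>i j. E = {(i, j, 0), (i + 1, j + 1, 0)}) \<or> (\<exists>s i j. E = {apex s, (i, j, 0)})"

lemma grid_edgeI:
  "grid_edge {(i, j, 0), (i + 1, j, 0)}" "grid_edge {(i, j, 0), (i, j + 1, 0)}"
  "grid_edge {(i, j, 0), (i + 1, j + 1, 0)}" "grid_edge {apex s, (i, j, 0)}"
  unfolding grid_edge_def by blast+

lemma card_2_subset_3:
  assumes "card E = 2" "E \<subseteq> {a, b, c}"
  shows "E = {a, b} \<or> E = {b, c} \<or> E = {a, c}"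
proof -
  obtain p q where pq: "E = {p, q}" "p \<noteq> q" using assms(1) unfolding card_2_iff by blast
  then have "p \<in> {a, b, c}" "q \<in> {a, b, c}" using assms(2) by simp_all
  then show ?thesis using pq by (elim insertE) (simp_all add: insert_commute)
qed

lemma edge_of_cell:
  assumes E: "card E = 2" "E \<subseteq> corners k"
  shows "grid_edge E"
proof -
  have sub: "E = {a, b} \<or> E = {b, c} \<or> E = {a, c}" if "corners k = {a, b, c}" for a b c
    using E card_2_subset_3 that by metis
  show ?thesis
  proof (cases k)
    case (LowerTri i j)
    then show ?thesis using sub [of "(i, j, 0)" "(i + 1, j, 0)" "(i + 1, j + 1, 0)"] grid_edgeI by auto
  next
    case (UpperTri i j)
    then show ?thesis using sub [of "(i, j, 0)" "(i, j + 1, 0)" "(i + 1, j + 1, 0)"] grid_edgeI by auto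
  next
    case (WallX s i j)
    then show ?thesis using sub [of "apex s" "(i, j, 0)" "(i + 1, j, 0)"] grid_edgeI by auto
  next
    case (WallY s i j)
    then show ?thesis using sub [of "apex s" "(i, j, 0)" "(i, j + 1, 0)"] grid_edgeI by auto
  qed
qed

text \<open>One equation per kind of edge, stated on the infinite grid: absent cells simply carry 0,
  which avoids boundary cases.\<close>

definition grid_cycle :: "(cell \<Rightarrow> bit) \<Rightarrow> bool" where
  "grid_cycle x \<longleftrightarrow>
    (\<forall>i j. x (LowerTri i j) + x (UpperTri i (j - 1)) + x (WallX False i j) + x (WallX True i j) = 0) \<and>
    (\<forall>i j. x (LowerTri (i - 1) j) + x (UpperTri i j) + x (WallY False i j) + x (WallY True i j) = 0) \<and>
    (\<forall>i j. x (LowerTri i j) + x (UpperTri i j) = 0) \<and>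
    (\<forall>s i j. x (WallX s i j) + x (WallX s (i - 1) j) + x (WallY s i j) + x (WallY s i (j - 1)) = 0)"

lemma grid_cycle_iff:
  assumes I: "finite I" and x: "\<And>k. k \<notin> I \<Longrightarrow> x k = 0"
  shows "(\<forall>E. card E = 2 \<longrightarrow> (\<Sum>k | k \<in> I \<and> E \<subseteq> corners k. x k) = 0) \<longleftrightarrow> grid_cycle x"
proof -
  have star: "(\<Sum>k | k \<in> I \<and> E \<subseteq> corners k. x k) = sum x S" if "{k. E \<subseteq> corners k} = S" "finite S" for E S
    using that x by (intro sum.mono_neutral_left) auto
  have sums: "(\<Sum>k | k \<in> I \<and> {(i, j, 0), (i + 1, j, 0)} \<subseteq> corners k. x k) =
      x (LowerTri i j) + x (UpperTri i (j - 1)) + x (WallX False i j) + x (WallX True i j)"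
    "(\<Sum>k | k \<in> I \<and> {(i, j, 0), (i, j + 1, 0)} \<subseteq> corners k. x k) =
      x (LowerTri (i - 1) j) + x (UpperTri i j) + x (WallY False i j) + x (WallY True i j)"
    "(\<Sum>k | k \<in> I \<and> {(i, j, 0), (i + 1, j + 1, 0)} \<subseteq> corners k. x k) = x (LowerTri i j) + x (UpperTri i j)"
    "(\<Sum>k | k \<in> I \<and> {apex s, (i, j, 0)} \<subseteq> corners k. x k) =
      x (WallX s i j) + x (WallX s (i - 1) j) + x (WallY s i j) + x (WallY s i (j - 1))" for i j s
    using star [OF cells_at_edge(1) [of i j]] star [OF cells_at_edge(2) [of i j]]
      star [OF cells_at_edge(3) [of i j]] star [OF cells_at_edge(4) [of s i j]]
    by (simp_all only: finite.intros) (simp_all add: add.assoc)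
  have cards: "card {(i, j, 0 :: int), (i + 1, j, 0)} = 2" "card {(i, j, 0 :: int), (i, j + 1, 0)} = 2"
    "card {(i, j, 0 :: int), (i + 1, j + 1, 0)} = 2" "card {apex s, (i, j, 0)} = 2" for i j :: int and s
    by (simp_all add: card_insert_if)
  show ?thesis
  proof
    assume "\<forall>E. card E = 2 \<longrightarrow> (\<Sum>k | k \<in> I \<and> E \<subseteq> corners k. x k) = 0"
    then have *: "(\<Sum>k | k \<in> I \<and> E \<subseteq> corners k. x k) = 0" if "card E = 2" for E
      using that by blast
    note eqs = trans [OF sums(1) [symmetric] * [OF cards(1)]] trans [OF sums(2) [symmetric] * [OF cards(2)]]
      trans [OF sums(3) [symmetric] * [OF cards(3)]] trans [OF sums(4) [symmetric] * [OF cards(4)]]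
    show "grid_cycle x"
      unfolding grid_cycle_def
      by (intro conjI allI; fact eqs)
  next
    assume cyc: "grid_cycle x"
    show "\<forall>E. card E = 2 \<longrightarrow> (\<Sum>k | k \<in> I \<and> E \<subseteq> corners k. x k) = 0"
    proof (intro allI impI)
      fix E :: "point set" assume E: "card E = 2"
      show "(\<Sum>k | k \<in> I \<and> E \<subseteq> corners k. x k) = 0"
      proof (cases "\<exists>k. E \<subseteq> corners k")
        case True
        then have "grid_edge E" using edge_of_cell [OF E] by blast
        then show ?thesis
          unfolding grid_edge_def
        proof (elim disjE exE)
          show ?thesis if "E = {(i, j, 0), (i + 1, j, 0)}" for i j
            using cyc unfolding that sums(1) grid_cycle_def by blast
          show ?thesis if "E = {(i, j, 0), (i, j + 1, 0)}" for i j
            using cyc unfolding that sums(2) grid_cycle_def by blast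
          show ?thesis if "E = {(i, j, 0), (i + 1, j + 1, 0)}" for i j
            using cyc unfolding that sums(3) grid_cycle_def by blast
          show ?thesis if "E = {apex s, (i, j, 0)}" for s i j
            using cyc unfolding that sums(4) grid_cycle_def by blast
        qed
      next
        case False
        then have "{k. k \<in> I \<and> E \<subseteq> corners k} = {}" by blast
        then show ?thesis by (metis sum.empty)
      qed
    qed
  qed
qed

subsection \<open>Embeddings of the grid complex\<close>

text \<open>Distinct unit vectors realize any abstract complex, since the coordinates of a point can
  be read off. This gives the copy in the space where representations are required to live.\<close>

definition coordinate_pos :: "point \<Rightarrow> nat \<Rightarrow>\<^sub>0 real" where
  "coordinate_pos v = Poly_Mapping.single (to_nat v) 1"

lemma lookup_scaleR: "Poly_Mapping.lookup (c *\<^sub>R x) i = c * Poly_Mapping.lookup x (i :: nat)"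
  for x :: "nat \<Rightarrow>\<^sub>0 real"
proof -
  have "finite {i. c * Poly_Mapping.lookup x i \<noteq> 0}"
    by (rule finite_subset [OF _ finite_lookup [of x]]) auto
  then show ?thesis by (simp add: scaleR_poly_mapping_def lookup_Abs_poly_mapping)
qed

lemma realization_coordinate_pos:
  assumes I: "finite I" "I \<noteq> {}"
  shows "realization I corners coordinate_pos"
proof
  show "inj_on corners I" using inj_corners by (rule inj_on_subset) simp
  fix k k' and l m :: "point \<Rightarrow> real"
  assume supp: "\<And>v. v \<notin> corners k \<Longrightarrow> l v = 0" "\<And>v. v \<notin> corners k' \<Longrightarrow> m v = 0"
    and eq: "(\<Sum>v\<in>corners k. l v *\<^sub>R coordinate_pos v) = (\<Sum>v\<in>corners k'. m v *\<^sub>R coordinate_pos v)"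
  have *: "Poly_Mapping.lookup (\<Sum>v\<in>corners k. l v *\<^sub>R coordinate_pos v) (to_nat w) = l w"
    if "\<And>v. v \<notin> corners k \<Longrightarrow> l v = 0" for k l w
  proof -
    have "Poly_Mapping.lookup (\<Sum>v\<in>corners k. l v *\<^sub>R coordinate_pos v) (to_nat w) =
        (\<Sum>v\<in>corners k. if v = w then l v else 0)"
      unfolding lookup_sum lookup_scaleR coordinate_pos_def
      by (intro sum.cong) (auto simp: lookup_single when_def)
    also have "\<dots> = l w" using that [of w] finite_corners [of k] by (simp add: sum.delta)
    finally show ?thesis .
  qed
  show "l = m"
    using * [of k l] * [of k' m] supp eq by (intro ext) metis
qed (use I card_corners in auto)

definition grid_pos :: "point \<Rightarrow> real ^ 3" where
  "grid_pos v = vector [real_of_int (fst v), real_of_int (fst (snd v)), real_of_int (snd (snd v))]"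

definition grid_points :: "point set" where
  "grid_points = insert (apex True) (insert (apex False) {(a, b, 0) |a b. True})"

text \<open>The tetrahedra are the cells of linearity of a convex function: on the grid it is the quadratic
  form of the triangular lattice, and both apexes get the value 1.\<close>

fun lift :: "point \<Rightarrow> int" where
  "lift (a, b, c) = (if c = 0 then a * a + b * b + (a - b) * (a - b) else 1)"

text \<open>On the floor this is the sum of the secants of the square function over
  \<open>[i, i + 1]\<close>, \<open>[j, j + 1]\<close> and \<open>[d, d + 1]\<close>, taken at
  \<open>a\<close>, \<open>b\<close> and \<open>a - b\<close>. The coefficient of \<open>c\<close>
  is tuned to give the value 1 at the apex \<open>s\<close>.\<close>

fun support :: "int \<Rightarrow> int \<Rightarrow> int \<Rightarrow> bool \<Rightarrow> point \<Rightarrow> int" where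
  "support i j d s (a, b, c) = (2 * i + 1) * a + (2 * j + 1) * b + (2 * d + 1) * (a - b) -
     (i * (i + 1) + j * (j + 1) + d * (d + 1)) +
     (if s then 1 else - 1) * (1 + (i * (i + 1) + j * (j + 1) + d * (d + 1))) * c"

definition tetrahedron :: "int \<Rightarrow> int \<Rightarrow> bool \<Rightarrow> bool \<Rightarrow> point set" where
  "tetrahedron i j ty s =
     {apex s, (i, j, 0), (i + 1, j + 1, 0), if ty then (i + 1, j, 0) else (i, j + 1, 0)}"

lemma int_mult_pred: "0 \<le> n * (n - 1)" "n * (n - 1) = 0 \<longleftrightarrow> n = 0 \<or> n = 1" for n :: int
proof -
  have "0 \<le> n * (n - 1)" by (cases "n \<le> 0") (auto simp: mult_nonneg_nonneg mult_nonpos_nonpos)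
  then show "0 \<le> n * (n - 1)" .
qed auto

lemma lift_minus_support:
  "lift (a, b, 0) - support i j d s (a, b, 0) =
    (a - i) * (a - i - 1) + (b - j) * (b - j - 1) + (a - b - d) * (a - b - d - 1)"
  by (simp add: algebra_simps)

text \<open>A product of consecutive integers is nonnegative and vanishes only if a factor does.
  Contact on the floor thus means that \<open>a\<close>, \<open>b\<close>, \<open>a - b\<close> are
  ends of the three secant intervals; the choice of \<open>d\<close> excludes one corner of the unit
  square and leaves the floor triangle of the tetrahedron.\<close>

lemma support_le_lift:
  assumes v: "v \<in> grid_points" and d: "d = (if ty then i - j else i - j - 1)"
  shows "support i j d s v \<le> lift v" "support i j d s v = lift v \<longleftrightarrow> v \<in> tetrahedron i j ty s"
proof -
  let ?K = "i * (i + 1) + j * (j + 1) + d * (d + 1)"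
  have K: "0 \<le> ?K"
    using int_mult_pred(1)[of "i + 1"] int_mult_pred(1)[of "j + 1"] int_mult_pred(1)[of "d + 1"]
    by (simp add: algebra_simps)
  consider a b where "v = (a, b, 0)" | s' where "v = apex s'" using v by (auto simp: grid_points_def)
  then have "support i j d s v \<le> lift v \<and> (support i j d s v = lift v \<longleftrightarrow> v \<in> tetrahedron i j ty s)"
  proof cases
    case 1
    note nn = int_mult_pred(1)[of "a - i"] int_mult_pred(1)[of "b - j"] int_mult_pred(1)[of "a - b - d"]
    have "support i j d s v = lift v \<longleftrightarrow> (a - i) * (a - i - 1) = 0 \<and> (b - j) * (b - j - 1) = 0 \<and>
        (a - b - d) * (a - b - d - 1) = 0"
      using lift_minus_support [of a b i j d s] nn unfolding 1 by linarith
    also have "\<dots> \<longleftrightarrow> v \<in> tetrahedron i j ty s"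
      unfolding int_mult_pred(2) 1 tetrahedron_def d by auto
    finally show ?thesis using lift_minus_support [of a b i j d s] nn unfolding 1 by linarith
  next
    case 2
    \<comment> \<open>At the opposite apex the function stays below 1 because \<open>?K\<close> is
      nonnegative.\<close>
    have "support i j d s v = (if s' = s then 1 else - 1 - 2 * ?K)"
      unfolding 2 apex_def by (cases s; cases s') (simp_all add: algebra_simps)
    moreover have "lift v = 1" unfolding 2 apex_def by simp
    moreover have "v \<in> tetrahedron i j ty s \<longleftrightarrow> s' = s" unfolding 2 tetrahedron_def by auto
    ultimately show ?thesis using K by auto
  qed
  then show "support i j d s v \<le> lift v" "support i j d s v = lift v \<longleftrightarrow> v \<in> tetrahedron i j ty s"
    by blast+
qed

lemma corners_tetrahedron: "\<exists>i j ty s. corners k \<subseteq> tetrahedron i j ty s"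
proof (cases k)
  case (LowerTri i j)
  then show ?thesis by (intro exI [of _ i] exI [of _ j] exI [of _ True] exI) (auto simp: tetrahedron_def)
next
  case (UpperTri i j)
  then show ?thesis by (intro exI [of _ i] exI [of _ j] exI [of _ False] exI) (auto simp: tetrahedron_def)
next
  case (WallX s i j)
  then show ?thesis by (intro exI [of _ i] exI [of _ j] exI [of _ True] exI [of _ s]) (auto simp: tetrahedron_def)
next
  case (WallY s i j)
  then show ?thesis by (intro exI [of _ i] exI [of _ j] exI [of _ False] exI [of _ s]) (auto simp: tetrahedron_def)
qed

lemma corners_grid_points: "corners k \<subseteq> grid_points"
proof -
  have "apex s \<in> grid_points" for s by (cases s) (auto simp: grid_points_def)
  moreover have "(a, b, 0) \<in> grid_points" for a b by (auto simp: grid_points_def)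
  ultimately show ?thesis by (cases k) auto
qed

lemma support_affine: "real_of_int (support i j d s v) =
    real_of_int (2 * i + 1 + (2 * d + 1)) * grid_pos v $ 1 + real_of_int (2 * j + 1 - (2 * d + 1)) * grid_pos v $ 2 +
    real_of_int ((if s then 1 else - 1) * (1 + (i * (i + 1) + j * (j + 1) + d * (d + 1)))) * grid_pos v $ 3 -
    real_of_int (i * (i + 1) + j * (j + 1) + d * (d + 1))"
  by (cases v) (simp add: grid_pos_def algebra_simps)

lemma support_sum_eq:
  assumes "sum l A = 1" "sum m B = 1" "(\<Sum>v\<in>A. l v *\<^sub>R grid_pos v) = (\<Sum>v\<in>B. m v *\<^sub>R grid_pos v)"
  shows "(\<Sum>v\<in>A. l v * real_of_int (support i j d s v)) = (\<Sum>v\<in>B. m v * real_of_int (support i j d s v))"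
proof -
  have lin: "(\<Sum>v\<in>A. l v * (\<alpha> * grid_pos v $ 1 + \<beta> * grid_pos v $ 2 + \<gamma> * grid_pos v $ 3 - \<delta>)) =
      \<alpha> * (\<Sum>v\<in>A. l v *\<^sub>R grid_pos v) $ 1 + \<beta> * (\<Sum>v\<in>A. l v *\<^sub>R grid_pos v) $ 2 +
      \<gamma> * (\<Sum>v\<in>A. l v *\<^sub>R grid_pos v) $ 3 - \<delta> * sum l A" for \<alpha> \<beta> \<gamma> \<delta> A l
    by (simp add: sum_distrib_left sum.distrib [symmetric] sum_subtractf [symmetric] algebra_simps)
  show ?thesis by (simp only: support_affine lin assms)
qed

text \<open>The third coordinate kills the weight of the apex; the first two then separate the
  corners of the floor triangle.\<close>

lemma tetrahedron_independent:
  assumes total: "sum w (tetrahedron i j ty s) = 0"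
    and zero: "(\<Sum>v\<in>tetrahedron i j ty s. w v *\<^sub>R grid_pos v) = 0" and v: "v \<in> tetrahedron i j ty s"
  shows "w v = 0"
proof -
  define p q r where "p = (i, j, 0 :: int)" and "q = (i + 1, j + 1, 0 :: int)"
    and "r = (if ty then (i + 1, j, 0 :: int) else (i, j + 1, 0))"
  have tet: "tetrahedron i j ty s = {apex s, p, q, r}" by (simp add: tetrahedron_def p_def q_def r_def)
  have dist: "apex s \<noteq> p" "apex s \<noteq> q" "apex s \<noteq> r" "p \<noteq> q" "p \<noteq> r" "q \<noteq> r"
    by (auto simp: p_def q_def r_def split: if_splits)
  have comp: "w (apex s) * grid_pos (apex s) $ c + (w p * grid_pos p $ c + (w q * grid_pos q $ c + w r * grid_pos r $ c)) = 0" for c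
    using arg_cong [OF zero, of "\<lambda>x. x $ c"] dist unfolding tet by simp
  have sum0: "w (apex s) + (w p + (w q + w r)) = 0" using total dist unfolding tet by simp
  have a: "w (apex s) = 0"
    using comp [of 3] by (simp add: grid_pos_def apex_def p_def q_def r_def split: if_splits)
  have "w p * real_of_int i + (w q * (real_of_int i + 1) + w r * (real_of_int i + (if ty then 1 else 0))) = 0"
    "w p * real_of_int j + (w q * (real_of_int j + 1) + w r * (real_of_int j + (if ty then 0 else 1))) = 0"
    using comp [of 1] comp [of 2] a by (simp_all add: grid_pos_def p_def q_def r_def split: if_splits)
  then have "(w p + w q + w r) * real_of_int i + w q + (if ty then w r else 0) = 0"
    "(w p + w q + w r) * real_of_int j + w q + (if ty then 0 else w r) = 0"
    by (auto simp: algebra_simps)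
  moreover have s0: "w p + w q + w r = 0" using sum0 a by simp
  ultimately have "w q + (if ty then w r else 0) = 0" "w q + (if ty then 0 else w r) = 0" by auto
  then have "w q = 0 \<and> w r = 0" by (cases ty) auto
  then show ?thesis using a s0 v unfolding tet by auto
qed

text \<open>An affine function touching \<open>lift\<close> on a tetrahedron containing
  \<open>k\<close> shows that the coordinates \<open>l\<close> give a mean of \<open>lift\<close> no
  larger than those of any other representation of the same point. By symmetry the means agree, so
  \<open>m\<close> lives on contact points, that is on the same tetrahedron, whose corners are
  independent.\<close>

lemma grid_pos_unique:
  fixes l m :: "point \<Rightarrow> real"
  assumes nn: "\<And>v. 0 \<le> l v" "\<And>v. 0 \<le> m v"
    and supp: "\<And>v. v \<notin> corners k \<Longrightarrow> l v = 0" "\<And>v. v \<notin> corners k' \<Longrightarrow> m v = 0"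
    and one: "sum l (corners k) = 1" "sum m (corners k') = 1"
    and eq: "(\<Sum>v\<in>corners k. l v *\<^sub>R grid_pos v) = (\<Sum>v\<in>corners k'. m v *\<^sub>R grid_pos v)"
  shows "l = m"
proof -
  have dom: "(\<Sum>v\<in>corners k. l v * real_of_int (lift v)) \<le> (\<Sum>v\<in>corners k'. m v * real_of_int (lift v)) \<and>
      ((\<Sum>v\<in>corners k. l v * real_of_int (lift v)) = (\<Sum>v\<in>corners k'. m v * real_of_int (lift v)) \<longrightarrow>
       (\<forall>v. m v \<noteq> 0 \<longrightarrow> v \<in> tetrahedron i j ty s))"
    if nn: "\<And>v. 0 \<le> m v" and supp: "\<And>v. v \<notin> corners k' \<Longrightarrow> m v = 0"
      and one: "sum l (corners k) = 1" "sum m (corners k') = 1"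
      and eq: "(\<Sum>v\<in>corners k. l v *\<^sub>R grid_pos v) = (\<Sum>v\<in>corners k'. m v *\<^sub>R grid_pos v)"
      and tet: "corners k \<subseteq> tetrahedron i j ty s" for l m :: "point \<Rightarrow> real" and k k' i j ty s
  proof -
    define d where "d = (if ty then i - j else i - j - 1)"
    let ?L = "support i j d s"
    note L = support_le_lift [OF _ d_def, of _ s]
    have "(\<Sum>v\<in>corners k. l v * real_of_int (lift v)) = (\<Sum>v\<in>corners k. l v * real_of_int (?L v))"
      by (intro sum.cong refl) (use L(2) tet corners_grid_points in \<open>metis subsetD\<close>)
    also have "\<dots> = (\<Sum>v\<in>corners k'. m v * real_of_int (?L v))"
      by (rule support_sum_eq [OF one eq])
    finally have e: "(\<Sum>v\<in>corners k'. m v * real_of_int (lift v)) - (\<Sum>v\<in>corners k. l v * real_of_int (lift v)) =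
        (\<Sum>v\<in>corners k'. m v * real_of_int (lift v - ?L v))"
      by (simp add: sum_subtractf [symmetric] right_diff_distrib)
    have pos: "0 \<le> m v * real_of_int (lift v - ?L v)" if "v \<in> corners k'" for v
    proof -
      have "?L v \<le> lift v" using L(1) that corners_grid_points by blast
      then show ?thesis using nn by (intro mult_nonneg_nonneg) simp_all
    qed
    have "m v \<noteq> 0 \<longrightarrow> v \<in> tetrahedron i j ty s"
      if "(\<Sum>v\<in>corners k'. m v * real_of_int (lift v - ?L v)) = 0" for v
    proof
      assume v: "m v \<noteq> 0"
      then have vk: "v \<in> corners k'" using supp by blast
      have "\<forall>v\<in>corners k'. m v * real_of_int (lift v - ?L v) = 0"
        using that pos finite_corners by (subst (asm) sum_nonneg_eq_0_iff) auto
      then have "real_of_int (lift v - ?L v) = 0" using vk v by auto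
      then have "?L v = lift v" by simp
      then show "v \<in> tetrahedron i j ty s" using L(2) vk corners_grid_points by blast
    qed
    moreover have "0 \<le> (\<Sum>v\<in>corners k'. m v * real_of_int (lift v - ?L v))" using pos by (rule sum_nonneg)
    ultimately show ?thesis using e by auto
  qed
  obtain i j ty s where tet: "corners k \<subseteq> tetrahedron i j ty s" using corners_tetrahedron by blast
  obtain i' j' ty' s' where tet': "corners k' \<subseteq> tetrahedron i' j' ty' s'" using corners_tetrahedron by blast
  note d1 = dom [OF nn(2) supp(2) one eq tet]
    and d2 = dom [OF nn(1) supp(1) one(2,1) eq [symmetric] tet']
  \<comment> \<open>Equality of the means forces every point with positive weight in
    \<open>m\<close> to be a contact point.\<close>
  have m_tet: "v \<in> tetrahedron i j ty s" if "m v \<noteq> 0" for v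
    using order_antisym [OF conjunct1 [OF d1] conjunct1 [OF d2]] d1 that by blast
  let ?T = "tetrahedron i j ty s"
  have fin: "finite ?T" by (simp add: tetrahedron_def)
  have T: "sum l ?T = 1" "sum m ?T = 1"
    "(\<Sum>v\<in>?T. l v *\<^sub>R grid_pos v) = (\<Sum>v\<in>corners k. l v *\<^sub>R grid_pos v)"
    "(\<Sum>v\<in>?T. m v *\<^sub>R grid_pos v) = (\<Sum>v\<in>corners k'. m v *\<^sub>R grid_pos v)"
  proof -
    show "sum l ?T = 1" unfolding one(1) [symmetric]
      by (rule sum.mono_neutral_right [OF fin tet]) (use supp in auto)
    show "(\<Sum>v\<in>?T. l v *\<^sub>R grid_pos v) = (\<Sum>v\<in>corners k. l v *\<^sub>R grid_pos v)"
      by (rule sum.mono_neutral_right [OF fin tet]) (use supp in auto)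
    show "sum m ?T = 1" unfolding one(2) [symmetric]
      by (rule sum.mono_neutral_cong [OF finite_corners fin _ _ refl]) (use supp(2) m_tet scaleR_eq_0_iff in blast)+
    show "(\<Sum>v\<in>?T. m v *\<^sub>R grid_pos v) = (\<Sum>v\<in>corners k'. m v *\<^sub>R grid_pos v)"
      by (rule sum.mono_neutral_cong [OF finite_corners fin _ _ refl]) (use supp(2) m_tet scaleR_eq_0_iff in blast)+
  qed
  show "l = m"
  proof
    fix v
    show "l v = m v"
    proof (cases "v \<in> ?T")
      case True
      have "(\<lambda>v. l v - m v) v = 0"
      proof (rule tetrahedron_independent [OF _ _ True])
        show "(\<Sum>v\<in>?T. l v - m v) = 0" by (simp add: sum_subtractf T)
        show "(\<Sum>v\<in>?T. (l v - m v) *\<^sub>R grid_pos v) = 0"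
          by (simp add: scaleR_diff_left sum_subtractf T eq)
      qed
      then show ?thesis by simp
    next
      case False
      then have "l v = 0" "m v = 0" using supp(1) tet m_tet by blast+
      then show ?thesis by simp
    qed
  qed
qed

lemma realization_grid_pos:
  assumes I: "finite I" "I \<noteq> {}"
  shows "realization I corners grid_pos"
proof
  show "inj_on corners I" using inj_corners by (rule inj_on_subset) simp
qed (use I card_corners grid_pos_unique in blast)+

subsection \<open>Wiring a graph into the grid\<close>

text \<open>Components of the graph with edges \<open>u i\<close>, \<open>w i\<close>, defined
  without paths: two vertices are equivalent if every function constant along all edges agrees on
  them. This is already the property needed later.\<close>

lemma potential_representatives:
  fixes u w :: "'i \<Rightarrow> 'v"
  obtains rep :: "'v \<Rightarrow> 'v" where "\<And>i. rep (u i) = rep (w i)" "\<And>v. rep (rep v) = rep v"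
    "\<And>(c :: 'v \<Rightarrow> bit) v. (\<And>i. c (u i) = c (w i)) \<Longrightarrow> c (rep v) = c v"
proof -
  define sim where "sim v v' \<longleftrightarrow> (\<forall>c :: 'v \<Rightarrow> bit. (\<forall>i. c (u i) = c (w i)) \<longrightarrow> c v = c v')" for v v'
  define rep where "rep v = (SOME v'. sim v v')" for v
  have "sim v v" for v by (simp add: sim_def)
  then have rep: "sim v (rep v)" for v unfolding rep_def by (rule someI)
  have cong: "rep v = rep v'" if "sim v v'" for v v'
  proof -
    have "sim v = sim v'" using that unfolding sim_def fun_eq_iff by metis
    then show ?thesis by (simp add: rep_def)
  qed
  show ?thesis
  proof (rule that [of rep])
    show "rep (u i) = rep (w i)" for i by (rule cong) (simp add: sim_def)
    show "rep (rep v) = rep v" for v using cong [OF rep] by metis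
    show "c (rep v) = c v" if "\<And>i. c (u i) = c (w i)" for c :: "'v \<Rightarrow> bit" and v
      using rep that unfolding sim_def by metis
  qed
qed

text \<open>Row \<open>i\<close> below the grid is joined to column \<open>u i\<close> above it by the missing triangle
  \<open>LowerTri i (u i)\<close>, and the columns in \<open>R\<close> are joined to the unbounded region by the missing
  triangles \<open>WallY True 0 j\<close>.\<close>

locale wiring =
  fixes N M :: int and u :: "int \<Rightarrow> int" and R :: "int set"
  assumes N: "0 < N" and M: "0 < M" and u: "0 \<le> u i" "u i < M"
begin

text \<open>Below the floor there are walls between all rows, and \<open>WallX False\<close> only
  closes their ends at \<open>j = 0\<close> and \<open>j = M\<close>. Above, columns take the part
  of rows, with ends at \<open>i = 0\<close> and \<open>i = N\<close>.\<close>

fun is_cell :: "cell \<Rightarrow> bool" where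
  "is_cell (LowerTri i j) \<longleftrightarrow> 0 \<le> i \<and> i < N \<and> 0 \<le> j \<and> j < M \<and> j \<noteq> u i"
| "is_cell (UpperTri i j) \<longleftrightarrow> 0 \<le> i \<and> i < N \<and> 0 \<le> j \<and> j < M"
| "is_cell (WallX s i j) \<longleftrightarrow> 0 \<le> i \<and> i < N \<and> (if s then 0 \<le> j \<and> j \<le> M else j = 0 \<or> j = M)"
| "is_cell (WallY s i j) \<longleftrightarrow> 0 \<le> j \<and> j < M \<and> (if s then i = 0 \<and> j \<notin> R \<or> i = N else 0 \<le> i \<and> i \<le> N)"

definition cells :: "cell set" where
  "cells = {k. is_cell k}"

lemma finite_cells: "finite cells"
proof -
  let ?S = "{0..N} \<times> {0..M}"
  have "cells \<subseteq> (\<lambda>(i, j). LowerTri i j) ` ?S \<union> (\<lambda>(i, j). UpperTri i j) ` ?S \<union>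
      (\<lambda>(s, i, j). WallX s i j) ` (UNIV \<times> ?S) \<union> (\<lambda>(s, i, j). WallY s i j) ` (UNIV \<times> ?S)"
  proof
    fix k assume "k \<in> cells"
    then have k: "is_cell k" by (simp add: cells_def)
    show "k \<in> (\<lambda>(i, j). LowerTri i j) ` ?S \<union> (\<lambda>(i, j). UpperTri i j) ` ?S \<union>
      (\<lambda>(s, i, j). WallX s i j) ` (UNIV \<times> ?S) \<union> (\<lambda>(s, i, j). WallY s i j) ` (UNIV \<times> ?S)"
    proof (cases k)
      case (LowerTri i j) then show ?thesis using k by force
    next
      case (UpperTri i j) then show ?thesis using k by force
    next
      case (WallX s i j)
      then have "(s, i, j) \<in> UNIV \<times> ?S" using k M by (auto split: if_splits)
      then show ?thesis unfolding WallX by (intro UnI1 UnI2) (rule image_eqI [of _ _ "(s, i, j)"], simp_all)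
    next
      case (WallY s i j)
      then have "(s, i, j) \<in> UNIV \<times> ?S" using k N by (auto split: if_splits)
      then show ?thesis unfolding WallY by (intro UnI2) (rule image_eqI [of _ _ "(s, i, j)"], simp_all)
    qed
  qed
  then show ?thesis by (rule finite_subset) simp
qed

text \<open>Columns in \<open>R\<close> belong to the unbounded region, which has value 0; the
  values out of range are fixed to make \<open>c\<close> unique.\<close>

definition potential :: "(int \<Rightarrow> bit) \<Rightarrow> bool" where
  "potential c \<longleftrightarrow> (\<forall>j. j < 0 \<or> M \<le> j \<or> j \<in> R \<longrightarrow> c j = 0)"

definition row :: "(int \<Rightarrow> bit) \<Rightarrow> int \<Rightarrow> int \<Rightarrow> bit" where
  "row c i j = (if 0 \<le> i \<and> i < N \<and> 0 \<le> j \<and> j < M then c (u i) else 0)"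

definition col :: "(int \<Rightarrow> bit) \<Rightarrow> int \<Rightarrow> int \<Rightarrow> bit" where
  "col c i j = (if 0 \<le> i \<and> i < N \<and> 0 \<le> j \<and> j < M then c j else 0)"

text \<open>The boundary of the region \<open>c\<close>, where row \<open>i\<close> gets the value of column \<open>u i\<close>.\<close>

fun bounding :: "(int \<Rightarrow> bit) \<Rightarrow> cell \<Rightarrow> bit" where
  "bounding c (LowerTri i j) = row c i j + col c i j"
| "bounding c (UpperTri i j) = row c i j + col c i j"
| "bounding c (WallX s i j) = (if s then col c i j + col c i (j - 1) else row c i j + row c i (j - 1))"
| "bounding c (WallY s i j) = (if s then col c i j + col c (i - 1) j else row c i j + row c (i - 1) j)"

text \<open>Going once around an edge, every region there is entered and left, so its value occurs
  twice.\<close>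

lemma bounding_cycle: "grid_cycle (bounding c)"
proof -
  have bit1: "(r + s) + (r' + s') + (r + r') + (s + s') = (0 :: bit)" for r s r' s'
    by (cases r; cases s; cases r'; cases s') simp_all
  have bit2: "(r1 + r2) + (r3 + r4) + (r1 + r3) + (r2 + r4) = (0 :: bit)" for r1 r2 r3 r4
    by (cases r1; cases r2; cases r3; cases r4) simp_all
  have bit3: "(r1 + s1) + (r2 + s2) + (r2 + r1) + (s2 + s1) = (0 :: bit)" for r1 r2 s1 s2
    by (cases r1; cases r2; cases s1; cases s2) simp_all
  show ?thesis
    unfolding grid_cycle_def by (simp add: bit1 bit2 bit3)
qed

text \<open>Every missing triangle has equal values on its two sides:
  \<open>LowerTri i (u i)\<close> by the choice of the row value, \<open>WallY True 0 j\<close> with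
  \<open>j\<close> in \<open>R\<close> because the potential vanishes there.\<close>

lemma bounding_support:
  assumes c: "potential c" and k: "k \<notin> cells"
  shows "bounding c k = 0"
  using assms u unfolding cells_def potential_def
  by (cases k) (auto simp: row_def col_def)

text \<open>Zeros spread from the end walls over \<open>x = 0\<close>: the equations at edges to the
  upper apex clear the \<open>WallX True\<close> cells along each column, then the
  \<open>WallY True\<close> cells. The floor is next, row by row, and the floor edges finally clear
  the walls below.\<close>

lemma cycle_zero:
  assumes cyc: "grid_cycle x" and off: "\<And>k. k \<notin> cells \<Longrightarrow> x k = 0"
    and zero: "\<And>j. x (WallY True 0 j) = 0"
  shows "x k = 0"
proof -
  have e1: "x (LowerTri i j) + x (UpperTri i (j - 1)) + x (WallX False i j) + x (WallX True i j) = 0"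
    and e2: "x (LowerTri (i - 1) j) + x (UpperTri i j) + x (WallY False i j) + x (WallY True i j) = 0"
    and e3: "x (LowerTri i j) + x (UpperTri i j) = 0"
    and e4: "x (WallX s i j) + x (WallX s (i - 1) j) + x (WallY s i j) + x (WallY s i (j - 1)) = 0" for i j s
    using cyc unfolding grid_cycle_def by blast+
  have off': "x k = 0" if "\<not> is_cell k" for k using off that by (simp add: cells_def)
  have nonneg: "x (WallX True i j) = 0" if "0 \<le> i" for i j
    using that
  proof (induction i rule: int_ge_induct)
    case base
    show ?case using e4 [of True 0 j] zero off' [of "WallX True (- 1) j"] by simp
  next
    case (step i)
    show ?case
    proof (cases "i + 1 < N")
      case True
      then have "x (WallY True (i + 1) j) = 0" "x (WallY True (i + 1) (j - 1)) = 0"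
        using step.hyps by (auto intro!: off')
      then show ?thesis using e4 [of True "i + 1" j] step.IH by simp
    next
      case False
      then show ?thesis by (intro off') simp
    qed
  qed
  have XT: "x (WallX True i j) = 0" for i j
    using nonneg [of i j] off' [of "WallX True i j"] by (cases "0 \<le> i") auto
  have YT: "x (WallY True i j) = 0" for i j
  proof (cases "0 \<le> j")
    case True
    then show ?thesis
    proof (induction j rule: int_ge_induct)
      case base
      show ?case using e4 [of True i 0] XT off' [of "WallY True i (- 1)"] by simp
    next
      case (step j)
      then show ?case using e4 [of True i "j + 1"] XT by simp
    qed
  qed (simp add: off')
  have UL: "x (UpperTri i j) = x (LowerTri i j)" for i j
    using e3 [of i j] by (simp add: bit_add_eq_0_iff)
  \<comment> \<open>Below the floor no wall crosses the inside of a row, so the floor triangles of a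
    row share one value; the missing \<open>LowerTri i (u i)\<close> will make it 0.\<close>
  have row0: "x (LowerTri i j) = x (LowerTri i 0)" if "0 \<le> j" "j < M" for i j
    using that
  proof (induction j rule: int_ge_induct)
    case (step j)
    have "x (WallX False i (j + 1)) = 0" using step by (intro off') simp
    then have "x (LowerTri i (j + 1)) + x (LowerTri i j) = 0"
      using e1 [of i "j + 1"] XT by (simp add: UL)
    then show ?case using step by (simp add: bit_add_eq_0_iff)
  qed simp
  have L: "x (LowerTri i j) = 0" for i j
  proof (cases "0 \<le> j \<and> j < M")
    case True
    have "x (LowerTri i (u i)) = 0" by (intro off') simp
    then show ?thesis using row0 [of "u i" i] row0 [of j i] u True by simp
  next
    case False
    then show ?thesis by (intro off') auto
  qed
  have XF: "x (WallX False i j) = 0" for i j using e1 [of i j] XT L UL by simp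
  have YF: "x (WallY False i j) = 0" for i j using e2 [of i j] YT L UL by simp
  show ?thesis
    using L UL XT XF YT YF by (cases k) (metis (full_types))+
qed

text \<open>The value of column \<open>j\<close> can be read off \<open>WallY True 0 j\<close>,
  which separates it from the outside. Subtracting the bounding cycle of these values leaves a cycle
  that vanishes on all those walls.\<close>

lemma cycle_bounding:
  assumes cyc: "grid_cycle x" and off: "\<And>k. k \<notin> cells \<Longrightarrow> x k = 0"
  obtains c where "potential c" "x = bounding c"
proof -
  define c where "c j = x (WallY True 0 j)" for j
  have pot: "potential c" unfolding potential_def c_def using N by (auto intro!: off simp: cells_def)
  define x' where "x' k = x k + bounding c k" for k
  have "x' k = 0" for k
  proof (rule cycle_zero)
    have add: "(p + p') + (q + q') = (p + q) + (p' + q')" for p p' q q' :: bit by (simp add: ac_simps)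
    show "grid_cycle x'"
      using cyc bounding_cycle [of c] unfolding grid_cycle_def x'_def add by (simp only: add_0_left simp_thms)
    show "x' k = 0" if "k \<notin> cells" for k
      using off [OF that] bounding_support [OF pot that] by (simp add: x'_def)
    show "x' (WallY True 0 j) = 0" for j
      using pot N by (auto simp: x'_def col_def c_def [symmetric] potential_def)
  qed
  then have "x = bounding c" by (auto simp: x'_def bit_add_eq_0_iff)
  then show ?thesis using that pot by blast
qed

lemma bounding_UpperTri:
  "0 \<le> i \<Longrightarrow> i < N \<Longrightarrow> 0 \<le> j \<Longrightarrow> j < M \<Longrightarrow> bounding c (UpperTri i j) = c (u i) + c j"
  by (simp add: row_def col_def)

end

section \<open>Every cut space is represented\<close>

lemma GF2_dim_image:
  fixes L :: "('i \<Rightarrow> bit) \<Rightarrow> 'j \<Rightarrow> bit"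
  assumes L: "Vector_Spaces.linear GF2_scale GF2_scale L" and K: "GF2.subspace K" and inj: "inj_on L K"
  shows "GF2.dim (L ` K) = GF2.dim K"
proof -
  interpret vector_space_pair "GF2_scale :: bit \<Rightarrow> ('i \<Rightarrow> bit) \<Rightarrow> 'i \<Rightarrow> bit"
    "GF2_scale :: bit \<Rightarrow> ('j \<Rightarrow> bit) \<Rightarrow> 'j \<Rightarrow> bit" by unfold_locales
  obtain B where B: "B \<subseteq> K" "GF2.independent B" "K \<subseteq> GF2.span B" "card B = GF2.dim K"
    using GF2.basis_exists by blast
  have span: "GF2.span B = K" using B K by (metis GF2.span_minimal subset_antisym)
  have "GF2.independent (L ` B)"
    using linear_independent_injective_image [OF L B(2)] inj span by simp
  moreover have "GF2.span (L ` B) = GF2.span (L ` K)"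
    using linear_span_image [OF L, of B] linear_span_image [OF L, of K] span GF2.span_span by metis
  ultimately have "GF2.dim (L ` K) = card (L ` B)" using GF2.dim_eq_card by blast
  also have "\<dots> = card B" using card_image inj_on_subset [OF inj B(1)] by blast
  finally show ?thesis using B(4) by simp
qed

lemma subspace_kernel: "GF2.subspace (kernel \<Delta>)"
  unfolding GF2.subspace_def kernel_def GF2_space_def GF2_scale_def
  by (auto simp: sum.distrib distrib_left mult.left_commute [of _ c for c] simp flip: sum_distrib_left)

lemma linear_puncture_relabel:
  fixes \<phi> :: "'j \<Rightarrow> 'i"
  shows "Vector_Spaces.linear GF2_scale GF2_scale
    (\<lambda>x i. if i \<in> A then (if \<phi> i \<in> S then 0 else x (\<phi> i)) else 0)"
  by unfold_locales (auto simp: GF2_scale_def fun_eq_iff)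

text \<open>Edge \<open>i\<close> becomes row \<open>i\<close>, merged with column
  \<open>u i\<close>; its coordinate is the triangle \<open>UpperTri i (w i)\<close> between that
  row and column \<open>w i\<close>, and all other triangles are punctured.\<close>

lemma potentials_imp_representation:
  fixes a b :: "nat \<Rightarrow> nat"
  assumes C: "C = {y \<in> GF2_space {1..n}. \<exists>c. \<forall>i\<in>{1..n}. y i = c (a i) + c (b i)}"
  shows "has_geometric_representation_into TYPE(real^3) n C"
proof -
  define m where "m = Suc (Max (insert 0 (a ` {1..n} \<union> b ` {1..n})))"
  have m: "a i < m" "b i < m" if "i \<in> {1..n}" for i
    using that by (auto simp: m_def less_Suc_eq_le intro!: Max_ge)
  have m0: "0 < m" by (simp add: m_def)
  \<comment> \<open>Indices outside \<open>1..n\<close> become loops at column 0. Row 0 is such a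
    padding row, as edges are numbered from 1; hence \<open>int n + 1\<close> rows.\<close>
  define u w :: "int \<Rightarrow> int"
    where "u i = (if 1 \<le> i \<and> i \<le> int n then int (a (nat i)) else 0)"
      and "w i = (if 1 \<le> i \<and> i \<le> int n then int (b (nat i)) else 0)" for i
  have uw_int: "u (int i) = int (a i)" "w (int i) = int (b i)" if "i \<in> {1..n}" for i
    using that by (simp_all add: u_def w_def)
  have u: "0 \<le> u i" "u i < int m" and w: "0 \<le> w i" "w i < int m" for i
  proof -
    have "nat i \<in> {1..n}" if "1 \<le> i" "i \<le> int n" using that by auto
    then show "0 \<le> u i" "u i < int m" "0 \<le> w i" "w i < int m"
      using m [of "nat i"] m0 by (auto simp: u_def w_def)
  qed
  obtain rep where rep: "\<And>i. rep (u i) = rep (w i)" "\<And>v. rep (rep v) = rep v"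
    "\<And>(c :: int \<Rightarrow> bit) v. (\<And>i. c (u i) = c (w i)) \<Longrightarrow> c (rep v) = c v"
    using potential_representatives [of u w] by metis
  define R where "R = {j. rep j = j}"
  interpret W: wiring "int n + 1" "int m" u R
    by unfold_locales (use u m0 in auto)
  \<comment> \<open>Adding the value at the representative makes the potential vanish on
    \<open>R\<close> and changes no edge difference, since both ends of an edge have the same
    representative.\<close>
  have normalize: "\<exists>c'. W.potential c' \<and> (\<forall>i. c' (u i) + c' (w i) = c (u i) + c (w i))" for c :: "int \<Rightarrow> bit"
  proof (intro exI conjI allI)
    let ?c = "\<lambda>j. if 0 \<le> j \<and> j < int m then c j + c (rep j) else 0"
    show "W.potential ?c" unfolding W.potential_def by (auto simp: R_def)
    have cancel: "p + r + (q + r) = p + q" for p q r :: bit by (cases p; cases q; cases r) simp_all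
    show "?c (u i) + ?c (w i) = c (u i) + c (w i)" for i
      using u [of i] w [of i] by (simp add: rep(1) cancel)
  qed
  \<comment> \<open>The sum of two potentials with the same edge differences is constant along
    edges, hence equals its value at the representative, which is 0.\<close>
  have determined: "c = c'"
    if c: "W.potential c" "W.potential c'" and eq: "\<And>i. c (u i) + c (w i) = c' (u i) + c' (w i)" for c c'
  proof
    fix j
    have rearrange: "p + q = p' + q' \<longleftrightarrow> p + p' = q + q'" for p q p' q' :: bit
      by (cases p; cases q; cases p'; cases q') simp_all
    have "c (rep j) + c' (rep j) = c j + c' j"
      by (rule rep(3)) (use eq in \<open>simp add: rearrange [symmetric]\<close>)
    moreover have "c (rep j) = 0" "c' (rep j) = 0"
      using c rep(2) unfolding W.potential_def by (auto simp: R_def)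
    ultimately show "c j = c' j" by (metis add_0_right bit_add_eq_0_iff)
  qed
  \<comment> \<open>Thanks to the padding row a triangle exists even for
    \<open>n = 0\<close>.\<close>
  have "UpperTri 0 0 \<in> W.cells" using m0 by (simp add: W.cells_def)
  then have I: "finite W.cells" "W.cells \<noteq> {}" using W.finite_cells by auto
  interpret P: realization W.cells corners coordinate_pos by (rule realization_coordinate_pos [OF I])
  interpret Q: realization W.cells corners grid_pos by (rule realization_grid_pos [OF I])
  define \<psi> where "\<psi> k = P.hull_of (corners k)" for k
  have bij: "bij_betw \<psi> W.cells (triangles P.realized)"
    using P.bij_triangles unfolding \<psi>_def .
  define \<phi> where "\<phi> i = \<psi> (UpperTri (int i) (w (int i)))" for i
  have cell: "UpperTri (int i) (w (int i)) \<in> W.cells" if "i \<in> {1..n}" for i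
    using that w by (simp add: W.cells_def)
  define S where "S = triangles P.realized - \<phi> ` {1..n}"
  have \<phi>T: "\<phi> ` {1..n} \<subseteq> triangles P.realized"
    using cell bij_betwE [OF bij] by (auto simp: \<phi>_def)
  have S: "triangles P.realized - S = \<phi> ` {1..n}" using \<phi>T by (auto simp: S_def)
  have \<phi>_bij: "bij_betw \<phi> {1..n} (triangles P.realized - S)"
    unfolding S
  proof (rule inj_on_imp_bij_betw, rule inj_onI)
    fix i j assume "i \<in> {1..n}" "j \<in> {1..n}" "\<phi> i = \<phi> j"
    then have "UpperTri (int i) (w (int i)) = UpperTri (int j) (w (int j))"
      using inj_onD [OF bij_betw_imp_inj_on [OF bij]] cell unfolding \<phi>_def by blast
    then show "i = j" by simp
  qed
  have kernel_iff: "x \<in> kernel P.realized \<longleftrightarrow> (\<exists>c. W.potential c \<and> (\<forall>k\<in>W.cells. x (\<psi> k) = W.bounding c k))"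
    if x: "x \<in> GF2_space (triangles P.realized)" for x
  proof -
    define y where "y k = (if k \<in> W.cells then x (\<psi> k) else 0)" for k
    have "x \<in> kernel P.realized \<longleftrightarrow>
        (\<forall>E. card E = 2 \<longrightarrow> (\<Sum>k | k \<in> W.cells \<and> E \<subseteq> corners k. x (\<psi> k)) = 0)"
      unfolding \<psi>_def by (rule P.kernel_realized [OF x])
    also have "\<dots> \<longleftrightarrow> (\<forall>E. card E = 2 \<longrightarrow> (\<Sum>k | k \<in> W.cells \<and> E \<subseteq> corners k. y k) = 0)"
    proof -
      have "(\<Sum>k | k \<in> W.cells \<and> E \<subseteq> corners k. x (\<psi> k)) = (\<Sum>k | k \<in> W.cells \<and> E \<subseteq> corners k. y k)" for E
        by (intro sum.cong) (simp_all add: y_def)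
      then show ?thesis by simp
    qed
    also have "\<dots> \<longleftrightarrow> grid_cycle y" by (rule grid_cycle_iff [OF I(1)]) (simp add: y_def)
    also have "\<dots> \<longleftrightarrow> (\<exists>c. W.potential c \<and> (\<forall>k\<in>W.cells. x (\<psi> k) = W.bounding c k))"
    proof
      assume "grid_cycle y"
      then obtain c where "W.potential c" "y = W.bounding c"
        by (rule W.cycle_bounding) (simp_all add: y_def)
      then show "\<exists>c. W.potential c \<and> (\<forall>k\<in>W.cells. x (\<psi> k) = W.bounding c k)"
        by (metis y_def)
    next
      assume "\<exists>c. W.potential c \<and> (\<forall>k\<in>W.cells. x (\<psi> k) = W.bounding c k)"
      then obtain c where c: "W.potential c" "\<forall>k\<in>W.cells. x (\<psi> k) = W.bounding c k" by blast
      have "y = W.bounding c"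
        using c W.bounding_support [OF c(1)] by (auto simp: y_def fun_eq_iff)
      then show "grid_cycle y" using W.bounding_cycle by simp
    qed
    finally show ?thesis .
  qed
  define L where "L = (\<lambda>x i. if i \<in> {1..n} then (if \<phi> i \<in> S then 0 else x (\<phi> i)) else (0 :: bit))"
  have L_relabel: "L ` K = relabel n \<phi> (puncture K S)" for K
    by (simp add: L_def relabel_def puncture_def image_image)
  have L_bounding: "L x i = c (u (int i)) + c (w (int i))"
    if i: "i \<in> {1..n}" and x: "\<forall>k\<in>W.cells. x (\<psi> k) = W.bounding c k" for x c i
  proof -
    have "\<phi> i \<notin> S" using i by (auto simp: S_def)
    then have "L x i = x (\<phi> i)" using i by (simp add: L_def)
    also have "\<dots> = W.bounding c (UpperTri (int i) (w (int i)))"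
      using x cell [OF i] by (simp add: \<phi>_def)
    also have "\<dots> = c (u (int i)) + c (w (int i))"
      using i w by (intro W.bounding_UpperTri) auto
    finally show ?thesis .
  qed
  have supp: "kernel P.realized \<subseteq> GF2_space (triangles P.realized)" by (auto simp: kernel_def)
  have "C = L ` kernel P.realized"
  proof (intro equalityI subsetI)
    fix y assume "y \<in> C"
    then obtain c where y: "y \<in> GF2_space {1..n}" and c: "\<forall>i\<in>{1..n}. y i = c (a i) + c (b i)"
      unfolding C by blast
    obtain c' where c': "W.potential c'"
      "\<And>i. c' (u i) + c' (w i) = (\<lambda>j. c (nat j)) (u i) + (\<lambda>j. c (nat j)) (w i)"
      using normalize [of "\<lambda>j. c (nat j)"] by blast
    define x where "x t = (if t \<in> triangles P.realized then W.bounding c' (inv_into W.cells \<psi> t) else 0)" for t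
    have x: "x \<in> GF2_space (triangles P.realized)" by (simp add: x_def GF2_space_def)
    have xb: "\<forall>k\<in>W.cells. x (\<psi> k) = W.bounding c' k"
      using bij_betwE [OF bij] bij_betw_inv_into_left [OF bij] by (simp add: x_def)
    have "x \<in> kernel P.realized" using kernel_iff [OF x] c'(1) xb by blast
    moreover have "L x = y"
    proof
      fix i
      show "L x i = y i"
      proof (cases "i \<in> {1..n}")
        case True
        then show ?thesis using L_bounding [OF True xb] c'(2) [of "int i"] c uw_int by simp
      next
        case False
        then have "y i = 0" using y by (simp add: GF2_space_def)
        then show ?thesis unfolding L_def if_not_P [OF False] ..
      qed
    qed
    ultimately show "y \<in> L ` kernel P.realized" by blast
  next
    fix y assume "y \<in> L ` kernel P.realized"
    then obtain x where x: "x \<in> kernel P.realized" "y = L x" by blast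
    then obtain c where c: "\<forall>k\<in>W.cells. x (\<psi> k) = W.bounding c k" using kernel_iff supp by blast
    show "y \<in> C"
      unfolding C
    proof (intro CollectI conjI exI [of _ "\<lambda>j. c (int j)"] ballI)
      show "y \<in> GF2_space {1..n}" by (simp add: x(2) L_def GF2_space_def)
      show "y i = c (int (a i)) + c (int (b i))" if "i \<in> {1..n}" for i
        using L_bounding [OF that c] uw_int [OF that] by (simp add: x(2))
    qed
  qed
  moreover have "GF2.dim (L ` kernel P.realized) = GF2.dim (kernel P.realized)"
  \<comment> \<open>A word gives the edge differences, these determine the normalized potential, and
    the potential determines the whole cycle.\<close>
  proof (rule GF2_dim_image)
    show "Vector_Spaces.linear GF2_scale GF2_scale L" unfolding L_def by (rule linear_puncture_relabel)
    show "inj_on L (kernel P.realized)"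
    proof (rule inj_onI)
      fix x x' assume x: "x \<in> kernel P.realized" "x' \<in> kernel P.realized" "L x = L x'"
      obtain c c' where c: "W.potential c" "\<forall>k\<in>W.cells. x (\<psi> k) = W.bounding c k"
        and c': "W.potential c'" "\<forall>k\<in>W.cells. x' (\<psi> k) = W.bounding c' k"
        using kernel_iff supp x(1,2) by (meson subsetD)
      have "c = c'"
      proof (rule determined [OF c(1) c'(1)])
        fix i
        show "c (u i) + c (w i) = c' (u i) + c' (w i)"
        proof (cases "1 \<le> i \<and> i \<le> int n")
          case True
          then have "nat i \<in> {1..n}" "int (nat i) = i" by auto
          then show ?thesis using L_bounding [OF _ c(2)] L_bounding [OF _ c'(2)] x(3) by metis
        next
          case False
          then have "u i = 0" "w i = 0" unfolding u_def w_def by (simp_all only: if_False)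
          then show ?thesis by simp
        qed
      qed
      show "x = x'"
      proof
        fix t
        show "x t = x' t"
        proof (cases "t \<in> triangles P.realized")
          case True
          then obtain k where "k \<in> W.cells" "t = \<psi> k"
            unfolding bij_betw_imp_surj_on [OF bij, symmetric] by blast
          then show ?thesis using c(2) c'(2) \<open>c = c'\<close> by simp
        next
          case False
          moreover have "x \<in> GF2_space (triangles P.realized)" "x' \<in> GF2_space (triangles P.realized)"
            using x(1,2) supp by blast+
          ultimately show ?thesis by (simp add: GF2_space_def)
        qed
      qed
    qed
  qed (rule subspace_kernel)
  ultimately have "geometric_representation n C P.realized S"
    unfolding geometric_representation_def
    using P.triangular_realized \<phi>_bij L_relabel [of "kernel P.realized"] by (auto simp: S_def)
  moreover have "embeddable_into TYPE(real^3) P.realized"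
    unfolding embeddable_into_def
    using Q.triangular_realized complex_iso_realized [OF P.realization_axioms Q.realization_axioms] by blast
  ultimately show ?thesis unfolding has_geometric_representation_into_def by blast
qed

lemma cut_space_imp_representation:
  fixes V :: "nat set"
  assumes "graph V {1..n} ends"
  shows "has_geometric_representation_into TYPE(real^3) n (cut_space V {1..n} ends)"
proof -
  have "\<forall>i. \<exists>p q. ends i = Upair p q" by (metis uprod_exhaust)
  then obtain a b where ab: "\<And>i. ends i = Upair (a i) (b i)" by metis
  show ?thesis
  proof (rule potentials_imp_representation)
    show "cut_space V {1..n} ends =
        {y \<in> GF2_space {1..n}. \<exists>c. \<forall>i\<in>{1..n}. y i = c (a i) + c (b i)}"
    proof (rule cut_space_eq_potentials)
      show "a i \<in> V \<and> b i \<in> V" if "i \<in> {1..n}" for i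
      proof -
        have "set_uprod (ends i) \<subseteq> V" using assms that by (simp add: graph_def)
        then show ?thesis by (simp add: ab)
      qed
    qed (rule ab)
  qed
qed

theorem theorem4:
  fixes n :: nat and C :: "(nat \<Rightarrow> bit) set"
  assumes "binary_linear_code n C"
  shows "has_geometric_representation_into TYPE(real ^ 3) n C \<longleftrightarrow>
    (\<exists>(V :: nat set) (ends :: nat \<Rightarrow> nat uprod).
       graph V {1..n} ends \<and> C = cut_space V {1..n} ends)"
  using representation_imp_cut_space cut_space_imp_representation by blast

end
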